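(* Let $\alpha\in\mathbb{R}\setminus\mathbb{Q}$ with $0\le\beta(\alpha)<\infty$ and let $\lambda\in\mathbb{R}\setminus\{0\}$. Let $E_0\in\Sigma_{\lambda,\alpha}$ and $A_{E_0}=S_{\lambda,E_0}$. Suppose that $2\rho(\alpha,A_{E_0})\in\alpha\mathbb{Z}+\mathbb{Z}$ and that $(\alpha,A_{E_0})$ is analytically reducible in $|\Im x|<\eta$ for some $\eta>6\beta(\alpha)$. Then $E_0$ is an endpoint of some gap of $\Sigma_{\lambda,\alpha}$.
   Context: $(H_{\lambda,\alpha,\theta}u)_n=u_{n+1}+u_{n-1}+2\lambda\cos 2\pi(\theta+n\alpha)u_n$ on $\ell^2(\mathbb{Z})$; for irrational $\alpha$ its spectrum is independent of $\theta$ and denoted $\Sigma_{\lambda,\alpha}$. A gap of $\Sigma_{\lambda,\alpha}$ is a connected component of $\mathbb{R}\setminus\Sigma_{\lambda,\alpha}$ (unbounded components included). $\beta(\alpha)=\limsup_{n\to\infty}\frac{\ln q_{n+1}}{q_n}$, with $p_n/q_n$ the continued fraction convergents of $\alpha$. $S_{\lambda,E}(x)=\begin{pmatrix}E-2\lambda\cos 2\pi x&-1\\1&0\end{pmatrix}$. $(\alpha,A)$ is analytically reducible in $|\Im x|<\eta$ if there is $B:\mathbb{R}/\mathbb{Z}\to\mathrm{PSL}(2,\mathbb{R})$ (a matrix function on $\mathbb{R}$ with real entries, $\det B=1$, $B(x+1)=\pm B(x)$ with one fixed sign) extending analytically to $|\Im x|<\eta$ such that $B(x+\alpha)^{-1}A(x)B(x)$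 is constant. Rotation number: for $A:\mathbb{R}/\mathbb{Z}\to\mathrm{SL}(2,\mathbb{R})$ continuous and homotopic to the identity (as $S_{\lambda,E}$ is), consider the map $(x,\varphi)\mapsto(x+\alpha,\varphi')$ on $\mathbb{R}/\mathbb{Z}\times\mathbb{R}/\frac12\mathbb{Z}$, where $A(x)(\cos 2\pi\varphi,\sin 2\pi\varphi)^T$ spans the line of direction $(\cos 2\pi\varphi',\sin 2\pi\varphi')^T$. It has a continuous lift $\tilde T(x,\varphi)=(x+\alpha,\tilde\varphi(x,\varphi))$ to $\mathbb{R}\times\mathbb{R}$ such that $\tilde\varphi(x,\varphi)-\varphi$ is $1$-periodic in $x$ and $\frac12$-periodic in $\varphi$. Then $\rho(\alpha,A)=\limsup_{n\to\infty}\frac1n(p_2\circ\tilde T^n(x,\varphi)-\varphi)\bmod\frac12\mathbb{Z}$, where $p_2(x,\varphi)=\varphi$; it does not depend on $(x,\varphi)$. In particular $2\rho(\alpha,A)$ is well defined modulo $\mathbb{Z}$. *)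

theory Defs
  imports "HOL-Complex_Analysis.Complex_Analysis"
begin

definition ell2 :: "(int \<Rightarrow> complex) set" where
  "ell2 = {u. (\<lambda>n. (cmod (u n))\<^sup>2) summable_on UNIV}"

definition ell2_norm :: "(int \<Rightarrow> complex) \<Rightarrow> real" where
  "ell2_norm u = sqrt (\<Sum>\<^sub>\<infinity>n. (cmod (u n))\<^sup>2)"

definition bounded_operator :: "((int \<Rightarrow> complex) \<Rightarrow> (int \<Rightarrow> complex)) \<Rightarrow> bool" where
  "bounded_operator T \<longleftrightarrow>
     (\<forall>u\<in>ell2. T u \<in> ell2) \<and>
     (\<forall>u\<in>ell2. \<forall>v\<in>ell2. T (\<lambda>n. u n + v n) = (\<lambda>n. T u n + T v n)) \<and>
     (\<forall>c. \<forall>u\<in>ell2. T (\<lambda>n. c * u n) = (\<lambda>n. c * T u n)) \<and>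
     (\<exists>K. \<forall>u\<in>ell2. ell2_norm (T u) \<le> K * ell2_norm u)"

definition operator_spectrum :: "((int \<Rightarrow> complex) \<Rightarrow> (int \<Rightarrow> complex)) \<Rightarrow> complex set" where
  "operator_spectrum T =
     {z. \<not> (\<exists>R. bounded_operator R \<and>
              (\<forall>u\<in>ell2. R (\<lambda>n. T u n - z * u n) = u) \<and>
              (\<forall>u\<in>ell2. (\<lambda>n. T (R u) n - z * R u n) = u))}"

definition almost_mathieu :: "real \<Rightarrow> real \<Rightarrow> real \<Rightarrow> (int \<Rightarrow> complex) \<Rightarrow> (int \<Rightarrow> complex)" where
  "almost_mathieu lam \<alpha> \<theta> u =
     (\<lambda>n. u (n + 1) + u (n - 1)
          + complex_of_real (2 * lam * cos (2 * pi * (\<theta> + of_int n * \<alpha>))) * u n)"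

text \<open>The operator is self-adjoint, so its spectrum is real and nothing is lost by
  restricting to real energies. For irrational \<open>\<alpha>\<close> the set does not depend on \<open>\<theta>\<close>.\<close>

definition amo_spectrum :: "real \<Rightarrow> real \<Rightarrow> real \<Rightarrow> real set" where
  "amo_spectrum lam \<alpha> \<theta> =
     {E. complex_of_real E \<in> operator_spectrum (almost_mathieu lam \<alpha> \<theta>)}"

definition is_gap :: "real set \<Rightarrow> real set \<Rightarrow> bool" where
  "is_gap S G \<longleftrightarrow> G \<in> components (UNIV - S)"

text \<open>Only finite endpoints of an interval \<open>G\<close> qualify; \<open>Inf\<close> and \<open>Sup\<close> on the reals are
  meaningful only under the boundedness conditions.\<close>

definition is_endpoint :: "real \<Rightarrow> real set \<Rightarrow> bool" where
  "is_endpoint E G \<longleftrightarrow>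
     G \<noteq> {} \<and> ((bdd_below G \<and> E = Inf G) \<or> (bdd_above G \<and> E = Sup G))"

text \<open>Complete quotients of \<open>\<alpha>\<close>; the partial quotients are their integer parts.\<close>

fun cf_complete :: "real \<Rightarrow> nat \<Rightarrow> real" where
  "cf_complete \<alpha> 0 = \<alpha>"
| "cf_complete \<alpha> (Suc n) = 1 / frac (cf_complete \<alpha> n)"

definition cf_partial :: "real \<Rightarrow> nat \<Rightarrow> int" where
  "cf_partial \<alpha> n = \<lfloor>cf_complete \<alpha> n\<rfloor>"

text \<open>Denominators \<open>q\<^sub>n\<close> of the convergents \<open>p\<^sub>n / q\<^sub>n = [a\<^sub>0; a\<^sub>1, \<dots>, a\<^sub>n]\<close>.\<close>

fun cf_denom :: "real \<Rightarrow> nat \<Rightarrow> int" where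
  "cf_denom \<alpha> 0 = 1"
| "cf_denom \<alpha> (Suc 0) = cf_partial \<alpha> 1"
| "cf_denom \<alpha> (Suc (Suc n)) =
     cf_partial \<alpha> (Suc (Suc n)) * cf_denom \<alpha> (Suc n) + cf_denom \<alpha> n"

definition cf_beta :: "real \<Rightarrow> ereal" where
  "cf_beta \<alpha> =
     limsup (\<lambda>n. ereal (ln (of_int (cf_denom \<alpha> (Suc n))) / of_int (cf_denom \<alpha> n)))"

definition schrodinger_matrix :: "real \<Rightarrow> real \<Rightarrow> real \<Rightarrow> real^2^2" where
  "schrodinger_matrix lam E x =
     vector [vector [E - 2 * lam * cos (2 * pi * x), -1], vector [1, 0]]"

text \<open>\<open>F\<close> is the analytic extension of the real conjugacy \<open>B\<close>, which is a map into
  \<open>PSL(2,\<real>)\<close> in that it may change sign over a period.\<close>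

definition analytically_reducible :: "real \<Rightarrow> (real \<Rightarrow> real^2^2) \<Rightarrow> real \<Rightarrow> bool" where
  "analytically_reducible \<alpha> A \<eta> \<longleftrightarrow>
     (\<exists>(B :: real \<Rightarrow> real^2^2) (F :: complex \<Rightarrow> complex^2^2) (C :: real^2^2).
        (\<forall>x. det (B x) = 1) \<and>
        ((\<forall>x. B (x + 1) = B x) \<or> (\<forall>x. B (x + 1) = - B x)) \<and>
        (\<forall>i j. (\<lambda>z. F z $ i $ j) analytic_on {z. \<bar>Im z\<bar> < \<eta>}) \<and>
        (\<forall>x i j. F (complex_of_real x) $ i $ j = complex_of_real (B x $ i $ j)) \<and>
        (\<forall>x. matrix_inv (B (x + \<alpha>)) ** A x ** B x = C))"

definition direction :: "real \<Rightarrow> real^2" where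
  "direction \<phi> = vector [cos (2 * pi * \<phi>), sin (2 * pi * \<phi>)]"

text \<open>\<open>f\<close> is the second component of a continuous lift
  \<open>(x, \<phi>) \<mapsto> (x + \<alpha>, f (x, \<phi>))\<close> of the projective action of the cocycle.\<close>

definition is_projective_lift :: "(real \<Rightarrow> real^2^2) \<Rightarrow> (real \<times> real \<Rightarrow> real) \<Rightarrow> bool" where
  "is_projective_lift A f \<longleftrightarrow>
     continuous_on UNIV f \<and>
     (\<forall>x \<phi>. span {A x *v direction \<phi>} = span {direction (f (x, \<phi>))}) \<and>
     (\<forall>x \<phi>. f (x + 1, \<phi>) - \<phi> = f (x, \<phi>) - \<phi>) \<and>
     (\<forall>x \<phi>. f (x, \<phi> + 1/2) - (\<phi> + 1/2) = f (x, \<phi>) - \<phi>)"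

definition lift_map :: "real \<Rightarrow> (real \<times> real \<Rightarrow> real) \<Rightarrow> real \<times> real \<Rightarrow> real \<times> real" where
  "lift_map \<alpha> f = (\<lambda>(x, \<phi>). (x + \<alpha>, f (x, \<phi>)))"

text \<open>The rotation number is only defined modulo \<open>1/2\<close>, so it is represented by the set of
  its real representatives, a coset of \<open>(1/2)\<int>\<close>. Letting the lift and the starting point
  range over all choices does not enlarge the coset: two lifts differ by a constant in
  \<open>(1/2)\<int>\<close>, and the upper limit does not depend on \<open>(x, \<phi>)\<close>.\<close>

definition rotation_number :: "real \<Rightarrow> (real \<Rightarrow> real^2^2) \<Rightarrow> real set" where
  "rotation_number \<alpha> A =
     {r. \<exists>f x \<phi>. \<exists>k::int. is_projective_lift A f \<and>
           limsup (\<lambda>n. ereal ((snd ((lift_map \<alpha> f ^^ n) (x, \<phi>)) - \<phi>) / real n))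
             = ereal (r + of_int k / 2)}"

end

theory Submission
  imports Defs
begin

text \<open>Write \<open>B(x + \<alpha>) C = A(x) B(x)\<close> with \<open>C\<close> constant. If \<open>C\<close> is hyperbolic, there are solutions
  decaying at either end and \<open>E\<^sub>0\<close> lies in the resolvent set. If \<open>C\<close> is elliptic, the condition on the
  rotation number lets one conjugate \<open>C\<close> to \<open>\<plusminus>1\<close>; in that case the entries of the first row of \<open>B\<close>
  yield, by Aubry duality, two independent decaying solutions of a dual difference equation,
  which is impossible because their Wronskian is constant and tends to zero. Hence \<open>C\<close> is
  parabolic. Perturbing the energy by \<open>- w \<delta>\<^sup>2\<close>, where the sign of \<open>w\<close> is that of the off-diagonal
  entry, turns the conjugated and rescaled cocycle into \<open>1 + \<delta> ((0, 1), (g\<^sup>2, 0)) + O(\<delta>\<^sup>2)\<close> with \<open>g\<close>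
  the first entry of \<open>B\<close>. A bounded coboundary makes \<open>g\<^sup>2\<close> strictly positive, so for small \<open>\<delta>\<close> the
  cocycle has positive entries, hence is uniformly hyperbolic, and all energies on one side of
  \<open>E\<^sub>0\<close> lie in the resolvent set.\<close>

section \<open>Green functions\<close>

text \<open>The scaling balances sizes. At \<open>E\<^sub>0\<close> the conjugated cocycle is, up to
  sign, a constant shear with upper right entry 1, and an energy shift of size t creates a lower
  left entry of size t times the square of \<open>g\<close>. Multiplying one coordinate by \<delta>,
  with t = \<delta>^2, makes both off-diagonal entries of order \<delta>, against diagonal errors of
  order \<delta>^2. Off-diagonal entries of equal sign preserve a cone, while opposite signs would
  rotate vectors; this is why only one side of \<open>E\<^sub>0\<close> is reached. The obstacle is
  that \<open>g\<close> may vanish, so that the lower left entry is only nonnegative. Irrationality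
  of \<alpha> brings every orbit back to a place where \<open>g\<close> is nonzero, and the
  coboundary spreads this positivity evenly. The matrix \<open>B\<close> may change sign over a
  period, but the square of \<open>g\<close> does not see it. Trace 2 or -2 does not by itself yield
  a shear: \<open>C\<close> equal to 1 or -1 has to be excluded as well, and there the duality
  argument applies directly, with the columns of \<open>B\<close> as they stand.\<close>

lemma summable_on_int_geometric:
  fixes r :: real
  assumes "0 \<le> r" "r < 1"
  shows "(\<lambda>k::int. r ^ nat \<bar>k\<bar>) summable_on UNIV"
proof -
  have nat: "(\<lambda>n::nat. r ^ n) summable_on UNIV"
    using assms by (simp add: summable_on_UNIV_nonneg_real_iff summable_geometric)
  have inj: "inj int" "inj (\<lambda>n. - int n)"
    by (auto simp: inj_def)
  have cover: "(UNIV::int set) = range int \<union> range (\<lambda>n. - int n)"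
  proof (intro UNIV_eq_I)
    show "k \<in> range int \<union> range (\<lambda>n. - int n)" for k
      by (cases k rule: int_cases2) auto
  qed
  have "(\<lambda>k::int. r ^ nat \<bar>k\<bar>) summable_on range int"
    using nat by (subst summable_on_reindex) (use inj in \<open>auto simp: o_def\<close>)
  moreover have "(\<lambda>k::int. r ^ nat \<bar>k\<bar>) summable_on range (\<lambda>n. - int n)"
    using nat by (subst summable_on_reindex) (use inj in \<open>auto simp: o_def\<close>)
  ultimately show ?thesis
    unfolding cover by (rule summable_on_union)
qed

lemma ell2_summable: "u \<in> ell2 \<Longrightarrow> (\<lambda>n. (cmod (u n))\<^sup>2) summable_on UNIV"
  by (simp add: ell2_def)

lemma kernel_row_summable:
  fixes G :: "int \<Rightarrow> int \<Rightarrow> complex"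
  assumes r: "0 \<le> r" "r < 1" and G: "\<And>m n. cmod (G m n) \<le> K * r ^ nat \<bar>m - n\<bar>"
    and f: "f \<in> ell2"
  shows "(\<lambda>n. cmod (G m n * f n)) summable_on UNIV"
proof (rule abs_summable_product)
  have bij: "bij (\<lambda>n. m - n)"
    by (rule bij_betwI[of _ _ _ "\<lambda>n. m - n"]) auto
  have "(\<lambda>n. K\<^sup>2 * (r\<^sup>2) ^ nat \<bar>m - n\<bar>) summable_on UNIV"
    using summable_on_int_geometric[of "r\<^sup>2"] r
      summable_on_reindex_bij_betw[OF bij, of "\<lambda>k. (r\<^sup>2) ^ nat \<bar>k\<bar>"]
    by (intro summable_on_cmult_right) (auto simp: abs_square_less_1)
  then show "(\<lambda>n. cmod (G m n * G m n)) summable_on UNIV"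
  proof (rule Infinite_Sum.abs_summable_on_comparison_test')
    fix n
    have "cmod (G m n * G m n) = (cmod (G m n))\<^sup>2"
      by (simp add: norm_mult power2_eq_square)
    also have "\<dots> \<le> (K * r ^ nat \<bar>m - n\<bar>)\<^sup>2"
      by (intro power_mono G) auto
    finally show "cmod (G m n * G m n) \<le> K\<^sup>2 * (r\<^sup>2) ^ nat \<bar>m - n\<bar>"
      by (simp add: power_mult_distrib power_mult [symmetric] mult.commute)
  qed
  show "(\<lambda>n. cmod (f n * f n)) summable_on UNIV"
    using ell2_summable[OF f] by (simp add: norm_mult power2_eq_square)
qed

text \<open>Schur test: Cauchy--Schwarz with the weight \<open>r ^ \<bar>m - n\<bar>\<close>, then summation over \<open>m\<close> first.\<close>

lemma bounded_operator_kernel: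
  fixes G :: "int \<Rightarrow> int \<Rightarrow> complex"
  assumes r: "0 \<le> r" "r < 1" and G: "\<And>m n. cmod (G m n) \<le> K * r ^ nat \<bar>m - n\<bar>"
  shows "bounded_operator (\<lambda>f m. \<Sum>\<^sub>\<infinity>n. G m n * f n)" (is "bounded_operator ?R")
proof -
  have K: "0 \<le> K"
    using order_trans[OF norm_ge_zero G[of 0 0]] by simp
  define k where "k j = K * r ^ nat \<bar>j\<bar>" for j :: int
  have k0: "0 \<le> k j" for j
    using K r by (simp add: k_def)
  have ksum: "k summable_on UNIV"
    unfolding k_def using summable_on_int_geometric[OF r] by (rule summable_on_cmult_right)
  define S where "S = (\<Sum>\<^sub>\<infinity>j. k j)"
  have S0: "0 \<le> S"
    unfolding S_def using k0 by (simp add: infsum_nonneg)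
  have kr: "((\<lambda>m. k (m - n)) has_sum S) UNIV" for n
    using has_sum_reindex_bij_betw[of "\<lambda>m. m - n" UNIV UNIV k S] ksum
    by (simp add: S_def bij_diff_right has_sum_infsum)
  have kc: "((\<lambda>n. k (m - n)) has_sum S) UNIV" for m
  proof -
    have "bij (\<lambda>n. m - n)"
      by (rule bij_betwI[of _ _ _ "\<lambda>n. m - n"]) auto
    then show ?thesis
      using has_sum_reindex_bij_betw[of "\<lambda>n. m - n" UNIV UNIV k S] ksum
      by (simp add: S_def has_sum_infsum)
  qed
  have main: "?R f \<in> ell2 \<and> ell2_norm (?R f) \<le> S * ell2_norm f" if f: "f \<in> ell2" for f
  proof -
    define F where "F n = (cmod (f n))\<^sup>2" for n
    have F0: "0 \<le> F n" for n by (simp add: F_def)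
    have Fs: "F summable_on UNIV" using ell2_summable[OF f] by (simp add: F_def[abs_def])
    define N where "N = (\<Sum>\<^sub>\<infinity>n. F n)"
    have Fh: "(F has_sum N) UNIV" using Fs by (simp add: N_def)
    have dbl: "((\<lambda>(n, m). k (m - n) * F n) has_sum S * N) (UNIV \<times> UNIV)"
    proof (rule has_sum_SigmaI)
      show "((\<lambda>m. case (n, m) of (n, m) \<Rightarrow> k (m - n) * F n) has_sum S * F n) UNIV" for n
        using has_sum_cmult_left[OF kr] by simp
      show "((\<lambda>n. S * F n) has_sum S * N) UNIV"
        using Fh by (rule has_sum_cmult_right)
      show "(\<lambda>(n, m). k (m - n) * F n) summable_on UNIV \<times> UNIV"
      proof (rule summable_on_SigmaI)
        show "((\<lambda>m. case (n, m) of (n, m) \<Rightarrow> k (m - n) * F n) has_sum S * F n) UNIV" for n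
          using has_sum_cmult_left[OF kr] by simp
        show "(\<lambda>n. S * F n) summable_on UNIV"
          using Fs by (rule summable_on_cmult_right)
      qed (use k0 F0 in auto)
    qed
    \<comment> \<open>Cauchy--Schwarz bounds the square of the entry \<open>?R f m\<close> by
      \<open>S * T m\<close>; as the \<open>T m\<close> add up to \<open>S * N\<close>, the operator
      norm is at most \<open>S\<close>.\<close>
    define T where "T m = (\<Sum>\<^sub>\<infinity>n. k (m - n) * F n)" for m
    have dbl': "((\<lambda>(m, n). k (m - n) * F n) has_sum S * N) (UNIV \<times> UNIV)"
      using dbl by (subst has_sum_swap) (simp add: case_prod_unfold)
    have rowsum: "(\<lambda>n. k (m - n) * F n) summable_on UNIV" for m
      using summable_on_SigmaD1[OF has_sum_imp_summable[OF dbl'], of m] k0 F0 by auto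
    have Th: "(T has_sum S * N) UNIV"
    proof (rule has_sum_Sigma'[OF dbl'])
      show "((\<lambda>n. case (m, n) of (m, n) \<Rightarrow> k (m - n) * F n) has_sum T m) UNIV" for m
        using rowsum[of m] by (simp add: T_def)
    qed
    have T0: "0 \<le> T m" for m
      unfolding T_def using k0 F0 by (simp add: infsum_nonneg)
    have pt: "(cmod (?R f m))\<^sup>2 \<le> S * T m" for m
    proof -
      have abs: "(\<lambda>n. cmod (G m n * f n)) summable_on UNIV"
        by (rule kernel_row_summable[OF r G f])
      have "cmod (?R f m) \<le> (\<Sum>\<^sub>\<infinity>n. cmod (G m n * f n))"
        using abs by (rule norm_infsum_bound)
      also have "\<dots> \<le> sqrt (S * T m)"
      proof (rule infsum_le_finite_sums[OF abs])
        fix A :: "int set" assume A: "finite A"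
        have "(\<Sum>n\<in>A. cmod (G m n * f n)) \<le> (\<Sum>n\<in>A. sqrt (k (m - n)) * (sqrt (k (m - n)) * cmod (f n)))"
          using G by (intro sum_mono)
            (simp add: norm_mult mult.assoc[symmetric] k0 mult_right_mono k_def[symmetric])
        also have "\<dots> \<le> sqrt (\<Sum>n\<in>A. (sqrt (k (m - n)))\<^sup>2) * sqrt (\<Sum>n\<in>A. (sqrt (k (m - n)) * cmod (f n))\<^sup>2)"
          using L2_set_mult_ineq[where A = A and f = "\<lambda>n. sqrt (k (m - n))" and g = "\<lambda>n. sqrt (k (m - n)) * cmod (f n)"]
          by (simp add: L2_set_def k0)
        also have "\<dots> = sqrt ((\<Sum>n\<in>A. k (m - n)) * (\<Sum>n\<in>A. k (m - n) * F n))"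
          by (simp add: k0 power_mult_distrib F_def real_sqrt_mult)
        also have "\<dots> \<le> sqrt (S * T m)"
        proof -
          have "(\<Sum>n\<in>A. k (m - n)) \<le> S"
            using A k0 by (intro finite_sum_le_has_sum[OF kc]) auto
          moreover have "(\<Sum>n\<in>A. k (m - n) * F n) \<le> T m"
            unfolding T_def using A k0 F0 by (intro finite_sum_le_infsum rowsum) auto
          ultimately show ?thesis
            using S0 k0 F0 by (auto intro!: mult_mono sum_nonneg)
        qed
        finally show "(\<Sum>n\<in>A. cmod (G m n * f n)) \<le> sqrt (S * T m)" .
      qed
      finally show ?thesis
        using S0 T0 by (metis mult_nonneg_nonneg norm_ge_zero power_mono real_sqrt_pow2)
    qed
    have STh: "((\<lambda>m. S * T m) has_sum S * (S * N)) UNIV"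
      by (rule has_sum_cmult_right[OF Th])
    have sm: "(\<lambda>m. (cmod (?R f m))\<^sup>2) summable_on UNIV"
      by (rule summable_on_comparison_test[OF has_sum_imp_summable[OF STh]]) (use pt in auto)
    have "(\<Sum>\<^sub>\<infinity>m. (cmod (?R f m))\<^sup>2) \<le> S * (S * N)"
      by (rule has_sum_mono[OF has_sum_infsum[OF sm] STh]) (use pt in auto)
    then have "ell2_norm (?R f) \<le> sqrt (S * (S * N))"
      by (simp add: ell2_norm_def)
    also have "\<dots> = S * ell2_norm f"
      using S0 by (simp add: ell2_norm_def N_def F_def real_sqrt_mult mult.assoc[symmetric])
    finally show ?thesis using sm by (simp add: ell2_def)
  qed
  have s: "(\<lambda>n. G m n * f n) summable_on UNIV" if "f \<in> ell2" for f m
    by (rule abs_summable_summable[OF kernel_row_summable[OF r G that]])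
  show ?thesis
    unfolding bounded_operator_def
  proof (intro conjI ballI allI)
    fix u v assume u: "u \<in> ell2" and v: "v \<in> ell2"
    show "?R (\<lambda>n. u n + v n) = (\<lambda>n. ?R u n + ?R v n)"
      by (rule ext) (simp add: distrib_left infsum_add s u v)
  next
    fix c u assume u: "u \<in> ell2"
    show "?R (\<lambda>n. c * u n) = (\<lambda>n. c * ?R u n)"
      by (rule ext) (simp add: infsum_cmult_right[OF s[OF u], symmetric] mult.left_commute)
  qed (use main in auto)
qed


section \<open>Square-summable sequences\<close>

lemma ell2_tendsto_0:
  assumes "u \<in> ell2"
  shows "(\<lambda>n. u (int n)) \<longlonglongrightarrow> 0" "(\<lambda>n. u (- int n)) \<longlonglongrightarrow> 0"
proof -
  have sub: "(\<lambda>n. (cmod (u (g n)))\<^sup>2) summable_on (UNIV :: nat set)" if "inj g" for g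
  proof -
    have "(\<lambda>n. (cmod (u n))\<^sup>2) summable_on range g"
      by (rule summable_on_subset_banach[OF ell2_summable[OF assms]]) auto
    then show ?thesis
      by (subst (asm) summable_on_reindex[OF that]) (simp add: o_def)
  qed
  have lim: "(\<lambda>n. u (g n)) \<longlonglongrightarrow> 0" if "inj g" for g :: "nat \<Rightarrow> int"
  proof -
    have "(\<lambda>n. (cmod (u (g n)))\<^sup>2) \<longlonglongrightarrow> 0"
      by (rule summable_LIMSEQ_zero[OF summable_on_imp_summable[OF sub[OF that]]])
    then have "(\<lambda>n. sqrt ((cmod (u (g n)))\<^sup>2)) \<longlonglongrightarrow> sqrt 0"
      by (rule tendsto_real_sqrt)
    then show ?thesis
      by (simp add: tendsto_norm_zero_iff)
  qed
  show "(\<lambda>n. u (int n)) \<longlonglongrightarrow> 0" by (rule lim) simp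
  show "(\<lambda>n. u (- int n)) \<longlonglongrightarrow> 0" by (rule lim) (simp add: inj_def)
qed

lemma ell2_add:
  assumes "u \<in> ell2" "v \<in> ell2"
  shows "(\<lambda>n. u n + v n) \<in> ell2"
proof -
  have "(\<lambda>n. 2 * (cmod (u n))\<^sup>2 + 2 * (cmod (v n))\<^sup>2) summable_on UNIV"
    using assms[THEN ell2_summable] by (intro summable_on_add summable_on_cmult_right)
  then have "(\<lambda>n. (cmod (u n + v n))\<^sup>2) summable_on UNIV"
  proof (rule summable_on_comparison_test)
    fix n
    have "(cmod (u n + v n))\<^sup>2 \<le> (cmod (u n) + cmod (v n))\<^sup>2"
      by (intro power_mono norm_triangle_ineq) simp
    also have "\<dots> \<le> 2 * (cmod (u n))\<^sup>2 + 2 * (cmod (v n))\<^sup>2"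
      using zero_le_power2[of "cmod (u n) - cmod (v n)"] by (simp add: power2_eq_square algebra_simps)
    finally show "(cmod (u n + v n))\<^sup>2 \<le> 2 * (cmod (u n))\<^sup>2 + 2 * (cmod (v n))\<^sup>2" .
  qed simp
  then show ?thesis by (simp add: ell2_def)
qed

lemma ell2_mult:
  assumes "u \<in> ell2" and "\<And>n. cmod (c n) \<le> C"
  shows "(\<lambda>n. c n * u n) \<in> ell2"
proof -
  have "(\<lambda>n. C\<^sup>2 * (cmod (u n))\<^sup>2) summable_on UNIV"
    using assms(1)[THEN ell2_summable] by (rule summable_on_cmult_right)
  then have "(\<lambda>n. (cmod (c n * u n))\<^sup>2) summable_on UNIV"
    by (rule summable_on_comparison_test)
      (auto simp: norm_mult power_mult_distrib intro!: mult_right_mono power_mono assms(2))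
  then show ?thesis by (simp add: ell2_def)
qed

lemma ell2_shift:
  assumes "u \<in> ell2"
  shows "(\<lambda>n. u (n + k)) \<in> ell2"
  using assms summable_on_reindex_bij_betw[of "\<lambda>n. n + k" UNIV UNIV "\<lambda>n. (cmod (u n))\<^sup>2"]
  by (simp add: ell2_def bij_plus_right)

lemma recurrence_zero:
  fixes f V :: "int \<Rightarrow> 'a::comm_ring_1"
  assumes eq: "\<And>n. f (n + 1) + f (n - 1) + V n * f n = 0" and "f 0 = 0" "f (- 1) = 0"
  shows "f = (\<lambda>_. 0)"
proof -
  have "f n = 0 \<and> f (n - 1) = 0" for n
  proof (induction n rule: int_induct[where k = 0])
    case base then show ?case using assms by simp
  next
    case (step1 i) then show ?case using eq[of i] by simp
  next
    case (step2 i) then show ?case using eq[of "i - 1"] by simp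
  qed
  then show ?thesis by auto
qed

lemma wronskian_constant:
  fixes u v V :: "int \<Rightarrow> 'a::comm_ring_1"
  assumes "\<And>n. u (n + 1) + u (n - 1) + V n * u n = 0"
    and "\<And>n. v (n + 1) + v (n - 1) + V n * v n = 0"
  shows "u (n + 1) * v n - u n * v (n + 1) = u 0 * v (- 1) - u (- 1) * v 0"
proof -
  have step: "u (n + 1) * v n - u n * v (n + 1) = u n * v (n - 1) - u (n - 1) * v n" for n
  proof -
    have "u (n + 1) = - (u (n - 1) + V n * u n)" "v (n + 1) = - (v (n - 1) + V n * v n)"
      using assms[of n] by (metis add.assoc eq_neg_iff_add_eq_0)+
    then show ?thesis by (simp only:) (simp add: algebra_simps)
  qed
  show ?thesis
  proof (induction n rule: int_induct[where k = "-1"])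
    case (step1 i) then show ?case using step[of "i + 1"] by simp
  next
    case (step2 i) then show ?case using step[of i] by simp
  qed simp
qed

text \<open>The resolvent is the Green function built from a solution \<open>u\<close> that decays on the left
  and a solution \<open>v\<close> that decays on the right.\<close>

lemma not_in_amo_spectrum:
  fixes u v :: "int \<Rightarrow> real"
  assumes u: "\<And>n. u (n + 1) + u (n - 1) + (2 * lam * cos (2 * pi * (\<theta> + of_int n * \<alpha>)) - E) * u n = 0"
    and v: "\<And>n. v (n + 1) + v (n - 1) + (2 * lam * cos (2 * pi * (\<theta> + of_int n * \<alpha>)) - E) * v n = 0"
    and W: "u 0 * v (- 1) - u (- 1) * v 0 \<noteq> 0"
    and r: "0 < r" "r < 1"
    and dec: "\<And>m n. m \<le> n \<Longrightarrow> \<bar>u m * v n\<bar> \<le> K * r ^ nat (n - m)"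
  shows "E \<notin> amo_spectrum lam \<alpha> \<theta>"
proof -
  define V :: "int \<Rightarrow> complex" where
    "V n = complex_of_real (2 * lam * cos (2 * pi * (\<theta> + of_int n * \<alpha>)) - E)" for n
  define U where "U n = complex_of_real (u n)" for n
  define U' where "U' n = complex_of_real (v n)" for n
  have Ueq: "U (n + 1) + U (n - 1) + V n * U n = 0" for n
    using arg_cong[OF u[of n], of complex_of_real] by (simp add: U_def V_def)
  have U'eq: "U' (n + 1) + U' (n - 1) + V n * U' n = 0" for n
    using arg_cong[OF v[of n], of complex_of_real] by (simp add: U'_def V_def)
  define w where "w = u 0 * v (- 1) - u (- 1) * v 0"
  have w0: "w \<noteq> 0" using W by (simp add: w_def)
  have wr: "U (n + 1) * U' n - U n * U' (n + 1) = of_real w" for n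
    using wronskian_constant[of U V U' n, OF Ueq U'eq] by (simp add: U_def U'_def w_def)
  \<comment> \<open>Away from the diagonal the factor depending on \<open>m\<close> solves the
    equation. On the diagonal the switch between the two branches contributes the Wronskian
    \<open>w\<close>, whence the normalisation by \<open>- w\<close>.\<close>
  define G where "G m n = (if m \<le> n then U m * U' n else U n * U' m) / (- of_real w)" for m n :: int
  have Gb: "cmod (G m n) \<le> (K / \<bar>w\<bar>) * r ^ nat \<bar>m - n\<bar>" for m n
  proof -
    have "cmod (G m n) = \<bar>if m \<le> n then u m * v n else u n * v m\<bar> / \<bar>w\<bar>"
      by (simp add: G_def U_def U'_def norm_divide norm_mult abs_mult)
    also have "\<dots> \<le> (K * r ^ nat \<bar>m - n\<bar>) / \<bar>w\<bar>"
    proof (rule divide_right_mono)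
      show "\<bar>if m \<le> n then u m * v n else u n * v m\<bar> \<le> K * r ^ nat \<bar>m - n\<bar>"
        using dec[of m n] dec[of n m] by (cases "m \<le> n") (auto simp: abs_if)
    qed simp
    finally show ?thesis by simp
  qed
  define R where "R f m = (\<Sum>\<^sub>\<infinity>n. G m n * f n)" for f :: "int \<Rightarrow> complex" and m :: int
  have bR: "bounded_operator R"
    unfolding R_def[abs_def] using r Gb by (intro bounded_operator_kernel[where r = r and K = "K / \<bar>w\<bar>"]) auto
  have sm: "(\<lambda>n. G m n * f n) summable_on UNIV" if "f \<in> ell2" for f m
    using r Gb that by (intro abs_summable_summable[OF kernel_row_summable[where r = r and K = "K / \<bar>w\<bar>"]]) auto
  define H where "H f n = f (n + 1) + f (n - 1) + V n * f n" for f :: "int \<Rightarrow> complex" and n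
  have Heq: "almost_mathieu lam \<alpha> \<theta> f n - complex_of_real E * f n = H f n" for f n
    by (simp add: almost_mathieu_def H_def V_def algebra_simps)
  have Gl: "G a b = U a * U' b / (- of_real w)" if "a \<le> b" for a b
    using that by (simp add: G_def)
  have Gr: "G a b = U b * U' a / (- of_real w)" if "b \<le> a" for a b
    using that by (cases "a = b") (auto simp: G_def)
  have HG: "H (\<lambda>m. G m n) m = (if m = n then 1 else 0)" for m n
  proof -
    consider "m < n" | "m > n" | "m = n" by linarith
    then show ?thesis
    proof cases
      case 1
      then have "H (\<lambda>m. G m n) m = (U (m + 1) + U (m - 1) + V m * U m) * U' n / (- of_real w)"
        by (simp add: H_def Gl diff_divide_distrib add_divide_distrib algebra_simps)
      then show ?thesis using 1 by (simp add: Ueq)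
    next
      case 2
      then have "H (\<lambda>m. G m n) m = (U' (m + 1) + U' (m - 1) + V m * U' m) * U n / (- of_real w)"
        by (simp add: H_def Gr diff_divide_distrib add_divide_distrib algebra_simps)
      then show ?thesis using 2 by (simp add: U'eq)
    next
      case 3
      then have "H (\<lambda>m. G m n) m
          = ((U (n + 1) + U (n - 1) + V n * U n) * U' n - (U (n + 1) * U' n - U n * U' (n + 1))) / (- of_real w)"
        by (simp add: H_def Gl Gr[of n "1 + n"] diff_divide_distrib add_divide_distrib algebra_simps)
      then show ?thesis using 3 w0 by (simp only: Ueq wr) simp
    qed
  qed
  have HR: "H (R f) = f" if f: "f \<in> ell2" for f
  proof
    fix m
    have "H (R f) m = (\<Sum>\<^sub>\<infinity>n. G (m + 1) n * f n + G (m - 1) n * f n + V m * (G m n * f n))"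
      unfolding H_def R_def using sm[OF f]
      by (simp add: infsum_add summable_on_add summable_on_cmult_right infsum_cmult_right)
    also have "\<dots> = (\<Sum>\<^sub>\<infinity>n. H (\<lambda>m. G m n) m * f n)"
      by (simp add: H_def algebra_simps)
    also have "\<dots> = (\<Sum>\<^sub>\<infinity>n\<in>{m}. f n)"
      by (rule infsum_cong_neutral) (auto simp: HG)
    finally show "H (R f) m = f m" by simp
  qed
  \<comment> \<open>\<open>HR\<close> only gives a right inverse; injectivity makes it two-sided,
    because \<open>R (H f) - f\<close> is annihilated by \<open>H\<close>. A kernel element tends to
    0 at both ends, so its Wronskian with \<open>U\<close>, bounded on the left, and with
    \<open>U'\<close>, bounded on the right, is 0. As \<open>U\<close> and \<open>U'\<close> are
    independent, it vanishes at two neighbouring sites.\<close>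
  have ker: "f = (\<lambda>_. 0)" if f: "f \<in> ell2" and Hf: "\<And>n. H f n = 0" for f
  proof -
    have feq: "f (n + 1) + f (n - 1) + V n * f n = 0" for n
      using Hf[of n] by (simp add: H_def)
    \<comment> \<open>The sign \<open>i\<close> selects the end of the lattice at which the limit is
      taken. Walking to the left swaps the two sites of the Wronskian, hence the factor
      \<open>of_int i\<close> below.\<close>
    have wz: "f 0 * g (- 1) - f (- 1) * g 0 = 0"
      if g: "\<And>n. g (n + 1) + g (n - 1) + V n * g n = 0"
        and i: "i = 1 \<or> i = -1" and b: "\<And>n. n > 0 \<Longrightarrow> cmod (g (i * int n)) \<le> L" for g L i
    proof -
      have z: "(\<lambda>n. f (i * int n)) \<longlonglongrightarrow> 0"
        using i ell2_tendsto_0[OF f] by auto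
      have zg: "(\<lambda>n. f (i * int (h n)) * g (i * int (h' n))) \<longlonglongrightarrow> 0"
        if "filterlim h sequentially sequentially" "filterlim h' sequentially sequentially" for h h'
      proof (rule Lim_null_comparison)
        have "\<forall>\<^sub>F n in sequentially. h' n > 0"
          using that(2)[unfolded filterlim_iff, rule_format, OF eventually_gt_at_top[of 0]] by simp
        then show "\<forall>\<^sub>F n in sequentially. norm (f (i * int (h n)) * g (i * int (h' n))) \<le> norm (f (i * int (h n))) * L"
          by eventually_elim (simp add: norm_mult b mult_left_mono)
        have "(\<lambda>n. f (i * int (h n))) \<longlonglongrightarrow> 0"
          using filterlim_compose[OF z that(1)] .
        then show "(\<lambda>n. norm (f (i * int (h n))) * L) \<longlonglongrightarrow> 0"
          by (intro tendsto_mult_left_zero tendsto_norm_zero)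
      qed
      have const: "f (n + 1) * g n - f n * g (n + 1) = f 0 * g (- 1) - f (- 1) * g 0" for n
        by (rule wronskian_constant[OF feq g])
      have "(\<lambda>n. f (i * int (Suc n)) * g (i * int n) - f (i * int n) * g (i * int (Suc n))) \<longlonglongrightarrow> 0 - 0"
        by (intro tendsto_diff zg filterlim_ident filterlim_Suc)
      moreover have "f (i * int (Suc n)) * g (i * int n) - f (i * int n) * g (i * int (Suc n))
          = of_int i * (f 0 * g (- 1) - f (- 1) * g 0)" for n
        using i const[of "int n"] const[of "- 1 - int n"] by (auto simp: algebra_simps)
      ultimately have "of_int i * (f 0 * g (- 1) - f (- 1) * g 0) = 0"
        by (simp add: LIMSEQ_const_iff)
      then show ?thesis using i by auto
    qed
    \<comment> \<open>The decay hypothesis only controls products. Fixing a site where one factor is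
      nonzero turns it into a bound on the other; the site may be -1, so the bound starts at
      distance \<open>n > 0\<close> from the origin.\<close>
    have "\<exists>m\<in>{0, - 1}. v m \<noteq> 0" "\<exists>m\<in>{0, - 1}. u m \<noteq> 0"
      using W by auto
    then obtain m m' where m: "m \<in> {0, - 1}" "v m \<noteq> 0" and m': "m' \<in> {0, - 1}" "u m' \<noteq> 0"
      by blast
    have K0: "0 \<le> K"
      using order_trans[OF abs_ge_zero dec[of 0 0]] by simp
    have bnd: "\<bar>u j * v n\<bar> \<le> K" if "j \<le> n" for j n
      using dec[OF that] K0 r
      by (meson less_eq_real_def mult_left_le order_trans power_le_one)
    have u_wz: "f 0 * U (- 1) - f (- 1) * U 0 = 0"
    proof (rule wz[of U "-1" "K / \<bar>v m\<bar>"])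
      show "cmod (U (- 1 * int n)) \<le> K / \<bar>v m\<bar>" if "n > 0" for n
        using bnd[of "- int n" m] m that by (auto simp: U_def field_simps abs_mult)
    qed (use Ueq in auto)
    have v_wz: "f 0 * U' (- 1) - f (- 1) * U' 0 = 0"
    proof (rule wz[of U' 1 "K / \<bar>u m'\<bar>"])
      show "cmod (U' (1 * int n)) \<le> K / \<bar>u m'\<bar>" if "n > 0" for n
        using bnd[of m' "int n"] m' that by (auto simp: U'_def field_simps abs_mult)
    qed (use U'eq in auto)
    have wU: "U 0 * U' (- 1) - U (- 1) * U' 0 = of_real w"
      by (simp add: U_def U'_def w_def)
    have "f 0 * of_real w = U 0 * (f 0 * U' (- 1) - f (- 1) * U' 0) - U' 0 * (f 0 * U (- 1) - f (- 1) * U 0)"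
      by (simp add: wU[symmetric] algebra_simps)
    then have f0: "f 0 = 0" by (simp add: u_wz v_wz w0)
    have "f (- 1) * of_real w = U (- 1) * (f 0 * U' (- 1) - f (- 1) * U' 0) - U' (- 1) * (f 0 * U (- 1) - f (- 1) * U 0)"
      by (simp add: wU[symmetric] algebra_simps)
    then have f1: "f (- 1) = 0" by (simp add: u_wz v_wz w0)
    show ?thesis
      by (rule recurrence_zero[OF feq f0 f1])
  qed
  have bV: "cmod (V n) \<le> 2 * \<bar>lam\<bar> + \<bar>E\<bar>" for n
  proof -
    have "\<bar>2 * lam * cos (2 * pi * (\<theta> + of_int n * \<alpha>)) - E\<bar>
        \<le> \<bar>2 * lam\<bar> * \<bar>cos (2 * pi * (\<theta> + of_int n * \<alpha>))\<bar> + \<bar>E\<bar>"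
      by (metis abs_mult abs_triangle_ineq4)
    also have "\<dots> \<le> \<bar>2 * lam\<bar> * 1 + \<bar>E\<bar>"
      by (intro add_right_mono mult_left_mono) auto
    finally show ?thesis unfolding V_def norm_of_real by simp
  qed
  have H2: "H f \<in> ell2" if "f \<in> ell2" for f
    unfolding H_def[abs_def] using that bV
    by (intro ell2_add ell2_shift[of f 1] ell2_shift[of f "-1", simplified] ell2_mult)
  have LR: "R (H f) = f" if f: "f \<in> ell2" for f
  proof -
    define d where "d n = R (H f) n + (- 1) * f n" for n
    have R2: "R (H f) \<in> ell2" using bR H2[OF f] by (auto simp: bounded_operator_def)
    have "d \<in> ell2"
      unfolding d_def[abs_def] by (intro ell2_add R2 ell2_mult[where C = 1] f) simp
    moreover have "H d n = H (R (H f)) n - H f n" for n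
      by (simp add: H_def d_def algebra_simps)
    then have "H d n = 0" for n by (simp add: HR[OF H2[OF f]])
    ultimately have "d = (\<lambda>_. 0)" by (rule ker)
    then show ?thesis by (auto simp: d_def fun_eq_iff)
  qed
  have "bounded_operator R \<and>
      (\<forall>u\<in>ell2. R (\<lambda>n. almost_mathieu lam \<alpha> \<theta> u n - complex_of_real E * u n) = u) \<and>
      (\<forall>u\<in>ell2. (\<lambda>n. almost_mathieu lam \<alpha> \<theta> (R u) n - complex_of_real E * R u n) = u)"
    using bR LR HR by (simp add: Heq)
  then show ?thesis
    unfolding amo_spectrum_def operator_spectrum_def by blast
qed

section \<open>Positive matrix cocycles\<close>

lemma int_product_exists:
  fixes \<rho> :: "int \<Rightarrow> real"
  assumes "\<And>n. \<rho> n > 0"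
  obtains X where "\<And>n. X n > 0" "\<And>n. X (n + 1) = \<rho> n * X n"
proof
  define X where "X n = (if n \<ge> 0 then \<Prod>i<nat n. \<rho> (int i) else 1 / (\<Prod>i<nat (- n). \<rho> (- int i - 1)))" for n :: int
  show "X n > 0" for n
    using assms by (simp add: X_def prod_pos)
  show "X (n + 1) = \<rho> n * X n" for n
  proof (cases "n \<ge> 0")
    case True
    then have "nat (n + 1) = Suc (nat n)" by simp
    then show ?thesis using True by (simp add: X_def)
  next
    case False
    then obtain k where k: "n = - int k - 1"
      by (metis add.commute diff_minus_eq_add int_cases minus_diff_eq negD not_le of_nat_Suc uminus_add_conv_diff zero_le_imp_eq_int)
    have \<rho>: "\<rho> n \<noteq> 0" using assms[of n] by simp
    have "nat (- n) = Suc k" using k by simp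
    then have "X n = 1 / ((\<Prod>i<k. \<rho> (- int i - 1)) * \<rho> n)"
      using k by (simp add: X_def)
    moreover have "X (n + 1) = 1 / (\<Prod>i<k. \<rho> (- int i - 1))"
      using k by (cases "k = 0") (auto simp: X_def)
    ultimately show ?thesis using \<rho> by simp
  qed
qed

text \<open>The slopes \<open>Y / X\<close> evolve by increasing Moebius maps that send the positive
  half-line into a fixed compact part of itself. Slope 0, started earlier and earlier, therefore
  yields an increasing bounded sequence at each time, and the limits form an invariant family of
  positive slopes. The factors \<open>A n + B n * t n\<close> then determine
  \<open>X\<close>.\<close>

lemma positive_matrix_solution:
  fixes A B C D :: "int \<Rightarrow> real"
  assumes \<gamma>: "0 < \<gamma>"
    and lower: "\<And>n. \<gamma> \<le> A n" "\<And>n. \<gamma> \<le> B n" "\<And>n. \<gamma> \<le> C n" "\<And>n. \<gamma> \<le> D n"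
    and upper: "\<And>n. A n \<le> \<Gamma>" "\<And>n. B n \<le> \<Gamma>" "\<And>n. C n \<le> \<Gamma>" "\<And>n. D n \<le> \<Gamma>"
    and det: "\<And>n. A n * D n - B n * C n = 1"
  obtains X Y where "\<And>n. X n > 0" "\<And>n. Y n > 0"
    "\<And>n. X (n + 1) = A n * X n + B n * Y n" "\<And>n. Y (n + 1) = C n * X n + D n * Y n"
proof -
  define \<phi> where "\<phi> n t = (C n + D n * t) / (A n + B n * t)" for n t
  have \<Gamma>: "0 < \<Gamma>" using \<gamma> lower(1)[of 0] upper(1)[of 0] by linarith
  have pos: "0 < A n" "0 < B n" "0 < C n" "0 < D n" for n
    using \<gamma> lower[of n] by linarith+
  have den: "A n + B n * t > 0" if "0 \<le> t" for n t
    using pos[of n] that by (simp add: add_pos_nonneg)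
  have mono: "\<phi> n s \<le> \<phi> n t" if "0 \<le> s" "s \<le> t" for n s t
  proof -
    have "(C n + D n * t) * (A n + B n * s) - (C n + D n * s) * (A n + B n * t)
        = (A n * D n - B n * C n) * (t - s)" by (simp add: algebra_simps)
    then have "(C n + D n * s) * (A n + B n * t) \<le> (C n + D n * t) * (A n + B n * s)"
      using that det[of n] by simp
    then show ?thesis
      unfolding \<phi>_def using den[of s n] den[of t n] that by (simp add: divide_simps)
  qed
  have bnd: "\<gamma> / \<Gamma> \<le> \<phi> n t" "\<phi> n t \<le> \<Gamma> / \<gamma>" if "0 \<le> t" for n t
  proof -
    have "\<gamma> * (1 + t) \<le> C n + D n * t" "C n + D n * t \<le> \<Gamma> * (1 + t)"
      "\<gamma> * (1 + t) \<le> A n + B n * t" "A n + B n * t \<le> \<Gamma> * (1 + t)"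
      using lower[of n] upper[of n] that
      by (auto simp: distrib_left intro!: add_mono mult_right_mono)
    then have "(\<gamma> * (1 + t)) / (\<Gamma> * (1 + t)) \<le> \<phi> n t" "\<phi> n t \<le> (\<Gamma> * (1 + t)) / (\<gamma> * (1 + t))"
      unfolding \<phi>_def using \<gamma> \<Gamma> that den[OF that, of n] pos[of n]
      by (intro frac_le; simp)+
    then show "\<gamma> / \<Gamma> \<le> \<phi> n t" "\<phi> n t \<le> \<Gamma> / \<gamma>" using that by auto
  qed
  \<comment> \<open>\<open>s M n\<close> is the slope at time \<open>n\<close> of the orbit that
    starts with slope 0 at time \<open>n - M\<close>.\<close>
  define s where "s = rec_nat (\<lambda>_. 0) (\<lambda>_ g n. \<phi> (n - 1) (g (n - 1)))"
  have s0: "s 0 n = 0" and sS: "s (Suc M) n = \<phi> (n - 1) (s M (n - 1))" for M n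
    by (simp_all add: s_def)
  have snn: "0 \<le> s M n" for M n
  proof (induction M arbitrary: n)
    case (Suc M)
    have "0 \<le> \<gamma> / \<Gamma>" using \<gamma> \<Gamma> by simp
    then show ?case using bnd(1)[OF Suc, of "n - 1" "n - 1"] by (simp add: sS)
  qed (simp add: s0)
  have smono: "s M n \<le> s (Suc M) n" for M n
  proof (induction M arbitrary: n)
    case 0 then show ?case using snn[of "Suc 0" n] by (simp add: s0)
  next
    case (Suc M) then show ?case unfolding sS[of M] sS[of "Suc M"] by (intro mono snn)
  qed
  have sub: "s M n \<le> \<Gamma> / \<gamma>" for M n
    using \<gamma> \<Gamma> bnd(2)[OF snn] by (cases M) (auto simp: s0 sS)
  have "\<exists>l. (\<lambda>M. s M n) \<longlonglongrightarrow> l" for n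
    using incseq_convergent[of "\<lambda>M. s M n" "\<Gamma> / \<gamma>"] smono sub by (meson incseq_SucI)
  then obtain t where t: "\<And>n. (\<lambda>M. s M n) \<longlonglongrightarrow> t n" by metis
  have tnn: "0 \<le> t n" for n
    using t[of n] by (rule LIMSEQ_le_const) (use snn in auto)
  have trec: "t (n + 1) = \<phi> n (t n)" for n
  proof (rule LIMSEQ_unique)
    show "(\<lambda>M. s (Suc M) (n + 1)) \<longlonglongrightarrow> t (n + 1)"
      using t[of "n + 1"] by (rule LIMSEQ_Suc)
    have "(\<lambda>M. \<phi> n (s M n)) \<longlonglongrightarrow> \<phi> n (t n)"
      unfolding \<phi>_def using t[of n] den[OF tnn, of n n] by (intro tendsto_intros) auto
    then show "(\<lambda>M. s (Suc M) (n + 1)) \<longlonglongrightarrow> \<phi> n (t n)" by (simp add: sS)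
  qed
  have tpos: "0 < t n" for n
    using trec[of "n - 1"] bnd(1)[OF tnn, of "n - 1" "n - 1"] \<gamma> \<Gamma>
    by (metis diff_add_cancel divide_pos_pos less_le_trans)
  obtain X where X: "\<And>n. X n > 0" "\<And>n. X (n + 1) = (A n + B n * t n) * X n"
    using int_product_exists[of "\<lambda>n. A n + B n * t n"] den[OF tnn] by blast
  show thesis
  proof (rule that[of X "\<lambda>n. t n * X n"])
    show "t (n + 1) * X (n + 1) = C n * X n + D n * (t n * X n)" for n
      using den[OF tnn, of n n] unfolding X trec \<phi>_def by (simp add: field_simps)
  qed (use X tpos in \<open>auto simp: algebra_simps\<close>)
qed

text \<open>The product \<open>X Y\<close> is a Lyapunov function: \<open>(A X + B Y) (C X + D Y) \<ge> (A D + B C) X Y\<close>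
  and \<open>A D + B C = 1 + 2 B C\<close>.\<close>

lemma positive_matrix_dichotomy:
  fixes A B C D :: "int \<Rightarrow> real"
  assumes \<gamma>: "0 < \<gamma>"
    and lower: "\<And>n. \<gamma> \<le> A n" "\<And>n. \<gamma> \<le> B n" "\<And>n. \<gamma> \<le> C n" "\<And>n. \<gamma> \<le> D n"
    and upper: "\<And>n. A n \<le> \<Gamma>" "\<And>n. B n \<le> \<Gamma>" "\<And>n. C n \<le> \<Gamma>" "\<And>n. D n \<le> \<Gamma>"
    and det: "\<And>n. A n * D n - B n * C n = 1"
  obtains X Y X' Y' :: "int \<Rightarrow> real" and K r :: real
  where "0 < r" "r < 1"
    "\<And>n. X n > 0" "\<And>n. Y n > 0" "\<And>n. X' n > 0" "\<And>n. Y' n > 0"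
    "\<And>n. X (n + 1) = A n * X n + B n * Y n" "\<And>n. Y (n + 1) = C n * X n + D n * Y n"
    "\<And>n. X' (n + 1) = A n * X' n - B n * Y' n" "\<And>n. Y' (n + 1) = D n * Y' n - C n * X' n"
    "\<And>m n. m \<le> n \<Longrightarrow> (X m + Y m) * (X' n + Y' n) \<le> K * r ^ nat (n - m)"
proof -
  have \<Gamma>: "0 < \<Gamma>" using \<gamma> lower(1)[of 0] upper(1)[of 0] by linarith
  have ratio: "a' \<le> \<Gamma> / \<gamma> * b'"
    if "a' = p * a + q * b" "b' = p' * a + q' * b" "p \<le> \<Gamma>" "q \<le> \<Gamma>" "\<gamma> \<le> p'" "\<gamma> \<le> q'" "0 < a" "0 < b"
    for a b a' b' p q p' q' :: real
  proof -
    have "a' \<le> \<Gamma> * (a + b)" "\<gamma> * (a + b) \<le> b'"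
      using that by (auto simp: distrib_left intro!: add_mono mult_right_mono)
    moreover have "\<Gamma> / \<gamma> * (\<gamma> * (a + b)) \<le> \<Gamma> / \<gamma> * b'"
      by (rule mult_left_mono) (use \<gamma> \<Gamma> calculation in auto)
    moreover have "\<Gamma> / \<gamma> * (\<gamma> * (a + b)) = \<Gamma> * (a + b)" using \<gamma> by simp
    ultimately show ?thesis by linarith
  qed
  obtain X Y where X: "\<And>n. X n > 0" and Y: "\<And>n. Y n > 0"
    and XS: "\<And>n. X (n + 1) = A n * X n + B n * Y n" and YS: "\<And>n. Y (n + 1) = C n * X n + D n * Y n"
    using positive_matrix_solution[of \<gamma> A B C D \<Gamma>] assms by metis
  \<comment> \<open>The second solution comes from reversing time. After negating the second
    coordinate the inverse matrix has entries \<open>D\<close>, \<open>B\<close>, \<open>C\<close>,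
    \<open>A\<close>, which are positive again; index \<open>- n - 1\<close> is the step from
    \<open>- n - 1\<close> to \<open>- n\<close> traversed backwards.\<close>
  obtain Z Z' where Z: "\<And>n. Z n > 0" and Z': "\<And>n. Z' n > 0"
    and ZS: "\<And>n. Z (n + 1) = D (- n - 1) * Z n + B (- n - 1) * Z' n"
    and ZS': "\<And>n. Z' (n + 1) = C (- n - 1) * Z n + A (- n - 1) * Z' n"
  proof (rule positive_matrix_solution[of \<gamma> "\<lambda>n. D (- n - 1)" "\<lambda>n. B (- n - 1)"
        "\<lambda>n. C (- n - 1)" "\<lambda>n. A (- n - 1)" \<Gamma>])
    show "D (- n - 1) * A (- n - 1) - B (- n - 1) * C (- n - 1) = 1" for n
      using det[of "- n - 1"] by (simp add: mult.commute)
  qed (use assms in auto)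
  define X' Y' where "X' n = Z (- n)" and "Y' n = Z' (- n)" for n
  have X': "X' n > 0" and Y': "Y' n > 0" for n by (simp_all add: X'_def Y'_def Z Z')
  have Xb: "X' n = D n * X' (n + 1) + B n * Y' (n + 1)" for n
    using ZS[of "- n - 1"] by (simp add: X'_def Y'_def)
  have Yb: "Y' n = C n * X' (n + 1) + A n * Y' (n + 1)" for n
    using ZS'[of "- n - 1"] by (simp add: X'_def Y'_def)
  have XS': "X' (n + 1) = A n * X' n - B n * Y' n" for n
  proof -
    have "A n * X' n - B n * Y' n = (A n * D n - B n * C n) * X' (n + 1)"
      unfolding Xb[of n] Yb[of n] by (simp add: algebra_simps)
    then show ?thesis by (simp add: det)
  qed
  have YS': "Y' (n + 1) = D n * Y' n - C n * X' n" for n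
  proof -
    have "D n * Y' n - C n * X' n = (A n * D n - B n * C n) * Y' (n + 1)"
      unfolding Xb[of n] Yb[of n] by (simp add: algebra_simps)
    then show ?thesis by (simp add: det)
  qed
  \<comment> \<open>Images of positive vectors under matrices with entries between \<gamma> and
    \<Gamma> have comparable components. So the square of the sum is controlled by the product, the
    quantity whose growth is known.\<close>
  define \<kappa> where "\<kappa> = \<Gamma> / \<gamma>"
  have \<kappa>: "0 < \<kappa>" using \<gamma> \<Gamma> by (simp add: \<kappa>_def)
  have "X (n + 1) \<le> \<kappa> * Y (n + 1)" "Y (n + 1) \<le> \<kappa> * X (n + 1)" for n
    unfolding \<kappa>_def
    by (rule ratio[OF XS YS] ratio[OF YS XS]; rule lower upper X Y)+
  from this[of "n - 1" for n] have XY: "X n \<le> \<kappa> * Y n" "Y n \<le> \<kappa> * X n" for n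
    by simp_all
  have XY': "X' n \<le> \<kappa> * Y' n" "Y' n \<le> \<kappa> * X' n" for n
    unfolding \<kappa>_def
    by (rule ratio[OF Xb Yb] ratio[OF Yb Xb]; rule lower upper X' Y')+
  have sq: "(a + b)\<^sup>2 \<le> 4 * \<kappa> * (a * b)" if "0 < a" "0 < b" "a \<le> \<kappa> * b" "b \<le> \<kappa> * a" for a b :: real
  proof -
    have "a * a \<le> a * (\<kappa> * b)" "b * b \<le> b * (\<kappa> * a)" using that by (auto intro!: mult_left_mono)
    moreover have "2 * (a * b) \<le> a * a + b * b"
      using sum_squares_bound[of a b] by (simp add: power2_eq_square)
    ultimately show ?thesis by (simp add: power2_eq_square algebra_simps)
  qed
  define q where "q = 1 + 2 * \<gamma>\<^sup>2"
  have q: "1 < q" using \<gamma> by (simp add: q_def)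
  have Vstep: "q * (X n * Y n) \<le> X (n + 1) * Y (n + 1)" for n
  proof -
    have "X (n + 1) * Y (n + 1) = (A n * D n + B n * C n) * (X n * Y n) + A n * C n * X n * X n + B n * D n * Y n * Y n"
      unfolding XS YS by (simp add: algebra_simps)
    also have "\<dots> \<ge> (A n * D n + B n * C n) * (X n * Y n)"
      using lower[of n] \<gamma> X[of n] Y[of n] by simp
    finally have "(A n * D n + B n * C n) * (X n * Y n) \<le> X (n + 1) * Y (n + 1)" .
    moreover have "\<gamma> * \<gamma> \<le> B n * C n" using lower[of n] \<gamma> by (intro mult_mono) auto
    then have "q \<le> A n * D n + B n * C n" using det[of n] by (simp add: q_def power2_eq_square)
    then have "q * (X n * Y n) \<le> (A n * D n + B n * C n) * (X n * Y n)"
      using X[of n] Y[of n] by (intro mult_right_mono) auto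
    ultimately show ?thesis by linarith
  qed
  have Vgrow: "q ^ k * (X m * Y m) \<le> X (m + int k) * Y (m + int k)" for k m
  proof (induction k)
    case (Suc k)
    have "q ^ Suc k * (X m * Y m) = q * (q ^ k * (X m * Y m))" by simp
    also have "\<dots> \<le> q * (X (m + int k) * Y (m + int k))" using Suc q by (intro mult_left_mono) auto
    also have "\<dots> \<le> X (m + int (Suc k)) * Y (m + int (Suc k))" using Vstep[of "m + int k"] by (simp add: ac_simps)
    finally show ?case .
  qed simp
  \<comment> \<open>Up to sign this is the Wronskian of \<open>(X, Y)\<close> and
    \<open>(X', - Y')\<close>. Both summands are positive and their sum is constant, so each is at
    most \<open>W\<close>; hence growth of \<open>X Y\<close> forces decay of
    \<open>X' Y'\<close>.\<close>
  define W where "W = X 0 * Y' 0 + Y 0 * X' 0"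
  have Wstep: "X (n + 1) * Y' (n + 1) + Y (n + 1) * X' (n + 1) = X n * Y' n + Y n * X' n" for n
  proof -
    have "X (n + 1) * Y' (n + 1) + Y (n + 1) * X' (n + 1) = (A n * D n - B n * C n) * (X n * Y' n + Y n * X' n)"
      unfolding XS YS XS' YS' by (simp add: algebra_simps)
    then show ?thesis by (simp add: det)
  qed
  have W: "X n * Y' n + Y n * X' n = W" for n
  proof (induction n rule: int_induct[where k = 0])
    case base then show ?case by (simp add: W_def)
  next
    case (step1 i) then show ?case using Wstep[of i] by simp
  next
    case (step2 i) then show ?case using Wstep[of "i - 1"] by simp
  qed
  have W0: "0 < W" unfolding W_def by (intro add_pos_pos mult_pos_pos X Y X' Y')
  \<comment> \<open>The square root appears because \<open>q\<close> is the growth factor of the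
    product of two components.\<close>
  define r where "r = 1 / sqrt q"
  have r: "0 < r" "r < 1" using q by (simp_all add: r_def)
  have r2: "(r ^ k)\<^sup>2 * q ^ k = 1" for k
    using q by (simp add: r_def power_mult[symmetric] mult.commute[of k] power_divide)
      (simp add: power_mult)
  show thesis
  proof (rule that[of r X Y X' Y' "4 * \<kappa> * W"])
    fix m n :: int assume mn: "m \<le> n"
    define k where "k = nat (n - m)"
    have n: "m + int k = n" using mn by (simp add: k_def)
    have VV: "(X n * Y n) * (X' n * Y' n) \<le> W\<^sup>2"
    proof -
      have "(X n * Y n) * (X' n * Y' n) = (X n * Y' n) * (Y n * X' n)" by simp
      also have "\<dots> \<le> W * W"
        using X[of n] Y[of n] X'[of n] Y'[of n] W[of n]
        by (intro mult_mono) (auto intro: less_imp_le simp flip: W[of n])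
      finally show ?thesis by (simp add: power2_eq_square)
    qed
    have "((X m + Y m) * (X' n + Y' n))\<^sup>2 = (X m + Y m)\<^sup>2 * (X' n + Y' n)\<^sup>2"
      by (simp add: power_mult_distrib)
    also have "\<dots> \<le> (4 * \<kappa> * (X m * Y m)) * (4 * \<kappa> * (X' n * Y' n))"
      using \<kappa> X[of m] Y[of m] X'[of n] Y'[of n] XY[of m] XY'[of n] by (intro mult_mono sq) auto
    also have "\<dots> = (4 * \<kappa>)\<^sup>2 * (r ^ k)\<^sup>2 * ((q ^ k * (X m * Y m)) * (X' n * Y' n))"
      using r2[of k] by (simp add: power2_eq_square)
    also have "\<dots> \<le> (4 * \<kappa>)\<^sup>2 * (r ^ k)\<^sup>2 * ((X n * Y n) * (X' n * Y' n))"
      using Vgrow[of k m] X'[of n] Y'[of n] by (intro mult_left_mono mult_right_mono) (auto simp: n)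
    also have "\<dots> \<le> (4 * \<kappa>)\<^sup>2 * (r ^ k)\<^sup>2 * W\<^sup>2"
      using VV by (intro mult_left_mono) auto
    also have "\<dots> = (4 * \<kappa> * W * r ^ k)\<^sup>2" by (simp add: power_mult_distrib)
    finally have "((X m + Y m) * (X' n + Y' n))\<^sup>2 \<le> (4 * \<kappa> * W * r ^ k)\<^sup>2" .
    then have "(X m + Y m) * (X' n + Y' n) \<le> 4 * \<kappa> * W * r ^ k"
      by (rule power2_le_imp_le) (use \<kappa> W0 r in simp)
    then show "(X m + Y m) * (X' n + Y' n) \<le> 4 * \<kappa> * W * r ^ nat (n - m)"
      by (simp add: k_def)
  qed (use r X Y X' Y' XS YS XS' YS' in auto)
qed

section \<open>Averages along the rotation\<close>

text \<open>Only the norm is assumed periodic, since the functions in question pick up a sign or a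
  phase over a period.\<close>

lemma periodic_norm_int:
  fixes f :: "real \<Rightarrow> 'a::real_normed_vector"
  assumes "\<And>x. norm (f (x + 1)) = norm (f x)"
  shows "norm (f (x + of_int k)) = norm (f x)"
proof (induction k rule: int_induct[where k = 0])
  case (step1 i) then show ?case using assms[of "x + of_int i"] by (simp add: add.assoc)
next
  case (step2 i) then show ?case using assms[of "x + of_int (i - 1)"] by (simp add: algebra_simps)
qed simp

lemma periodic_continuous_bounded:
  fixes f :: "real \<Rightarrow> 'a::real_normed_vector"
  assumes "continuous_on UNIV f" and per: "\<And>x. norm (f (x + 1)) = norm (f x)"
  obtains M where "\<And>x. norm (f x) \<le> M"
proof -
  have "compact (f ` {0..1})"
    using assms(1) by (intro compact_continuous_image) (auto intro: continuous_on_subset)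
  then have "bounded (f ` {0..1})" by (rule compact_imp_bounded)
  then obtain M where M: "\<And>x. x \<in> {0..1} \<Longrightarrow> norm (f x) \<le> M"
    by (metis bounded_iff imageI)
  show thesis
  proof (rule that)
    fix x
    have "norm (f x) = norm (f (frac x))"
      using periodic_norm_int[of f "frac x" "\<lfloor>x\<rfloor>"] per by (simp add: frac_def)
    also have "\<dots> \<le> M"
      by (rule M) (simp add: frac_ge_0 less_imp_le[OF frac_lt_1])
    finally show "norm (f x) \<le> M" .
  qed
qed

text \<open>The coboundary replaces \<open>f\<close> by its average over \<open>N\<close> steps of the rotation, where \<open>N\<close> is so
  large that every orbit segment of length \<open>N\<close> meets a fixed interval on which \<open>f\<close> is positive.\<close>

lemma positive_up_to_coboundary:
  fixes f :: "real \<Rightarrow> real"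
  assumes \<alpha>: "\<alpha> \<notin> \<rat>" and cont: "continuous_on UNIV f" and per: "\<And>x. f (x + 1) = f x"
    and nonneg: "\<And>x. 0 \<le> f x" and x0: "0 < f x0"
  obtains \<phi> \<kappa> M where "0 < \<kappa>" "\<And>x. \<kappa> \<le> f x + \<phi> (x + \<alpha>) - \<phi> x" "\<And>x. \<bar>\<phi> x\<bar> \<le> M"
proof -
  have perk: "f (x + of_int k) = f x" for x k
    using periodic_norm_int[of f x k] per nonneg by simp
  define c where "c = f x0 / 2"
  have c: "0 < c" "c < f x0" using x0 by (auto simp: c_def)
  have op: "open {x. c < f (x + real i * \<alpha>)}" for i :: nat
    by (intro open_Collect_less continuous_on_const continuous_on_compose2[OF cont] continuous_intros) auto
  have "open {x. c < f x}" using op[of 0] by simp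
  then obtain d where d: "d > 0" "\<And>y. dist y x0 < d \<Longrightarrow> c < f y"
    using c unfolding open_dist by (metis mem_Collect_eq)
  have hit: "\<exists>i. c < f (x + real i * \<alpha>)" for x
  proof -
    obtain h k where k: "k > 0" "\<bar>of_int k * \<alpha> - of_int h - (x0 - x)\<bar> < d"
      using sequence_of_fractional_parts_is_dense[OF \<alpha> d(1), of "x0 - x"] by blast
    have "c < f (x + of_int k * \<alpha> - of_int h)"
      using k(2) by (intro d(2)) (simp add: dist_real_def algebra_simps)
    also have "\<dots> = f (x + real (nat k) * \<alpha>)"
      using perk[of "x + of_int k * \<alpha>" "- h"] k(1) by simp
    finally show ?thesis by blast
  qed
  have "{0..1} \<subseteq> (\<Union>i. {x. c < f (x + real i * \<alpha>)})" using hit by auto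
  then obtain C where C: "finite C" "{0..1} \<subseteq> (\<Union>i\<in>C. {x. c < f (x + real i * \<alpha>)})"
    using compactE_image[of "{0..1::real}" UNIV "\<lambda>i. {x. c < f (x + real i * \<alpha>)}"] op by auto
  obtain N where N: "\<And>i. i \<in> C \<Longrightarrow> i < N"
    using C(1) by (meson finite_nat_iff_bounded lessThan_iff subsetD)
  have hitN: "\<exists>i<N. c < f (x + real i * \<alpha>)" for x
  proof -
    have "frac x \<in> {0..1}" by (simp add: frac_ge_0 less_imp_le[OF frac_lt_1])
    then obtain i where "i \<in> C" "c < f (frac x + real i * \<alpha>)" using C(2) by blast
    moreover have "f (x + real i * \<alpha>) = f (frac x + real i * \<alpha>)"
      using perk[of "frac x + real i * \<alpha>" "\<lfloor>x\<rfloor>"] by (simp add: frac_def)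
    ultimately show ?thesis using N by metis
  qed
  have Npos: "N > 0" using hitN[of 0] by auto
  obtain M where M: "\<And>x. \<bar>f x\<bar> \<le> M"
    using periodic_continuous_bounded[of f] cont per by (metis real_norm_def)
  \<comment> \<open>The inner sum telescopes: under a rotation step it changes by
    \<open>f (x + real i * \<alpha>) - f x\<close>. Averaging over \<open>i\<close> thus replaces
    \<open>f\<close> by its mean along \<open>N\<close> steps.\<close>
  define \<phi> where "\<phi> x = (\<Sum>i<N. \<Sum>k<i. f (x + real k * \<alpha>)) / real N" for x
  show thesis
  proof (rule that[of "c / real N" \<phi> "(\<Sum>i<N. \<Sum>k<i. M) / real N"])
    show "0 < c / real N" using c Npos by simp
    show "\<bar>\<phi> x\<bar> \<le> (\<Sum>i<N. \<Sum>k<i. M) / real N" for x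
    proof -
      have "\<bar>\<phi> x\<bar> = \<bar>\<Sum>i<N. \<Sum>k<i. f (x + real k * \<alpha>)\<bar> / real N" by (simp add: \<phi>_def)
      also have "\<dots> \<le> (\<Sum>i<N. \<Sum>k<i. M) / real N"
        using M by (intro divide_right_mono order_trans[OF sum_abs] sum_mono) auto
      finally show ?thesis .
    qed
    fix x
    have tel: "(\<Sum>k<i. f (x + \<alpha> + real k * \<alpha>) - f (x + real k * \<alpha>)) = f (x + real i * \<alpha>) - f x" for i
      by (induction i) (auto simp: algebra_simps)
    have "\<phi> (x + \<alpha>) - \<phi> x = (\<Sum>i<N. f (x + real i * \<alpha>) - f x) / real N"
      unfolding \<phi>_def diff_divide_distrib[symmetric] sum_subtractf[symmetric] tel ..
    also have "\<dots> = (\<Sum>i<N. f (x + real i * \<alpha>)) / real N - f x"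
      using Npos by (simp add: sum_subtractf diff_divide_distrib)
    finally have eq: "f x + \<phi> (x + \<alpha>) - \<phi> x = (\<Sum>i<N. f (x + real i * \<alpha>)) / real N" by simp
    obtain i where i: "i < N" "c < f (x + real i * \<alpha>)" using hitN by blast
    have "c \<le> (\<Sum>i\<in>{i}. f (x + real i * \<alpha>))" using i by simp
    also have "\<dots> \<le> (\<Sum>i<N. f (x + real i * \<alpha>))" using i nonneg by (intro sum_mono2) auto
    finally show "c / real N \<le> f x + \<phi> (x + \<alpha>) - \<phi> x"
      unfolding eq by (simp add: divide_right_mono)
  qed
qed

section \<open>The parabolic case\<close>

text \<open>Variation of constants: a solution at energy \<open>E - w \<delta>\<^sup>2\<close> is written as
  \<open>s\<^sup>n (g X + h \<delta> y)\<close>. The matrices \<open>A\<close>, \<open>B\<close>, \<open>C\<close>, \<open>D\<close> below describe its evolution in the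
  coordinates \<open>X\<close> and \<open>Z = y + \<delta> \<phi> X\<close>, with \<open>\<phi>\<close> the coboundary that makes \<open>g\<^sup>2\<close> positive.\<close>

lemma parabolic_one_sided:
  fixes g g' h h' :: "real \<Rightarrow> real"
  assumes \<alpha>: "\<alpha> \<notin> \<rat>" and s: "s = 1 \<or> s = - 1" and w: "w \<noteq> 0"
    and cont: "continuous_on UNIV g" and per: "\<And>x. \<bar>g (x + 1)\<bar> = \<bar>g x\<bar>"
    and bounded_h: "\<And>x. \<bar>h x\<bar> \<le> M\<^sub>h"
    and g: "\<And>x. s * g (x + \<alpha>) = (E - 2 * lam * cos (2 * pi * x)) * g x - g' x"
    and g': "\<And>x. s * g' (x + \<alpha>) = g x"
    and h: "\<And>x. s * (h (x + \<alpha>) + g (x + \<alpha>)) = (E - 2 * lam * cos (2 * pi * x)) * h x - h' x"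
    and h': "\<And>x. s * (h' (x + \<alpha>) + g' (x + \<alpha>)) = h x"
    and wronskian: "\<And>x. g x * h' x - g' x * h x = w"
  obtains \<epsilon>\<^sub>0 where "0 < \<epsilon>\<^sub>0"
    "\<And>\<delta>. 0 < \<delta> \<Longrightarrow> \<delta> < \<epsilon>\<^sub>0 \<Longrightarrow> E - w * \<delta>\<^sup>2 \<notin> amo_spectrum lam \<alpha> \<theta>"
proof -
  obtain x0 where x0: "g x0 \<noteq> 0"
  proof (rule ccontr)
    assume "\<not> thesis"
    then have "g x = 0" for x using that by blast
    then show False using g'[of "- \<alpha>"] wronskian[of 0] s w by auto
  qed
  obtain \<phi> \<kappa> M\<^sub>\<phi> where \<kappa>: "0 < \<kappa>" and \<phi>: "\<And>x. \<kappa> \<le> (g x)\<^sup>2 + \<phi> (x + \<alpha>) - \<phi> x" and M\<^sub>\<phi>: "\<And>x. \<bar>\<phi> x\<bar> \<le> M\<^sub>\<phi>"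
  proof (rule positive_up_to_coboundary[OF \<alpha>, of "\<lambda>x. (g x)\<^sup>2" x0])
    show "(g (x + 1))\<^sup>2 = (g x)\<^sup>2" for x
      using per[of x] by (metis power2_abs)
  qed (use x0 cont in \<open>auto intro!: continuous_intros\<close>)
  obtain M\<^sub>g where M\<^sub>g: "\<And>x. \<bar>g x\<bar> \<le> M\<^sub>g"
    using periodic_continuous_bounded[of g] cont per by (metis real_norm_def)
  define M where "M = Max {1, M\<^sub>g, M\<^sub>h, M\<^sub>\<phi>}"
  have M: "1 \<le> M" "\<bar>g x\<bar> \<le> M" "\<bar>h x\<bar> \<le> M" "\<bar>\<phi> x\<bar> \<le> M" for x
    using M\<^sub>g[of x] bounded_h[of x] M\<^sub>\<phi>[of x] by (auto simp: M_def le_max_iff_disj)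
  define \<mu> where "\<mu> = min \<kappa> 1"
  have \<mu>: "0 < \<mu>" "\<mu> \<le> 1" "\<mu> \<le> \<kappa>" using \<kappa> by (auto simp: \<mu>_def)
  \<comment> \<open>\<open>6 * M ^ 4\<close> is the error constant in \<open>C_bd\<close>, and this
    choice keeps that error below half of the main term, which is at least \<delta> \<mu>. Capping
    \<mu> at 1 makes the same smallness suffice for \<open>A\<close>, \<open>B\<close> and
    \<open>D\<close> and keeps \<delta> below 1.\<close>
  define \<epsilon>\<^sub>0 where "\<epsilon>\<^sub>0 = \<mu> / (12 * M ^ 4)"
  have M4: "1 \<le> M ^ 4" using M(1) by simp
  have "0 < 12 * M ^ 4" "\<mu> \<le> 12 * M ^ 4" using \<mu> M4 by linarith+
  then have e0: "0 < \<epsilon>\<^sub>0" "\<epsilon>\<^sub>0 \<le> 1" using \<mu> by (simp_all add: \<epsilon>\<^sub>0_def)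
  show thesis
  proof (rule that[OF e0(1)])
    fix \<delta> assume \<delta>: "0 < \<delta>" "\<delta> < \<epsilon>\<^sub>0"
    have \<delta>1: "\<delta> < 1" using \<delta> e0 by simp
    have "6 * M ^ 4 * \<delta> \<le> 6 * M ^ 4 * \<epsilon>\<^sub>0" using \<delta> M4 by (intro mult_left_mono) auto
    also have "\<dots> = \<mu> / 2" using M(1) by (simp add: \<epsilon>\<^sub>0_def)
    finally have small1: "6 * M ^ 4 * \<delta> \<le> \<mu> / 2" .
    have small: "6 * M ^ 4 * \<delta>\<^sup>2 \<le> \<mu> / 2"
    proof -
      have "6 * M ^ 4 * \<delta>\<^sup>2 = (6 * M ^ 4 * \<delta>) * \<delta>" by (simp add: power2_eq_square)
      also have "\<dots> \<le> (6 * M ^ 4 * \<delta>) * 1" using \<delta> \<delta>1 M4 by (intro mult_left_mono) auto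
      finally show ?thesis using small1 by simp
    qed
    \<comment> \<open>The matrix with columns \<open>(g, g')\<close> and \<open>(h, h')\<close> has
      determinant \<open>w\<close>. The factor \<open>w\<close> in the energy shift cancels the
      division by \<open>w\<close> in its inverse, so \<open>w\<close> disappears from the entries
      below.\<close>
    define e where "e = E - w * \<delta>\<^sup>2"
    define x where "x n = \<theta> + of_int n * \<alpha>" for n :: int
    have xS: "x (n + 1) = x n + \<alpha>" for n by (simp add: x_def algebra_simps)
    \<comment> \<open>The coefficient of \<open>X n\<close> in \<open>g X + \<delta> h y\<close>
      once \<open>y\<close> is replaced by \<open>Z - \<delta> \<phi> X\<close>.\<close>
    define a where "a n = g (x n) - \<delta>\<^sup>2 * h (x n) * \<phi> (x n)" for n
    define A where "A n = 1 - \<delta>\<^sup>2 * \<phi> (x n) + \<delta>\<^sup>2 * (g (x n) - h (x n)) * a n" for n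
    define B where "B n = \<delta> + \<delta> ^ 3 * (g (x n) - h (x n)) * h (x n)" for n
    define C where "C n = - \<delta> * \<phi> (x n) + \<delta> * g (x n) * a n + \<delta> * \<phi> (x (n + 1)) * A n" for n
    define D where "D n = 1 + \<delta>\<^sup>2 * g (x n) * h (x n) + \<delta> * \<phi> (x (n + 1)) * B n" for n
    have det: "A n * D n - B n * C n = 1" for n
      unfolding A_def B_def C_def D_def a_def
      by (simp add: power2_eq_square power3_eq_cube algebra_simps)
    \<comment> \<open>This is the power \<open>s ^ n\<close> for integer \<open>n\<close>; it
      absorbs the sign of the double eigenvalue.\<close>
    define sg where "sg n = (if even n then 1 else s)" for n :: int
    have sgS: "sg (n + 1) = s * sg n" and sg2: "sg n * sg n = 1" and sgabs: "\<bar>sg n\<bar> = 1" for n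
      using s by (auto simp: sg_def)
    define u where "u X Z n = sg n * (a n * X n + \<delta> * h (x n) * Z n)" for X Z n
    define u' where "u' X Z n = sg n * (g' (x n) * X n + \<delta> * h' (x n) * (Z n - \<delta> * \<phi> (x n) * X n))" for X Z n
    have sol: "u' X Z (n + 1) = u X Z n"
      "u X Z (n + 1) = (e - 2 * lam * cos (2 * pi * x n)) * u X Z n - u' X Z n"
      if XZ: "X (n + 1) = A n * X n + B n * Z n" "Z (n + 1) = C n * X n + D n * Z n" for X Z n
    proof -
      define t where "t = a n * X n + \<delta> * h (x n) * Z n"
      define y where "y = Z n - \<delta> * \<phi> (x n) * X n"
      \<comment> \<open>The energy shift adds \<open>- w \<delta>\<^sup>2 t\<close> to the first
        entry of the image, which is the image of \<open>w \<delta>\<^sup>2 t\<close> times the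
        second unit vector. In the basis \<open>(g, g')\<close>, \<open>(h, h')\<close> that vector
        has coordinates \<open>- \<delta>\<^sup>2 h t\<close> and
        \<open>\<delta>\<^sup>2 g t\<close>. So \<open>P\<close> and \<open>Q\<close> are corrected
        coordinates, to which the unperturbed step, taking \<open>(P, Q)\<close> to
        \<open>(P + Q, Q)\<close>, is applied.\<close>
      define P where "P = X n - \<delta>\<^sup>2 * h (x n) * t"
      define Q where "Q = \<delta> * y + \<delta>\<^sup>2 * g (x n) * t"
      have t: "t = g (x n) * X n + \<delta> * h (x n) * y"
        by (simp add: t_def y_def a_def power2_eq_square algebra_simps)
      have X1: "X (n + 1) = P + Q"
        unfolding XZ A_def B_def P_def Q_def t_def y_def
        by (simp add: power2_eq_square power3_eq_cube algebra_simps)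
      have Q1: "\<delta> * (Z (n + 1) - \<delta> * \<phi> (x (n + 1)) * X (n + 1)) = Q"
        unfolding XZ C_def D_def Q_def t_def y_def
        by (simp add: power2_eq_square algebra_simps)
      have "u' X Z (n + 1) = sg (n + 1) * (g' (x (n + 1)) * (P + Q) + h' (x (n + 1)) * Q)"
        unfolding X1[symmetric] unfolding u'_def Q1[symmetric] by (simp add: mult.assoc mult.left_commute)
      also have "\<dots> = sg n * ((s * g' (x n + \<alpha>)) * P + (s * (h' (x n + \<alpha>) + g' (x n + \<alpha>))) * Q)"
        unfolding sgS xS by (simp add: algebra_simps)
      also have "\<dots> = sg n * (g (x n) * P + h (x n) * Q)"
        unfolding g' h' ..
      also have "\<dots> = sg n * t"
        unfolding P_def Q_def t by (simp add: power2_eq_square algebra_simps)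
      finally show "u' X Z (n + 1) = u X Z n" by (simp add: u_def t_def)
      have "u X Z (n + 1) = sg (n + 1) * (g (x (n + 1)) * X (n + 1) + h (x (n + 1)) * (\<delta> * (Z (n + 1) - \<delta> * \<phi> (x (n + 1)) * X (n + 1))))"
        by (simp add: u_def a_def power2_eq_square algebra_simps)
      also have "\<dots> = sg n * ((s * g (x n + \<alpha>)) * P + (s * (h (x n + \<alpha>) + g (x n + \<alpha>))) * Q)"
        unfolding Q1 unfolding X1 sgS xS by (simp add: algebra_simps)
      also have "\<dots> = sg n * ((E - 2 * lam * cos (2 * pi * x n)) * (g (x n) * P + h (x n) * Q) - (g' (x n) * P + h' (x n) * Q))"
        unfolding g h by (simp add: algebra_simps)
      also have "g (x n) * P + h (x n) * Q = t"
        unfolding P_def Q_def t by (simp add: power2_eq_square algebra_simps)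
      also have "g' (x n) * P + h' (x n) * Q
          = g' (x n) * X n + \<delta> * h' (x n) * y + \<delta>\<^sup>2 * t * (g (x n) * h' (x n) - g' (x n) * h (x n))"
        unfolding P_def Q_def by (simp add: algebra_simps)
      finally show "u X Z (n + 1) = (e - 2 * lam * cos (2 * pi * x n)) * u X Z n - u' X Z n"
        unfolding wronskian u_def u'_def y_def[symmetric] t_def[symmetric] e_def
        by (simp add: algebra_simps)
    qed
    have M2: "M \<le> M\<^sup>2" "M\<^sup>2 \<le> M ^ 3" "M ^ 3 \<le> M ^ 4"
      using M(1) by (auto simp: power2_eq_square power3_eq_cube power4_eq_xxxx)
    have d2: "0 \<le> \<delta>\<^sup>2" "\<delta>\<^sup>2 \<le> \<delta>" "\<delta>\<^sup>2 \<le> 1"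
      using \<delta> \<delta>1 by (auto simp: power2_eq_square mult_le_one)
    have prod: "\<bar>p * q\<bar> \<le> P * Q" if "\<bar>p\<bar> \<le> P" "\<bar>q\<bar> \<le> Q" for p q P Q :: real
      using that by (simp add: abs_mult mult_mono')
    have a_bd: "\<bar>a n\<bar> \<le> 2 * M\<^sup>2" for n
    proof -
      have "\<bar>h (x n) * \<phi> (x n)\<bar> \<le> M\<^sup>2"
        using prod[OF M(3,4)] by (simp add: power2_eq_square)
      then have "\<bar>\<delta>\<^sup>2 * (h (x n) * \<phi> (x n))\<bar> \<le> 1 * M\<^sup>2"
        using d2 by (intro prod) auto
      then show ?thesis using M(2)[of "x n"] M2 by (simp add: a_def mult.assoc)
    qed
    have gh: "\<bar>g (x n) - h (x n)\<bar> \<le> 2 * M" for n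
      using M(2,3)[of "x n"] by linarith
    have A_bd: "\<bar>A n - 1\<bar> \<le> \<delta>\<^sup>2 * (5 * M ^ 3)" for n
    proof -
      have "\<bar>(g (x n) - h (x n)) * a n\<bar> \<le> (2 * M) * (2 * M\<^sup>2)" by (rule prod[OF gh a_bd])
      then have "\<bar>- \<phi> (x n) + (g (x n) - h (x n)) * a n\<bar> \<le> 5 * M ^ 3"
        using M(4)[of "x n"] M2 by (simp add: power2_eq_square power3_eq_cube)
      then have "\<bar>\<delta>\<^sup>2 * (- \<phi> (x n) + (g (x n) - h (x n)) * a n)\<bar> \<le> \<delta>\<^sup>2 * (5 * M ^ 3)"
        using d2 by (intro prod) auto
      then show ?thesis by (simp add: A_def algebra_simps)
    qed
    have B_bd: "\<bar>B n - \<delta>\<bar> \<le> \<delta> * (\<delta>\<^sup>2 * (2 * M\<^sup>2))" for n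
    proof -
      have "\<bar>(g (x n) - h (x n)) * h (x n)\<bar> \<le> 2 * M\<^sup>2"
        using prod[OF gh M(3), of n "x n"] by (simp only: power2_eq_square mult.assoc)
      then have "\<bar>\<delta> * (\<delta>\<^sup>2 * ((g (x n) - h (x n)) * h (x n)))\<bar> \<le> \<delta> * (\<delta>\<^sup>2 * (2 * M\<^sup>2))"
        using \<delta> by (intro prod[OF _ prod]) auto
      then show ?thesis by (simp add: B_def power2_eq_square power3_eq_cube algebra_simps)
    qed
    \<comment> \<open>The new coordinate contributes \<phi> at \<open>x n + \<alpha>\<close> and the
      old one subtracts \<phi> at \<open>x n\<close>, which completes the square of \<open>g\<close>
      to the positive function. The constant 6 is 5 from \<open>A n - 1\<close> plus 1 from
      \<open>a n - g (x n)\<close>.\<close>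
    have C_bd: "\<bar>C n - \<delta> * ((g (x n))\<^sup>2 + \<phi> (x n + \<alpha>) - \<phi> (x n))\<bar> \<le> \<delta> * (\<delta>\<^sup>2 * (6 * M ^ 4))" for n
    proof -
      have 1: "\<bar>g (x n) * (\<delta>\<^sup>2 * (h (x n) * \<phi> (x n)))\<bar> \<le> M * (\<delta>\<^sup>2 * (M * M))"
        using d2 by (intro prod M) auto
      have 2: "\<bar>\<phi> (x n + \<alpha>) * (A n - 1)\<bar> \<le> M * (\<delta>\<^sup>2 * (5 * M ^ 3))"
        by (intro prod M A_bd)
      have 3: "M * (\<delta>\<^sup>2 * (M * M)) \<le> \<delta>\<^sup>2 * M ^ 4"
        using mult_left_mono[OF M2(3) d2(1)] by (simp add: power3_eq_cube ac_simps)
      have 4: "M * (\<delta>\<^sup>2 * (5 * M ^ 3)) = 5 * (\<delta>\<^sup>2 * M ^ 4)"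
        by (simp add: power3_eq_cube power4_eq_xxxx)
      have "\<bar>\<phi> (x n + \<alpha>) * (A n - 1) - g (x n) * (\<delta>\<^sup>2 * (h (x n) * \<phi> (x n)))\<bar> \<le> \<delta>\<^sup>2 * (6 * M ^ 4)"
        using 1 2 3 4 by linarith
      then have "\<bar>\<delta> * (\<phi> (x n + \<alpha>) * (A n - 1) - g (x n) * (\<delta>\<^sup>2 * (h (x n) * \<phi> (x n))))\<bar> \<le> \<delta> * (\<delta>\<^sup>2 * (6 * M ^ 4))"
        using \<delta> by (intro prod) auto
      also have "\<delta> * (\<phi> (x n + \<alpha>) * (A n - 1) - g (x n) * (\<delta>\<^sup>2 * (h (x n) * \<phi> (x n))))
          = C n - \<delta> * ((g (x n))\<^sup>2 + \<phi> (x n + \<alpha>) - \<phi> (x n))"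
        unfolding C_def xS by (simp add: a_def power2_eq_square algebra_simps)
      finally show ?thesis .
    qed
    have D_bd: "\<bar>D n - 1\<bar> \<le> \<delta>\<^sup>2 * (4 * M ^ 3)" for n
    proof -
      have "\<delta> * (\<delta>\<^sup>2 * (2 * M\<^sup>2)) \<le> \<delta> * (2 * M\<^sup>2)"
        using d2 \<delta> by (intro mult_left_mono mult_left_le_one_le) auto
      moreover have "\<delta> * 1 \<le> \<delta> * M\<^sup>2"
        using M2(1) M(1) \<delta> by (intro mult_left_mono) auto
      moreover have "\<delta> * (3 * M\<^sup>2) = \<delta> * (2 * M\<^sup>2) + \<delta> * M\<^sup>2"
        by (simp add: algebra_simps)
      ultimately have "\<bar>B n\<bar> \<le> \<delta> * (3 * M\<^sup>2)"
        using B_bd[of n] \<delta>(1) by linarith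
      then have 1: "\<bar>\<phi> (x (n + 1)) * B n\<bar> \<le> M * (\<delta> * (3 * M\<^sup>2))"
        by (intro prod M)
      have 2: "\<bar>\<delta> * (g (x n) * h (x n))\<bar> \<le> \<delta> * (M * M)"
        using \<delta> by (intro prod M) auto
      have "M * (\<delta> * (3 * M\<^sup>2)) = \<delta> * (3 * M ^ 3)" by (simp add: power2_eq_square power3_eq_cube)
      moreover have "\<delta> * (M * M) \<le> \<delta> * M ^ 3"
        using M2 \<delta> by (intro mult_left_mono) (auto simp: power2_eq_square)
      ultimately have "\<bar>\<delta> * (g (x n) * h (x n)) + \<phi> (x (n + 1)) * B n\<bar> \<le> \<delta> * (4 * M ^ 3)"
        using 1 2 by linarith
      then have "\<bar>\<delta> * (\<delta> * (g (x n) * h (x n)) + \<phi> (x (n + 1)) * B n)\<bar> \<le> \<delta> * (\<delta> * (4 * M ^ 3))"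
        using \<delta> by (intro prod) auto
      then show ?thesis by (simp add: D_def power2_eq_square algebra_simps)
    qed
    define \<gamma> where "\<gamma> = \<delta> * \<mu> / 2"
    have \<gamma>: "0 < \<gamma>" "\<gamma> \<le> 1 / 2"
      using \<delta> \<delta>1 \<mu> mult_le_one[of \<delta> \<mu>] by (auto simp: \<gamma>_def)
    have sm3: "\<delta>\<^sup>2 * (5 * M ^ 3) \<le> 1 / 2" "\<delta>\<^sup>2 * (4 * M ^ 3) \<le> 1 / 2" "\<delta>\<^sup>2 * (2 * M\<^sup>2) \<le> 1 / 2"
    proof -
      have "M\<^sup>2 * \<delta>\<^sup>2 \<le> M ^ 4 * \<delta>\<^sup>2" "M ^ 3 * \<delta>\<^sup>2 \<le> M ^ 4 * \<delta>\<^sup>2"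
        using M2 d2 by (auto intro!: mult_right_mono)
      moreover have "0 \<le> M ^ 4 * \<delta>\<^sup>2" using M4 d2 by simp
      ultimately show "\<delta>\<^sup>2 * (5 * M ^ 3) \<le> 1 / 2" "\<delta>\<^sup>2 * (4 * M ^ 3) \<le> 1 / 2" "\<delta>\<^sup>2 * (2 * M\<^sup>2) \<le> 1 / 2"
        using small \<mu> by (auto simp: mult.commute)
    qed
    have lowB: "\<gamma> \<le> B n" "B n \<le> 2" for n
    proof -
      have "\<delta> * (\<delta>\<^sup>2 * (2 * M\<^sup>2)) \<le> \<delta> * (1 / 2)" by (rule mult_left_mono[OF sm3(3)]) (use \<delta> in simp)
      moreover have "\<gamma> \<le> \<delta> / 2" using \<delta> \<mu> by (simp add: \<gamma>_def)
      ultimately show "\<gamma> \<le> B n" "B n \<le> 2" using B_bd[of n] \<delta>1 \<delta>(1) by linarith+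
    qed
    have lowC: "\<gamma> \<le> C n" "C n \<le> M\<^sup>2 + 2 * M + 1" for n
    proof -
      define b where "b = (g (x n))\<^sup>2 + \<phi> (x n + \<alpha>) - \<phi> (x n)"
      have err: "\<delta> * (\<delta>\<^sup>2 * (6 * M ^ 4)) \<le> \<delta> * (\<mu> / 2)"
        using small \<delta> by (intro mult_left_mono) (auto simp: ac_simps)
      have "\<delta> * \<mu> \<le> \<delta> * b" using \<phi>[of "x n"] \<mu> \<delta> by (intro mult_left_mono) (auto simp: b_def)
      then show "\<gamma> \<le> C n" using C_bd[of n] err unfolding b_def[symmetric] \<gamma>_def by linarith
      have "(g (x n))\<^sup>2 \<le> M\<^sup>2" using M(2)[of "x n"] by (simp add: abs_le_square_iff[symmetric])
      then have "b \<le> M\<^sup>2 + 2 * M" using M(4)[of "x n"] M(4)[of "x n + \<alpha>"] by (simp add: b_def abs_le_iff)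
      moreover have "0 \<le> b" using \<phi>[of "x n"] \<kappa> by (simp add: b_def)
      ultimately have "\<delta> * b \<le> M\<^sup>2 + 2 * M"
        using \<delta> \<delta>1 mult_left_le_one_le[of b \<delta>] by simp
      moreover have "\<delta> * (\<mu> / 2) \<le> 1" using \<gamma> by (simp add: \<gamma>_def)
      ultimately show "C n \<le> M\<^sup>2 + 2 * M + 1"
        using C_bd[of n] err unfolding b_def[symmetric] by linarith
    qed
    define \<Gamma> where "\<Gamma> = M\<^sup>2 + 2 * M + 2"
    have \<Gamma>: "2 \<le> \<Gamma>" "M\<^sup>2 + 2 * M + 1 \<le> \<Gamma>" using M(1) by (auto simp: \<Gamma>_def)
    have lowAD: "\<gamma> \<le> A n" "A n \<le> \<Gamma>" "\<gamma> \<le> D n" "D n \<le> \<Gamma>" for n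
      using A_bd[of n] D_bd[of n] sm3 \<gamma> \<Gamma> by linarith+
    have upB: "B n \<le> \<Gamma>" and upC: "C n \<le> \<Gamma>" for n
      using lowB(2)[of n] lowC(2)[of n] \<Gamma> by linarith+
    obtain X Y X' Y' K r where r: "0 < r" "r < 1"
      and pos: "\<And>n. X n > 0" "\<And>n. Y n > 0" "\<And>n. X' n > 0" "\<And>n. Y' n > 0"
      and XY: "\<And>n. X (n + 1) = A n * X n + B n * Y n" "\<And>n. Y (n + 1) = C n * X n + D n * Y n"
      and XY': "\<And>n. X' (n + 1) = A n * X' n - B n * Y' n" "\<And>n. Y' (n + 1) = D n * Y' n - C n * X' n"
      and dec: "\<And>m n. m \<le> n \<Longrightarrow> (X m + Y m) * (X' n + Y' n) \<le> K * r ^ nat (n - m)"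
      by (rule positive_matrix_dichotomy[of \<gamma> A B C D \<Gamma>, OF \<gamma>(1) lowAD(1) lowB(1) lowC(1) lowAD(3)
            lowAD(2) upB upC lowAD(4) det]) blast
    \<comment> \<open>The dichotomy delivers the decaying solution with its second coordinate
      negated.\<close>
    define Z where "Z n = - Y' n" for n
    have XZ: "X' (n + 1) = A n * X' n + B n * Z n" "Z (n + 1) = C n * X' n + D n * Z n" for n
      using XY'[of n] by (simp_all add: Z_def algebra_simps)
    have recur: "u X Z (n + 1) + u X Z (n - 1) + (2 * lam * cos (2 * pi * (\<theta> + of_int n * \<alpha>)) - e) * u X Z n = 0"
      if XZ: "\<And>n. X (n + 1) = A n * X n + B n * Z n" "\<And>n. Z (n + 1) = C n * X n + D n * Z n" for X Z n
      using sol[of X n Z, OF XZ[of n]] sol(1)[of X "n - 1" Z] XZ[of "n - 1"]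
      by (simp add: x_def algebra_simps)
    have prev: "u X Z (- 1) = u' X Z 0"
      if XZ: "\<And>n. X (n + 1) = A n * X n + B n * Z n" "\<And>n. Z (n + 1) = C n * X n + D n * Z n" for X Z
      using sol(1)[of X "- 1" Z] XZ[of "- 1"] by simp
    have u_bd: "\<bar>u X Z n\<bar> \<le> 3 * M\<^sup>2 * (\<bar>X n\<bar> + \<bar>Z n\<bar>)" for X Z n
    proof -
      have "\<bar>a n * X n\<bar> \<le> (3 * M\<^sup>2) * \<bar>X n\<bar>"
        using a_bd[of n] by (intro prod) auto
      moreover have "\<bar>\<delta> * h (x n)\<bar> \<le> 1 * M" using \<delta> \<delta>1 by (intro prod M) auto
      then have "\<bar>\<delta> * h (x n) * Z n\<bar> \<le> (3 * M\<^sup>2) * \<bar>Z n\<bar>"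
        using M2(1) M(1) by (intro prod[where P = "3 * M\<^sup>2"]; linarith)
      ultimately have "\<bar>a n * X n + \<delta> * h (x n) * Z n\<bar> \<le> 3 * M\<^sup>2 * (\<bar>X n\<bar> + \<bar>Z n\<bar>)"
        by (simp add: distrib_left)
      then show ?thesis by (simp add: u_def abs_mult sgabs)
    qed
    have "e \<notin> amo_spectrum lam \<alpha> \<theta>"
    proof (rule not_in_amo_spectrum[where u = "u X Y" and v = "u X' Z" and r = r and K = "(3 * M\<^sup>2)\<^sup>2 * K"])
      have "u X Y 0 * u X' Z (- 1) - u X Y (- 1) * u X' Z 0 = u X Y 0 * u' X' Z 0 - u' X Y 0 * u X' Z 0"
        using prev[OF XY] prev[OF XZ] by simp
      also have "\<dots> = (sg 0 * sg 0) * (\<delta> * (X 0 * Z 0 - Y 0 * X' 0) * (g (x 0) * h' (x 0) - g' (x 0) * h (x 0)))"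
        unfolding u_def u'_def a_def by (simp add: power2_eq_square algebra_simps)
      also have "\<dots> = - w * \<delta> * (X 0 * Y' 0 + Y 0 * X' 0)"
        unfolding wronskian sg2 by (simp add: Z_def algebra_simps)
      also have "\<dots> \<noteq> 0"
        using w \<delta> pos by (simp add: add_pos_pos less_imp_neq[symmetric])
      finally show "u X Y 0 * u X' Z (- 1) - u X Y (- 1) * u X' Z 0 \<noteq> 0" .
      show "\<bar>u X Y m * u X' Z n\<bar> \<le> (3 * M\<^sup>2)\<^sup>2 * K * r ^ nat (n - m)" if "m \<le> n" for m n
      proof -
        have "\<bar>u X Y m * u X' Z n\<bar> \<le> (3 * M\<^sup>2 * (\<bar>X m\<bar> + \<bar>Y m\<bar>)) * (3 * M\<^sup>2 * (\<bar>X' n\<bar> + \<bar>Z n\<bar>))"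
          by (intro prod u_bd)
        also have "\<dots> = (3 * M\<^sup>2)\<^sup>2 * ((X m + Y m) * (X' n + Y' n))"
          using pos[of m] pos[of n] by (simp add: Z_def power2_eq_square)
        also have "\<dots> \<le> (3 * M\<^sup>2)\<^sup>2 * (K * r ^ nat (n - m))"
          using dec[OF that] by (intro mult_left_mono) auto
        finally show ?thesis by simp
      qed
    qed (use recur[OF XY] recur[OF XZ] r in auto)
    then show "E - w * \<delta>\<^sup>2 \<notin> amo_spectrum lam \<alpha> \<theta>" by (simp add: e_def)
  qed
qed

section \<open>Aubry duality\<close>

lemma cos_le_cos_far:
  fixes y d :: real
  assumes "0 \<le> d" "d \<le> \<bar>y\<bar>" "\<bar>y\<bar> \<le> 1 - d"
  shows "cos (2 * pi * y) \<le> cos (2 * pi * d)"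
proof -
  have ab: "cos (2 * pi * y) = cos (2 * pi * \<bar>y\<bar>)"
    by (simp add: abs_if)
  show ?thesis
  proof (cases "\<bar>y\<bar> \<le> 1 / 2")
    case True
    then show ?thesis
      unfolding ab using assms by (intro cos_monotone_0_pi_le) auto
  next
    case False
    have "cos (2 * pi * \<bar>y\<bar>) = cos (2 * pi * (1 - \<bar>y\<bar>))"
      by (simp add: algebra_simps cos_diff)
    also have "\<dots> \<le> cos (2 * pi * d)"
      using assms False by (intro cos_monotone_0_pi_le) auto
    finally show ?thesis unfolding ab .
  qed
qed

text \<open>Testing against powers of \<open>1 + cos (2 \<pi> (x - x0)) - cos (2 \<pi> d)\<close>, which exceeds \<open>1\<close>
  exactly near \<open>x0\<close>, isolates the sign of \<open>f\<close> at \<open>x0\<close>.\<close>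

lemma fourier_coefficients_zero:
  fixes f :: "real \<Rightarrow> complex"
  assumes cont: "continuous_on {0..1} f"
    and zero: "\<And>k::int. integral {0..1} (\<lambda>x. f x * cis (2 * pi * k * x)) = 0"
    and x0: "0 < x0" "x0 < 1"
  shows "f x0 = 0"
proof (rule ccontr)
  assume nz: "f x0 \<noteq> 0"
  \<comment> \<open>Multiplication by the conjugate of \<open>f x0\<close> produces a real function
    that is positive at \<open>x0\<close>.\<close>
  define g where "g x = Re (cnj (f x0) * f x)" for x
  define r where "r = (cmod (f x0))\<^sup>2"
  have r: "0 < r" using nz by (simp add: r_def)
  have gx0: "g x0 = r"
    using cmod_power2[of "f x0"] by (simp add: g_def r_def power2_eq_square)
  have gc: "continuous_on {0..1} g" unfolding g_def by (intro continuous_intros cont)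
  obtain d0 where d0: "0 < d0" "\<And>x. x \<in> {0..1} \<Longrightarrow> \<bar>x - x0\<bar> < d0 \<Longrightarrow> r / 2 < g x"
  proof -
    have "\<exists>d>0. \<forall>x\<in>{0..1}. dist x x0 < d \<longrightarrow> dist (g x) (g x0) < r / 2"
      using gc[unfolded continuous_on_iff, rule_format, of x0 "r / 2"] x0 r by simp
    then obtain d where d: "d > 0" "\<And>x. x \<in> {0..1} \<Longrightarrow> \<bar>x - x0\<bar> < d \<Longrightarrow> \<bar>g x - r\<bar> < r / 2"
      by (auto simp: dist_real_def gx0)
    show thesis
    proof (rule that[OF d(1)])
      show "r / 2 < g x" if "x \<in> {0..1}" "\<bar>x - x0\<bar> < d" for x
        using d(2)[OF that] by linarith
    qed
  qed
  \<comment> \<open>Besides making \<open>g\<close> large near \<open>x0\<close>, this keeps every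
    point of the unit interval at distance at most \<open>1 - d\<close> from \<open>x0\<close>, so
    the next peak of the cosine, one period away, does not interfere.\<close>
  define d where "d = min (d0 / 2) (min (x0 / 2) ((1 - x0) / 2))"
  have d: "0 < d" "d < d0" "d \<le> x0 / 2" "d \<le> (1 - x0) / 2" using d0(1) x0 by (auto simp: d_def min_def)
  define T where "T x = 1 + cos (2 * pi * (x - x0)) - cos (2 * pi * d)" for x
  \<comment> \<open>The value of \<open>T\<close> at distance \<open>d / 2\<close> from
    \<open>x0\<close>, hence a lower bound for \<open>T\<close> on \<open>J\<close>.\<close>
  define q where "q = 1 + cos (pi * d) - cos (2 * pi * d)"
  have q: "1 < q"
    using d x0 cos_monotone_0_pi[of "pi * d" "2 * pi * d"] by (simp add: q_def)
  obtain M where M: "\<And>x. x \<in> {0..1} \<Longrightarrow> \<bar>g x\<bar> \<le> M"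
  proof -
    have "bounded (g ` {0..1})" by (intro compact_imp_bounded compact_continuous_image gc) auto
    then show thesis using that by (metis bounded_iff imageI real_norm_def)
  qed
  have M0: "0 \<le> M" using M[of 0] by simp
  have Tcis: "complex_of_real (T x) = (1 - cos (2 * pi * d)) + (cis (- 2 * pi * x0) * cis (2 * pi * x) + cis (2 * pi * x0) * cis (- 2 * pi * x)) / 2" for x
    by (simp add: T_def complex_eq_iff cos_diff right_diff_distrib)
  have ci: "(\<lambda>x. f x * of_real (T x) ^ n * cis (2 * pi * of_int k * x)) integrable_on {0..1}" for n and k :: int
    unfolding T_def by (intro integrable_continuous_interval continuous_intros cont)
  \<comment> \<open>All frequencies are treated at once, because one more factor \<open>T\<close>
    moves the frequency by 1 in either direction.\<close>
  have int0: "integral {0..1} (\<lambda>x. f x * of_real (T x) ^ n * cis (2 * pi * of_int k * x)) = 0" for n and k :: int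
  proof (induction n arbitrary: k)
    case 0 then show ?case using zero[of k] by simp
  next
    case (Suc n)
    define I where "I k x = f x * of_real (T x) ^ n * cis (2 * pi * of_int k * x)" for k :: int and x
    have Ii: "I k integrable_on {0..1}" for k unfolding I_def[abs_def] by (rule ci)
    have I0: "integral {0..1} (I k) = 0" for k unfolding I_def[abs_def] by (rule Suc)
    have "f x * of_real (T x) ^ Suc n * cis (2 * pi * of_int k * x)
        = (1 - cos (2 * pi * d)) * I k x + (cis (- 2 * pi * x0) / 2 * I (k + 1) x + cis (2 * pi * x0) / 2 * I (k - 1) x)" for x
    proof -
      have "cis (2 * pi * of_int (k + 1) * x) = cis (2 * pi * of_int k * x) * cis (2 * pi * x)"
        "cis (2 * pi * of_int (k - 1) * x) = cis (2 * pi * of_int k * x) * cis (- 2 * pi * x)"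
        by (simp_all add: cis_mult algebra_simps)
      then show ?thesis
        unfolding I_def power_Suc Tcis by (simp add: algebra_simps add_divide_distrib)
    qed
    then show ?case
      by (simp only:) (simp add: Ii I0 integral_add integrable_add integrable_on_mult_right)
  qed
  have gT0: "integral {0..1} (\<lambda>x. g x * T x ^ n) = 0" for n
  proof -
    have "integral {0..1} (\<lambda>x. Re (cnj (f x0) * (f x * of_real (T x) ^ n * cis (2 * pi * of_int 0 * x))))
        = Re (integral {0..1} (\<lambda>x. cnj (f x0) * (f x * of_real (T x) ^ n * cis (2 * pi * of_int 0 * x))))"
      by (subst integral_linear[OF integrable_on_mult_right[OF ci] bounded_linear_Re, symmetric])
        (simp only: o_def)
    also have "\<dots> = 0" by (simp only: integral_mult_right int0) simp
    finally show ?thesis by (simp add: g_def Re_complex_of_real mult.assoc[symmetric] flip: of_real_power)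
  qed
  define J where "J = {x0 - d / 2 .. x0 + d / 2}"
  have J: "J \<subseteq> {0..1}" using d x0 by (auto simp: J_def)
  have lowJ: "r / 2 * q ^ n \<le> g x * T x ^ n" if "x \<in> J" for x n
  proof -
    have x: "x \<in> {0..1}" "\<bar>x - x0\<bar> \<le> d / 2" using that J by (auto simp: J_def abs_if)
    have "cos (pi * d) \<le> cos \<bar>2 * pi * (x - x0)\<bar>"
      using x d x0 by (intro cos_monotone_0_pi_le) (auto simp: abs_mult)
    then have "q \<le> T x" by (simp add: q_def T_def)
    moreover have "r / 2 < g x" using d0(2)[OF x(1)] x d by simp
    ultimately show ?thesis using q r by (intro mult_mono power_mono) auto
  qed
  have low: "- M \<le> g x * T x ^ n" if x: "x \<in> {0..1}" for x n
  proof (cases "\<bar>x - x0\<bar> \<le> d")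
    case True
    have "cos (2 * pi * d) \<le> cos \<bar>2 * pi * (x - x0)\<bar>"
      using True d x0 by (intro cos_monotone_0_pi_le) (auto simp: abs_mult)
    then have "0 \<le> T x" by (simp add: T_def)
    moreover have "0 \<le> g x" using d0(2)[OF x] True d r by simp
    ultimately show ?thesis using M0 by (smt (verit) mult_nonneg_nonneg zero_le_power)
  next
    case False
    have "cos (2 * pi * (x - x0)) \<le> cos (2 * pi * d)"
      using False x x0 d by (intro cos_le_cos_far) auto
    then have "\<bar>T x\<bar> \<le> 1"
      using cos_ge_minus_one[of "2 * pi * (x - x0)"] cos_le_one[of "2 * pi * d"] unfolding T_def by (intro abs_leI) linarith+
    then have "\<bar>T x ^ n\<bar> \<le> 1" by (simp add: power_abs power_le_one)
    then have "\<bar>g x * T x ^ n\<bar> \<le> M * 1"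
      unfolding abs_mult using M[OF x] by (intro mult_mono) auto
    then show ?thesis by simp
  qed
  \<comment> \<open>Adding \<open>M\<close> makes the integrand nonnegative with total integral
    \<open>M\<close>, so its part over the interval \<open>J\<close> of length \<open>d\<close> is
    at most \<open>M\<close>. Since \<open>q > 1\<close>, this fails for large
    \<open>n\<close>.\<close>
  have "d * (r / 2) * q ^ n \<le> M" for n
  proof -
    have icont: "continuous_on {0..1} (\<lambda>x. g x * T x ^ n)"
      unfolding T_def by (intro continuous_intros gc)
    have i1: "(\<lambda>x. g x * T x ^ n + M) integrable_on {0..1}"
      by (rule integrable_continuous_interval[OF continuous_on_add[OF icont continuous_on_const]])
    have i2: "(\<lambda>x. g x * T x ^ n + M) integrable_on J"
      using J integrable_subinterval_real[OF i1] unfolding J_def by blast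
    have "d * (r / 2 * q ^ n) = integral J (\<lambda>x. r / 2 * q ^ n)"
      using d by (simp add: J_def)
    also have "\<dots> \<le> integral J (\<lambda>x. g x * T x ^ n + M)"
      using lowJ M0 by (intro integral_le i2) (auto simp: J_def add_increasing2)
    also have "\<dots> \<le> integral {0..1} (\<lambda>x. g x * T x ^ n + M)"
      using low[of _ n] by (intro integral_subset_le J i1 i2) (metis add.commute add.right_inverse add_le_cancel_left)
    also have "\<dots> = M"
      by (subst integral_add[OF integrable_continuous_interval[OF icont] integrable_const_ivl]) (simp add: gT0)
    finally show ?thesis by simp
  qed
  moreover obtain n where "M / (d * (r / 2)) < q ^ n"
    using real_arch_pow[OF q] by blast
  then have "M < d * (r / 2) * q ^ n" using d r by (simp add: field_simps)
  ultimately show False by (meson not_le)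
qed

lemma integral_periodic_shift:
  fixes f :: "real \<Rightarrow> complex"
  assumes cont: "continuous_on UNIV f" and per: "\<And>x. f (x + 1) = f x"
  shows "integral {0..1} (\<lambda>x. f (x + a)) = integral {0..1} f"
proof -
  have perk: "f (x + of_int k) = f x" for x k
  proof (induction k rule: int_induct[where k = 0])
    case (step1 i) then show ?case using per[of "x + of_int i"] by (simp add: add.assoc)
  next
    case (step2 i) then show ?case using per[of "x + of_int (i - 1)"] by (simp add: algebra_simps)
  qed simp
  have i: "f integrable_on {p..q}" for p q
    using continuous_on_subset[OF cont] by (intro integrable_continuous_interval) auto
  have sh: "integral {p..q} (\<lambda>x. f (x + b)) = integral {p + b..q + b} f" for p q b
    using integral_shift[of p b q f] continuous_on_subset[OF cont] by (simp add: o_def)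
  define b where "b = frac a"
  have b: "0 \<le> b" "b \<le> 1" by (simp_all add: b_def frac_ge_0 less_imp_le[OF frac_lt_1])
  have "f (x + a) = f (x + b)" for x
    using perk[of "x + b" "\<lfloor>a\<rfloor>"] by (simp add: b_def frac_def)
  then have "integral {0..1} (\<lambda>x. f (x + a)) = integral {b..1 + b} f"
    using sh[of 0 1 b] by simp
  also have "\<dots> = integral {b..1} f + integral {1..1 + b} f"
    using b i by (intro Henstock_Kurzweil_Integration.integral_combine [symmetric]) auto
  also have "integral {1..1 + b} f = integral {0..b} f"
    using sh[of 0 b 1] by (simp add: per add.commute)
  also have "integral {b..1} f + integral {0..b} f = integral {0..1} f"
    using b i by (subst add.commute) (intro Henstock_Kurzweil_Integration.integral_combine; auto)
  finally show ?thesis .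
qed


text \<open>Aubry duality: the Fourier coefficients of a solution of the functional equation solve a
  second-order difference equation. Two such sequences have a constant Wronskian, which vanishes by
  the Riemann--Lebesgue lemma.\<close>

context
  fixes \<kappa> :: real
begin

text \<open>The frequencies are shifted by \<kappa> because \<open>H\<close> gains the phase
  \<open>cis (2 * pi * \<kappa>)\<close> over a period. Later \<kappa> is 0 or 1/2, according to the
  sign of the period.\<close>

definition fourier_coeff :: "(real \<Rightarrow> complex) \<Rightarrow> int \<Rightarrow> complex" where
  "fourier_coeff H k = integral {0..1} (\<lambda>x. H x * cis (- 2 * pi * (of_int k + \<kappa>) * x))"

context
  fixes H :: "real \<Rightarrow> complex"
  assumes cont: "continuous_on UNIV H" and per: "\<And>x. H (x + 1) = cis (2 * pi * \<kappa>) * H x"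
begin

lemma continuous_on_shift: "continuous_on S (\<lambda>x. H (x + \<beta>))"
  by (rule continuous_on_compose2[OF cont]) (auto intro: continuous_intros)

text \<open>The phase of \<open>H\<close> cancels that of the exponential, so the product is
  genuinely periodic and the integral may be translated. This turns the shifts of the functional
  equation into multipliers.\<close>

lemma fourier_coeff_shift:
  "integral {0..1} (\<lambda>x. H (x + \<beta>) * cis (- 2 * pi * (of_int k + \<kappa>) * x))
     = cis (2 * pi * (of_int k + \<kappa>) * \<beta>) * fourier_coeff H k"
proof -
  define p where "p x = H x * cis (- 2 * pi * (of_int k + \<kappa>) * x)" for x
  have pc: "continuous_on UNIV p" unfolding p_def[abs_def] by (intro continuous_intros cont)
  have "cis (2 * pi * \<kappa>) * cis (- 2 * pi * (of_int k + \<kappa>) * (x + 1)) = cis (- 2 * pi * (of_int k + \<kappa>) * x)" for x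
  proof -
    have "cis (2 * pi * \<kappa>) * cis (- 2 * pi * (of_int k + \<kappa>) * (x + 1))
        = cis (- 2 * pi * (of_int k + \<kappa>) * x) * cis (2 * pi * of_int (- k))"
      by (simp add: cis_mult algebra_simps)
    also have "cis (2 * pi * of_int (- k)) = 1"
      by (rule cis_multiple_2pi) auto
    finally show ?thesis by simp
  qed
  then have pp: "p (x + 1) = p x" for x
    by (simp add: p_def per mult.assoc[symmetric] mult.commute[of _ "H x"])
  have "H (x + \<beta>) * cis (- 2 * pi * (of_int k + \<kappa>) * x) = cis (2 * pi * (of_int k + \<kappa>) * \<beta>) * p (x + \<beta>)" for x
    by (simp add: p_def mult.left_commute cis_mult algebra_simps)
  then have "integral {0..1} (\<lambda>x. H (x + \<beta>) * cis (- 2 * pi * (of_int k + \<kappa>) * x))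
      = cis (2 * pi * (of_int k + \<kappa>) * \<beta>) * integral {0..1} (\<lambda>x. p (x + \<beta>))"
    by (simp only: integral_mult_right)
  then show ?thesis
    unfolding integral_periodic_shift[OF pc pp] by (simp add: fourier_coeff_def p_def[abs_def])
qed

text \<open>Translation by half a wavelength reverses the sign of the exponential. Twice the
  coefficient is therefore the integral of \<open>H x - H (x + h)\<close> against it, with
  \<open>h\<close> tending to 0, and uniform continuity applies.\<close>

lemma fourier_coeff_tendsto_0: "(\<lambda>n. fourier_coeff H (int n)) \<longlonglongrightarrow> 0"
proof (rule LIMSEQ_I)
  fix \<epsilon> :: real assume \<epsilon>: "0 < \<epsilon>"
  have "uniformly_continuous_on {0..2} H"
    by (intro compact_uniformly_continuous continuous_on_subset[OF cont]) auto
  then obtain d where d: "0 < d" "\<And>x y. x \<in> {0..2} \<Longrightarrow> y \<in> {0..2} \<Longrightarrow> dist y x < d \<Longrightarrow> dist (H y) (H x) < \<epsilon>"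
    using \<epsilon> unfolding uniformly_continuous_on_def by metis
  obtain N :: nat where N: "1 / d + \<bar>\<kappa>\<bar> + 1 < real N" using reals_Archimedean2 by blast
  show "\<exists>no. \<forall>n\<ge>no. norm (fourier_coeff H (int n) - 0) < \<epsilon>"
  proof (intro exI allI impI)
    fix n assume n: "N \<le> n"
    define k where "k = real n + \<kappa>"
    have k: "1 / d < k" "1 < k"
      using N n d(1) zero_less_divide_1_iff[of d] unfolding k_def by linarith+
    define h where "h = 1 / (2 * k)"
    have h: "0 < h" "h < 1" "h < d"
      using k d(1) by (auto simp: h_def field_simps)
    let ?e = "\<lambda>x. cis (- 2 * pi * (of_int (int n) + \<kappa>) * x)"
    have "integral {0..1} (\<lambda>x. H (x + h) * ?e x) = cis (2 * pi * (of_int (int n) + \<kappa>) * h) * fourier_coeff H (int n)"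
      by (rule fourier_coeff_shift)
    also have "2 * pi * (of_int (int n) + \<kappa>) * h = pi"
      using k by (simp add: h_def k_def[symmetric])
    finally have sh: "integral {0..1} (\<lambda>x. H (x + h) * ?e x) = - fourier_coeff H (int n)" by simp
    have i1: "(\<lambda>x. H (x + h) * ?e x) integrable_on {0..1}"
      by (intro integrable_continuous_interval continuous_intros continuous_on_shift)
    have i0: "(\<lambda>x. H x * ?e x) integrable_on {0..1}"
      by (intro integrable_continuous_interval continuous_intros continuous_on_subset[OF cont]) auto
    have "2 * fourier_coeff H (int n) = integral {0..1} (\<lambda>x. H x * ?e x - H (x + h) * ?e x)"
      unfolding integral_diff[OF i0 i1] sh by (simp add: fourier_coeff_def)
    moreover have "norm (integral {0..1} (\<lambda>x. H x * ?e x - H (x + h) * ?e x)) \<le> \<epsilon> * (1 - 0)"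
    proof (rule integral_bound)
      show "continuous_on {0..1} (\<lambda>x. H x * ?e x - H (x + h) * ?e x)"
        by (intro continuous_intros continuous_on_shift continuous_on_subset[OF cont]) auto
      show "norm (H x * ?e x - H (x + h) * ?e x) \<le> \<epsilon>" if "x \<in> {0..1}" for x
      proof -
        have "norm (H x * ?e x - H (x + h) * ?e x) = dist (H x) (H (x + h))"
          by (simp add: left_diff_distrib[symmetric] norm_mult dist_norm)
        also have "\<dots> < \<epsilon>" using that h by (intro d(2)) (auto simp: dist_real_def)
        finally show ?thesis by simp
      qed
    qed simp
    ultimately have "norm (2 * fourier_coeff H (int n)) \<le> \<epsilon>" by simp
    then show "norm (fourier_coeff H (int n) - 0) < \<epsilon>" using \<epsilon> by (simp add: norm_mult)
  qed
qed

lemma zero_if_fourier_coeff_zero: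
  assumes "\<And>k. fourier_coeff H k = 0"
  shows "H x = 0"
proof -
  have inner: "H y = 0" if y: "y \<in> {0<..<1}" for y
  proof -
    have "H y * cis (- 2 * pi * \<kappa> * y) = 0"
    proof (rule fourier_coefficients_zero[where f = "\<lambda>x. H x * cis (- 2 * pi * \<kappa> * x)"])
      show "continuous_on {0..1} (\<lambda>x. H x * cis (- 2 * pi * \<kappa> * x))"
        by (intro continuous_intros continuous_on_subset[OF cont]) auto
      show "integral {0..1} (\<lambda>x. H x * cis (- 2 * pi * \<kappa> * x) * cis (2 * pi * of_int k * x)) = 0" for k
        using assms[of "- k"] by (simp add: fourier_coeff_def mult.assoc cis_mult algebra_simps)
    qed (use y in auto)
    then show ?thesis by (metis cis_neq_zero mult_eq_0_iff)
  qed
  \<comment> \<open>The uniqueness lemma only reaches interior points; continuity covers the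
    endpoint and periodicity of the norm the rest of the line.\<close>
  have "H (frac x) = 0"
  proof (rule continuous_constant_on_closure[of "{0<..<1::real}" H])
    show "frac x \<in> closure {0<..<1}" by (simp add: frac_ge_0 less_imp_le[OF frac_lt_1])
  qed (use inner continuous_on_subset[OF cont] in auto)
  moreover have "norm (H (frac x + of_int \<lfloor>x\<rfloor>)) = norm (H (frac x))"
    by (rule periodic_norm_int) (simp add: per norm_mult)
  ultimately show ?thesis by (simp add: frac_def)
qed

text \<open>Duality exchanges the two terms: multiplication by the cosine becomes the neighbour
  term, and translation by \<alpha> in both directions becomes a cosine potential. Division by
  \<open>lam\<close> normalises the neighbour term.\<close>

lemma fourier_coeff_recurrence:
  assumes eq: "\<And>x. s * (H (x + \<alpha>) + H (x - \<alpha>)) + of_real (2 * lam * cos (2 * pi * x)) * H x = of_real E * H x"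
    and lam: "lam \<noteq> 0"
  shows "fourier_coeff H (k + 1) + fourier_coeff H (k - 1)
      + (2 * s * of_real (cos (2 * pi * (of_int k + \<kappa>) * \<alpha>)) - of_real E) / of_real lam * fourier_coeff H k = 0"
proof -
  define e where "e k x = cis (- 2 * pi * (of_int k + \<kappa>) * x)" for k :: int and x
  have i: "(\<lambda>x. H (x + \<beta>) * e k x) integrable_on {0..1}" for \<beta> k
    unfolding e_def by (intro integrable_continuous_interval continuous_intros continuous_on_shift)
  have sh: "integral {0..1} (\<lambda>x. H (x + \<beta>) * e k x) = cis (2 * pi * (of_int k + \<kappa>) * \<beta>) * fourier_coeff H k" for \<beta> k
    unfolding e_def by (rule fourier_coeff_shift)
  have shifts: "e (k - 1) x = e k x * cis (2 * pi * x)" "e (k + 1) x = e k x * cis (- 2 * pi * x)" for x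
    by (simp_all add: e_def cis_mult algebra_simps)
  have cos: "of_real lam * (cis (2 * pi * x) + cis (- 2 * pi * x)) = complex_of_real (2 * lam * cos (2 * pi * x))" for x
    by (simp add: complex_eq_iff)
  have "s * (H (x + \<alpha>) * e k x + H (x + - \<alpha>) * e k x)
      + (of_real lam * (H (x + 0) * e (k - 1) x + H (x + 0) * e (k + 1) x) - of_real E * (H (x + 0) * e k x))
    = (s * (H (x + \<alpha>) + H (x - \<alpha>)) + (of_real lam * (cis (2 * pi * x) + cis (- 2 * pi * x))) * H x - of_real E * H x) * e k x" for x
    unfolding shifts by (simp add: algebra_simps del: cis_mult)
  then have pt: "s * (H (x + \<alpha>) * e k x + H (x + - \<alpha>) * e k x)
      + (of_real lam * (H (x + 0) * e (k - 1) x + H (x + 0) * e (k + 1) x) - of_real E * (H (x + 0) * e k x)) = 0" for x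
    unfolding cos eq by simp
  have "s * (integral {0..1} (\<lambda>x. H (x + \<alpha>) * e k x) + integral {0..1} (\<lambda>x. H (x + - \<alpha>) * e k x))
      + (of_real lam * (integral {0..1} (\<lambda>x. H (x + 0) * e (k - 1) x) + integral {0..1} (\<lambda>x. H (x + 0) * e (k + 1) x))
        - of_real E * integral {0..1} (\<lambda>x. H (x + 0) * e k x))
    = integral {0..1} (\<lambda>x. s * (H (x + \<alpha>) * e k x + H (x + - \<alpha>) * e k x)
      + (of_real lam * (H (x + 0) * e (k - 1) x + H (x + 0) * e (k + 1) x) - of_real E * (H (x + 0) * e k x)))"
    by (simp only: i integral_add integral_diff integral_mult_right integrable_add integrable_diff integrable_on_mult_right)
  also have "\<dots> = 0" unfolding pt by simp
  finally have "s * (cis (2 * pi * (of_int k + \<kappa>) * \<alpha>) + cis (2 * pi * (of_int k + \<kappa>) * - \<alpha>)) * fourier_coeff H k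
      + (of_real lam * (fourier_coeff H (k - 1) + fourier_coeff H (k + 1)) - of_real E * fourier_coeff H k) = 0"
    unfolding sh by (simp add: algebra_simps)
  moreover have "cis (2 * pi * (of_int k + \<kappa>) * \<alpha>) + cis (2 * pi * (of_int k + \<kappa>) * - \<alpha>)
      = 2 * complex_of_real (cos (2 * pi * (of_int k + \<kappa>) * \<alpha>))"
    by (simp add: complex_eq_iff)
  ultimately have "of_real lam * (fourier_coeff H (k + 1) + fourier_coeff H (k - 1))
      + (2 * s * of_real (cos (2 * pi * (of_int k + \<kappa>) * \<alpha>)) - of_real E) * fourier_coeff H k = 0"
    by (simp only:) (simp add: algebra_simps)
  then show ?thesis using lam by (simp add: field_simps)
qed

end

end

text \<open>A vanishing Wronskian gives a nontrivial combination of the two coefficient sequences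
  that is zero at 0 and -1. The recurrence makes it zero everywhere, and uniqueness of Fourier
  coefficients carries this back to the functions.\<close>

lemma dual_solutions_dependent:
  fixes F G :: "real \<Rightarrow> complex"
  assumes lam: "lam \<noteq> 0"
    and F: "continuous_on UNIV F" "\<And>x. F (x + 1) = cis (2 * pi * \<kappa>) * F x"
      "\<And>x. s * (F (x + \<alpha>) + F (x - \<alpha>)) + of_real (2 * lam * cos (2 * pi * x)) * F x = of_real E * F x"
    and G: "continuous_on UNIV G" "\<And>x. G (x + 1) = cis (2 * pi * \<kappa>) * G x"
      "\<And>x. s * (G (x + \<alpha>) + G (x - \<alpha>)) + of_real (2 * lam * cos (2 * pi * x)) * G x = of_real E * G x"
  obtains a b where "a \<noteq> 0 \<or> b \<noteq> 0" "\<And>x. a * F x + b * G x = 0"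
proof -
  define V where "V k = (2 * s * of_real (cos (2 * pi * (of_int k + \<kappa>) * \<alpha>)) - of_real E) / of_real lam" for k :: int
  define f where "f = fourier_coeff \<kappa> F"
  define g where "g = fourier_coeff \<kappa> G"
  have f: "f (k + 1) + f (k - 1) + V k * f k = 0" for k
    unfolding f_def V_def by (rule fourier_coeff_recurrence[OF F lam])
  have g: "g (k + 1) + g (k - 1) + V k * g k = 0" for k
    unfolding g_def V_def by (rule fourier_coeff_recurrence[OF G lam])
  have lf: "(\<lambda>n. f (int n)) \<longlonglongrightarrow> 0" and lg: "(\<lambda>n. g (int n)) \<longlonglongrightarrow> 0"
    unfolding f_def g_def by (rule fourier_coeff_tendsto_0[OF F(1,2)] fourier_coeff_tendsto_0[OF G(1,2)])+
  have "(\<lambda>n. f (int (Suc n)) * g (int n) - f (int n) * g (int (Suc n))) \<longlonglongrightarrow> 0 * 0 - 0 * 0"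
    by (intro tendsto_diff tendsto_mult lf lg LIMSEQ_Suc[OF lf] LIMSEQ_Suc[OF lg])
  moreover have "f (int (Suc n)) * g (int n) - f (int n) * g (int (Suc n)) = f 0 * g (- 1) - f (- 1) * g 0" for n
    using wronskian_constant[of f V g "int n", OF f g] by (simp add: add.commute)
  ultimately have W: "f 0 * g (- 1) = f (- 1) * g 0"
    by (simp add: LIMSEQ_const_iff)
  have "\<exists>a b. (a \<noteq> 0 \<or> b \<noteq> 0) \<and> a * f 0 + b * g 0 = 0 \<and> a * f (- 1) + b * g (- 1) = 0"
  proof (cases "g 0 \<noteq> 0 \<or> f 0 \<noteq> 0")
    case True
    then show ?thesis using W by (intro exI[of _ "g 0"] exI[of _ "- f 0"]) (auto simp: mult.commute)
  next
    case False
    show ?thesis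
    proof (cases "g (- 1) \<noteq> 0 \<or> f (- 1) \<noteq> 0")
      case True
      then show ?thesis
        using False by (intro exI[of _ "g (- 1)"] exI[of _ "- f (- 1)"]) (auto simp: mult.commute)
    next
      case no: False
      then show ?thesis using False by (intro exI[of _ 1] exI[of _ 0]) auto
    qed
  qed
  then obtain a b where ab: "a \<noteq> 0 \<or> b \<noteq> 0" "a * f 0 + b * g 0 = 0" "a * f (- 1) + b * g (- 1) = 0"
    by blast
  have "a * f (k + 1) + b * g (k + 1) + (a * f (k - 1) + b * g (k - 1)) + V k * (a * f k + b * g k)
      = a * (f (k + 1) + f (k - 1) + V k * f k) + b * (g (k + 1) + g (k - 1) + V k * g k)" for k
    by (simp add: algebra_simps)
  then have "(\<lambda>k. a * f k + b * g k) = (\<lambda>_. 0)"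
    using ab by (intro recurrence_zero[where V = V]) (simp_all add: f g)
  then have fg: "a * f k + b * g k = 0" for k by (rule fun_cong)
  have "fourier_coeff \<kappa> (\<lambda>x. a * F x + b * G x) k = a * f k + b * g k" for k
  proof -
    have i: "(\<lambda>x. H x * cis (- 2 * pi * (of_int k + \<kappa>) * x)) integrable_on {0..1}"
      if "continuous_on UNIV H" for H
      by (intro integrable_continuous_interval continuous_intros continuous_on_subset[OF that]) auto
    have "fourier_coeff \<kappa> (\<lambda>x. a * F x + b * G x) k
        = integral {0..1} (\<lambda>x. a * (F x * cis (- 2 * pi * (of_int k + \<kappa>) * x)) + b * (G x * cis (- 2 * pi * (of_int k + \<kappa>) * x)))"
      by (simp add: fourier_coeff_def algebra_simps)
    also have "\<dots> = a * f k + b * g k"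
      unfolding f_def g_def fourier_coeff_def
      by (simp only: i[OF F(1)] i[OF G(1)] integral_add integral_mult_right integrable_on_mult_right)
    finally show ?thesis .
  qed
  then have "a * F x + b * G x = 0" for x
  proof (intro zero_if_fourier_coeff_zero[where H = "\<lambda>x. a * F x + b * G x" and \<kappa> = \<kappa>])
    show "continuous_on UNIV (\<lambda>x. a * F x + b * G x)"
      by (intro continuous_intros F(1) G(1))
    show "a * F (x + 1) + b * G (x + 1) = cis (2 * pi * \<kappa>) * (a * F x + b * G x)" for x
      by (simp add: F(2) G(2) distrib_left mult.left_commute)
  qed (simp add: fg)
  then show thesis using that ab(1) by blast
qed

section \<open>Rotation numbers\<close>

text \<open>Viewing columns as complex functions turns directions into arguments, for which the
  complex logarithm provides continuous lifts.\<close>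

definition vec_of_complex :: "complex \<Rightarrow> real^2" where
  "vec_of_complex z = vector [Re z, Im z]"

lemma vec_of_complex_nth [simp]:
  "vec_of_complex z $ 1 = Re z" "vec_of_complex z $ 2 = Im z"
  by (simp_all add: vec_of_complex_def)

lemma vec_of_complex_polar:
  "vec_of_complex (of_real r * cis (2 * pi * \<phi>)) = r *\<^sub>R direction \<phi>"
  by (simp add: vec_eq_iff forall_2 direction_def)

lemma direction_span_eq:
  assumes "span {direction a} = span {direction b}"
  obtains k :: int where "a - b = of_int k / 2"
proof -
  have "direction a \<in> span {direction b}"
    using assms by (metis insertI1 span_base)
  then obtain c where "direction a = c *\<^sub>R direction b"
    by (auto simp: span_singleton)
  then have "cos (2 * pi * a) = c * cos (2 * pi * b)" "sin (2 * pi * a) = c * sin (2 * pi * b)"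
    by (simp_all add: vec_eq_iff forall_2 direction_def)
  then have "sin (2 * pi * (a - b)) = 0"
    by (simp add: right_diff_distrib sin_diff)
  then obtain k :: int where "2 * pi * (a - b) = of_int k * pi"
    by (auto simp: sin_zero_iff_int2)
  then have "pi * (2 * (a - b)) = pi * of_int k" by (simp only: ac_simps)
  then have "2 * (a - b) = of_int k" by (simp only: mult_cancel_left) simp
  then have "a - b = of_int k / 2" by simp
  then show thesis by (rule that)
qed

lemma half_integer_valued_constant:
  fixes D :: "'a::real_normed_vector \<Rightarrow> real"
  assumes cont: "continuous_on UNIV D" and half: "\<And>x. \<exists>k::int. D x = of_int k / 2"
  obtains j :: int where "\<And>x. D x = of_int j / 2"
proof -
  have "D constant_on UNIV"
  proof (rule continuous_discrete_range_constant[OF _ cont])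
    show "\<exists>e>0. \<forall>y. y \<in> UNIV \<and> D y \<noteq> D x \<longrightarrow> e \<le> norm (D y - D x)" for x
    proof (intro exI[of _ "1 / 2"] conjI allI impI)
      fix y assume y: "y \<in> UNIV \<and> D y \<noteq> D x"
      obtain k l :: int where kl: "D x = of_int k / 2" "D y = of_int l / 2"
        using half by metis
      then have "1 \<le> \<bar>l - k\<bar>" using y by auto
      then have "1 \<le> \<bar>real_of_int l - real_of_int k\<bar>" by linarith
      then show "1 / 2 \<le> norm (D y - D x)" unfolding kl real_norm_def by linarith
    qed simp
  qed (rule connected_UNIV)
  then show thesis
    using half that unfolding constant_on_def by (metis UNIV_I)
qed

text \<open>In the coordinates given by the columns \<open>p\<close>, \<open>q\<close> the cocycle is the rotation by \<open>-\<tau>\<close>.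
  Writing \<open>p cos + q sin = P e\<^sup>i\<^sup>t + Q e\<^sup>-\<^sup>i\<^sup>t\<close> with \<open>\<bar>Q\<bar> < \<bar>P\<bar>\<close>, the argument of this vector is
  that of \<open>P\<close> plus \<open>t\<close> up to a bounded error, so the degree \<open>d\<close> of \<open>P\<close> contributes
  \<open>d \<alpha> / 2\<close> to the rotation number.\<close>

lemma rotation_number_elliptic:
  fixes p q :: "real \<Rightarrow> complex"
  assumes cont: "continuous_on UNIV p" "continuous_on UNIV q"
    and \<sigma>: "\<sigma> = 1 \<or> \<sigma> = - 1"
    and per: "\<And>x. p (x + 1) = \<sigma> * p x" "\<And>x. q (x + 1) = \<sigma> * q x"
    and orient: "\<And>x. 0 < Im (cnj (p x) * q x)"
    and A: "\<And>x. A x *v vec_of_complex (p x) = vec_of_complex (of_real (cos \<tau>) * p (x + \<alpha>) - of_real (sin \<tau>) * q (x + \<alpha>))"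
      "\<And>x. A x *v vec_of_complex (q x) = vec_of_complex (of_real (sin \<tau>) * p (x + \<alpha>) + of_real (cos \<tau>) * q (x + \<alpha>))"
    and \<rho>: "\<rho> \<in> rotation_number \<alpha> A"
  obtains d j :: int where "2 * \<rho> = of_int d * \<alpha> + of_int j - \<tau> / pi"
proof -
  define P Q where "P x = (p x - \<i> * q x) / 2" and "Q x = (p x + \<i> * q x) / 2" for x
  have PQ: "cmod (Q x) < cmod (P x)" for x
  proof -
    have "(cmod (P x))\<^sup>2 - (cmod (Q x))\<^sup>2 = Im (cnj (p x) * q x)"
      unfolding cmod_power2 P_def Q_def by (simp add: power2_eq_square field_simps)
    then have "(cmod (Q x))\<^sup>2 < (cmod (P x))\<^sup>2" using orient[of x] by simp
    then show ?thesis by (rule power_less_imp_less_base) simp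
  qed
  have P0: "P x \<noteq> 0" for x using PQ[of x] by auto
  have Pc: "continuous_on UNIV P" and Qc: "continuous_on UNIV Q"
    unfolding P_def[abs_def] Q_def[abs_def] by (intro continuous_intros cont; simp)+
  obtain L where Lc: "continuous_on UNIV L" and L: "\<And>x. P x = exp (L x)"
    using continuous_logarithm_on_contractible[of UNIV P] Pc P0 convex_imp_contractible[OF convex_UNIV]
    by auto
  \<comment> \<open>The vector \<open>z x t\<close> below is
    \<open>P x * cis (2 * pi * t) * w x t\<close>. Since \<open>w\<close> stays in the right
    half-plane, its principal logarithm is continuous and moves the angle by less than a quarter
    turn.\<close>
  define w where "w x t = 1 + Q x / P x * cis (- 4 * pi * t)" for x t
  have wpos: "0 < Re (w x t)" for x t
  proof -
    have "cmod (Q x / P x * cis (- 4 * pi * t)) < 1"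
      using PQ[of x] P0[of x] by (simp add: norm_mult norm_divide)
    then show ?thesis
      using abs_Re_le_cmod[of "Q x / P x * cis (- 4 * pi * t)"] unfolding w_def by simp
  qed
  define \<theta> where "\<theta> x = Im (L x) / (2 * pi)" for x
  \<comment> \<open>A continuous choice of the argument of \<open>z x t\<close>, measured in
    turns.\<close>
  define h where "h x t = t + \<theta> x + Im (Ln (w x t)) / (2 * pi)" for x t
  have h_near: "\<bar>h x t - (t + \<theta> x)\<bar> \<le> 1 / 4" for x t
  proof -
    have "\<bar>Im (Ln (w x t))\<bar> < pi / 2"
      using Re_Ln_pos_lt[of "w x t"] wpos[of x t] by (metis less_irrefl zero_complex.sel(1))
    then show ?thesis by (simp add: h_def abs_mult divide_simps)
  qed
  define z where "z x t = of_real (cos (2 * pi * t)) * p x + of_real (sin (2 * pi * t)) * q x" for x t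
  have z_polar: "\<exists>r>0. z x t = of_real r * cis (2 * pi * h x t)" for x t
  proof -
    have "z x t = P x * cis (2 * pi * t) + Q x * cis (- 2 * pi * t)"
      by (simp add: z_def P_def Q_def complex_eq_iff field_simps)
    also have "Q x * cis (- 2 * pi * t) = P x * cis (2 * pi * t) * (Q x / P x * cis (- 4 * pi * t))"
      using P0[of x] by (simp add: mult.left_commute cis_mult mult.assoc)
    also have "P x * cis (2 * pi * t) + P x * cis (2 * pi * t) * (Q x / P x * cis (- 4 * pi * t)) = P x * cis (2 * pi * t) * w x t"
      by (simp add: w_def algebra_simps)
    also have "\<dots> = exp (L x) * cis (2 * pi * t) * exp (Ln (w x t))"
      using wpos[of x t] by (subst exp_Ln) (auto simp: L)
    also have "\<dots> = of_real (exp (Re (L x)) * exp (Re (Ln (w x t)))) * cis (2 * pi * h x t)"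
      by (simp add: exp_eq_polar cis_mult h_def \<theta>_def algebra_simps)
    finally show ?thesis by (intro exI[of _ "exp (Re (L x)) * exp (Re (Ln (w x t)))"]) simp
  qed
  have hc: "continuous_on S (\<lambda>y. h (u y) (v y))" if "continuous_on S u" "continuous_on S v"
    for S :: "'b::topological_space set" and u v
  proof -
    have c: "continuous_on S (\<lambda>y. G (u y))" if "continuous_on UNIV G" for G :: "real \<Rightarrow> complex"
      using continuous_on_compose2[OF that \<open>continuous_on S u\<close>] by simp
    have "w (u y) (v y) \<notin> \<real>\<^sub>\<le>\<^sub>0" for y using wpos[of "u y" "v y"] by (auto simp: complex_nonpos_Reals_iff)
    then show ?thesis
      unfolding h_def \<theta>_def w_def using P0
      by (intro continuous_intros that c[OF Lc] c[OF Pc] c[OF Qc]) (auto simp: w_def)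
  qed
  have Az: "A x *v vec_of_complex (z x t) = vec_of_complex (z (x + \<alpha>) (t - \<tau> / (2 * pi)))" for x t
  proof -
    have lin: "vec_of_complex (of_real a * b + of_real c * e) = a *\<^sub>R vec_of_complex b + c *\<^sub>R vec_of_complex e" for a c b e
      by (simp add: vec_eq_iff forall_2)
    have angle: "2 * pi * (t - \<tau> / (2 * pi)) = 2 * pi * t - \<tau>" by (simp add: field_simps)
    have "A x *v vec_of_complex (z x t)
        = cos (2 * pi * t) *\<^sub>R vec_of_complex (of_real (cos \<tau>) * p (x + \<alpha>) - of_real (sin \<tau>) * q (x + \<alpha>))
          + sin (2 * pi * t) *\<^sub>R vec_of_complex (of_real (sin \<tau>) * p (x + \<alpha>) + of_real (cos \<tau>) * q (x + \<alpha>))"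
      unfolding z_def lin[of _ "p x" _ "q x"] by (simp add: matrix_vector_right_distrib matrix_vector_mult_scaleR A)
    also have "\<dots> = vec_of_complex (z (x + \<alpha>) (t - \<tau> / (2 * pi)))"
      unfolding z_def angle by (simp add: vec_eq_iff forall_2 cos_diff sin_diff algebra_simps)
    finally show ?thesis .
  qed
  obtain f x \<phi> and k :: int where lift: "is_projective_lift A f"
    and lim: "limsup (\<lambda>n. ereal ((snd ((lift_map \<alpha> f ^^ n) (x, \<phi>)) - \<phi>) / real n)) = ereal (\<rho> + of_int k / 2)"
    using \<rho> by (auto simp: rotation_number_def)
  have fc: "continuous_on UNIV f"
    and fspan: "\<And>x \<phi>. span {A x *v direction \<phi>} = span {direction (f (x, \<phi>))}"
    and fhalf: "\<And>x \<phi>. f (x, \<phi> + 1 / 2) = f (x, \<phi>) + 1 / 2"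
    using lift by (auto simp: is_projective_lift_def diff_eq_eq add.commute)
  have fhalfk: "f (x, \<phi> + of_int k / 2) = f (x, \<phi>) + of_int k / 2" for x \<phi> and k :: int
  proof (induction k rule: int_induct[where k = 0])
    case (step1 i)
    then show ?case using fhalf[of x "\<phi> + of_int i / 2"] by (simp add: add_divide_distrib add.assoc)
  next
    case (step2 i)
    then show ?case using fhalf[of x "\<phi> + of_int (i - 1) / 2"] by (simp add: diff_divide_distrib algebra_simps)
  qed simp
  \<comment> \<open>Both terms are continuous angles for the same line, so they differ by a
    half-integer, which by connectedness does not depend on \<open>x\<close> and
    \<open>t\<close>.\<close>
  have "\<exists>k::int. f (x, h x t) - h (x + \<alpha>) (t - \<tau> / (2 * pi)) = of_int k / 2" for x t
  proof -
    obtain r where r: "r > 0" "z x t = of_real r * cis (2 * pi * h x t)"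
      using z_polar by blast
    obtain r' where r': "r' > 0" "z (x + \<alpha>) (t - \<tau> / (2 * pi)) = of_real r' * cis (2 * pi * h (x + \<alpha>) (t - \<tau> / (2 * pi)))"
      using z_polar by blast
    have "r *\<^sub>R (A x *v direction (h x t)) = r' *\<^sub>R direction (h (x + \<alpha>) (t - \<tau> / (2 * pi)))"
      using Az[of x t] unfolding r(2) r'(2) vec_of_complex_polar by (simp add: matrix_vector_mult_scaleR)
    then have "(1 / r) *\<^sub>R (r *\<^sub>R (A x *v direction (h x t))) = (1 / r) *\<^sub>R (r' *\<^sub>R direction (h (x + \<alpha>) (t - \<tau> / (2 * pi))))"
      by (rule arg_cong)
    then have "A x *v direction (h x t) = (r' / r) *\<^sub>R direction (h (x + \<alpha>) (t - \<tau> / (2 * pi)))"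
      using r(1) by simp
    then have "span {A x *v direction (h x t)} = span {direction (h (x + \<alpha>) (t - \<tau> / (2 * pi)))}"
      using span_image_scale[of "{direction (h (x + \<alpha>) (t - \<tau> / (2 * pi)))}" "\<lambda>_. r' / r"] r r' by simp
    then show ?thesis using direction_span_eq fspan by metis
  qed
  then obtain j :: int where j: "\<And>y. f (fst y, h (fst y) (snd y)) - h (fst y + \<alpha>) (snd y - \<tau> / (2 * pi)) = of_int j / 2"
  proof (rule_tac half_integer_valued_constant[where D = "\<lambda>y. f (fst y, h (fst y) (snd y)) - h (fst y + \<alpha>) (snd y - \<tau> / (2 * pi))"])
    show "continuous_on UNIV (\<lambda>y. f (fst y, h (fst y) (snd y)) - h (fst y + \<alpha>) (snd y - \<tau> / (2 * pi)))"
      by (intro continuous_on_diff continuous_on_compose2[OF fc] hc continuous_intros) auto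
  qed auto
  have iter: "(lift_map \<alpha> f ^^ n) (x, h x t)
      = (x + real n * \<alpha>, h (x + real n * \<alpha>) (t - real n * \<tau> / (2 * pi)) + real n * of_int j / 2)" for n x t
  proof (induction n)
    case (Suc n)
    have e: "h (x + real n * \<alpha> + \<alpha>) (t - real n * \<tau> / (2 * pi) - \<tau> / (2 * pi)) = h (x + real (Suc n) * \<alpha>) (t - real (Suc n) * \<tau> / (2 * pi))"
      by (simp add: algebra_simps add_divide_distrib)
    have "f (x + real n * \<alpha>, h (x + real n * \<alpha>) (t - real n * \<tau> / (2 * pi)) + real n * of_int j / 2)
        = f (x + real n * \<alpha>, h (x + real n * \<alpha>) (t - real n * \<tau> / (2 * pi))) + real n * of_int j / 2"
      using fhalfk[of _ _ "int n * j"] by simp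
    also have "\<dots> = h (x + real n * \<alpha> + \<alpha>) (t - real n * \<tau> / (2 * pi) - \<tau> / (2 * pi)) + of_int j / 2 + real n * of_int j / 2"
      using j[of "(x + real n * \<alpha>, t - real n * \<tau> / (2 * pi))"] by (simp add: algebra_simps)
    finally show ?case
      using Suc unfolding e by (simp add: lift_map_def algebra_simps add_divide_distrib)
  qed simp
  have "\<exists>k::int. (\<theta> (y + 1) - \<theta> y) = of_int k / 2" for y
  proof -
    have "exp (L (y + 1)) = \<sigma> * exp (L y)"
      unfolding L[symmetric] P_def per by (simp add: right_diff_distrib mult.left_commute)
    then have "exp (L (y + 1) - L y) = \<sigma>" by (simp add: exp_diff)
    then have "exp (2 * (L (y + 1) - L y)) = 1"
      unfolding exp_double using \<sigma> by auto
    then obtain k :: int where "Im (2 * (L (y + 1) - L y)) = of_int (2 * k) * pi"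
      unfolding exp_eq_1 by blast
    then show ?thesis
      by (intro exI[of _ k]) (simp add: \<theta>_def field_simps)
  qed
  then obtain d :: int where d: "\<And>y. \<theta> (y + 1) - \<theta> y = of_int d / 2"
  proof (rule_tac half_integer_valued_constant[where D = "\<lambda>y. \<theta> (y + 1) - \<theta> y"])
    show "continuous_on UNIV (\<lambda>y. \<theta> (y + 1) - \<theta> y)"
      unfolding \<theta>_def by (intro continuous_intros continuous_on_compose2[OF Lc]) auto
  qed auto
  obtain M where M: "\<And>y. \<bar>\<theta> y - of_int d * y / 2\<bar> \<le> M"
  proof (rule periodic_continuous_bounded[of "\<lambda>y. \<theta> y - of_int d * y / 2"])
    show "continuous_on UNIV (\<lambda>y. \<theta> y - of_int d * y / 2)"
      unfolding \<theta>_def by (intro continuous_intros Lc) auto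
    show "norm (\<theta> (y + 1) - of_int d * (y + 1) / 2) = norm (\<theta> y - of_int d * y / 2)" for y
      using d[of y] by (intro arg_cong[of _ _ norm]) (simp add: field_simps)
  qed (use that in auto)
  \<comment> \<open>The given starting angle is realised as some \<open>h x t\<close>, so that
    \<open>iter\<close> describes exactly the orbit whose upper limit is known.\<close>
  obtain t where t: "h x t = \<phi>"
  proof -
    have "h x (\<phi> - \<theta> x - 1) \<le> \<phi>" "\<phi> \<le> h x (\<phi> - \<theta> x + 1)"
      using h_near[of x "\<phi> - \<theta> x - 1"] h_near[of x "\<phi> - \<theta> x + 1"] by linarith+
    then have "\<exists>t. \<phi> - \<theta> x - 1 \<le> t \<and> t \<le> \<phi> - \<theta> x + 1 \<and> h x t = \<phi>"
      by (intro IVT' hc continuous_intros) auto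
    then show thesis using that by blast
  qed
  define c where "c = of_int d * \<alpha> / 2 - \<tau> / (2 * pi) + of_int j / 2"
  have near: "\<bar>snd ((lift_map \<alpha> f ^^ n) (x, \<phi>)) - \<phi> - real n * c\<bar> \<le> 2 * M + 1 / 2" for n
  proof -
    have s: "snd ((lift_map \<alpha> f ^^ n) (x, \<phi>)) = h (x + real n * \<alpha>) (t - real n * \<tau> / (2 * pi)) + real n * of_int j / 2"
      using iter[of n x t] by (simp add: t)
    have "real n * c = (of_int d * (x + real n * \<alpha>) / 2 - of_int d * x / 2) + ((t - real n * \<tau> / (2 * pi)) - t) + real n * of_int j / 2"
      by (simp add: c_def field_simps)
    then show ?thesis
      using h_near[of "x + real n * \<alpha>" "t - real n * \<tau> / (2 * pi)"] h_near[of x t]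
        M[of "x + real n * \<alpha>"] M[of x]
      unfolding s t by linarith
  qed
  have "(\<lambda>n. (snd ((lift_map \<alpha> f ^^ n) (x, \<phi>)) - \<phi>) / real n) \<longlonglongrightarrow> c"
  proof (rule Lim_transform2)
    show "(\<lambda>n. c) \<longlonglongrightarrow> c" by simp
    show "(\<lambda>n. c - (snd ((lift_map \<alpha> f ^^ n) (x, \<phi>)) - \<phi>) / real n) \<longlonglongrightarrow> 0"
    proof (rule Lim_null_comparison)
      show "\<forall>\<^sub>F n in sequentially. norm (c - (snd ((lift_map \<alpha> f ^^ n) (x, \<phi>)) - \<phi>) / real n) \<le> (2 * M + 1 / 2) / real n"
        using eventually_gt_at_top[of 0]
      proof eventually_elim
        case (elim n)
        have "c - (snd ((lift_map \<alpha> f ^^ n) (x, \<phi>)) - \<phi>) / real n = - (snd ((lift_map \<alpha> f ^^ n) (x, \<phi>)) - \<phi> - real n * c) / real n"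
          using elim by (simp add: field_simps)
        then have "norm (c - (snd ((lift_map \<alpha> f ^^ n) (x, \<phi>)) - \<phi>) / real n) = \<bar>snd ((lift_map \<alpha> f ^^ n) (x, \<phi>)) - \<phi> - real n * c\<bar> / real n"
          by (simp only: real_norm_def abs_divide abs_minus_cancel abs_of_nat)
        then show ?case using near[of n] by (simp only:) (intro divide_right_mono; simp)
      qed
      show "(\<lambda>n. (2 * M + 1 / 2) / real n) \<longlonglongrightarrow> 0" by (rule lim_const_over_n)
    qed
  qed
  then have "(\<lambda>n. ereal ((snd ((lift_map \<alpha> f ^^ n) (x, \<phi>)) - \<phi>) / real n)) \<longlonglongrightarrow> ereal c" by simp
  from lim_imp_Limsup[OF _ this] lim have "\<rho> + of_int k / 2 = c" by simp
  then have "2 * \<rho> = of_int d * \<alpha> + of_int (j - k) - \<tau> / pi"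
    by (simp add: c_def field_simps)
  then show thesis by (rule that)
qed

section \<open>Reducible cocycles\<close>

lemma gap_endpoint_right:
  fixes S :: "real set"
  assumes "E \<in> S" "0 < \<epsilon>" and free: "\<And>x. E < x \<Longrightarrow> x < E + \<epsilon> \<Longrightarrow> x \<notin> S"
  shows "\<exists>G. is_gap S G \<and> is_endpoint E G"
proof -
  define G where "G = connected_component_set (UNIV - S) (E + \<epsilon> / 2)"
  have sub: "{E<..<E + \<epsilon>} \<subseteq> G"
    unfolding G_def using assms by (intro connected_component_maximal) auto
  have mem: "E + \<epsilon> / 2 \<in> G" using sub assms by auto
  have conn: "connected G" by (simp add: G_def connected_connected_component)
  have disj: "G \<subseteq> UNIV - S" unfolding G_def by (rule connected_component_subset)
  have lower: "E < y" if "y \<in> G" for y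
  proof (rule ccontr)
    assume "\<not> E < y"
    then have "E \<in> G" using connectedD_interval[OF conn that mem, of E] assms by simp
    then show False using disj assms by auto
  qed
  have "Inf G = E"
  proof (rule cInf_eq_non_empty)
    show "y \<le> E" if lb: "\<And>x. x \<in> G \<Longrightarrow> y \<le> x" for y
    proof (rule dense_ge_bounded[of E "E + \<epsilon>"])
      show "y \<le> w" if "E < w" "w < E + \<epsilon>" for w using lb sub that by auto
    qed (use assms in auto)
  qed (use mem lower in \<open>auto intro: less_imp_le\<close>)
  moreover have "is_gap S G"
    unfolding is_gap_def G_def using mem disj by (intro componentsI) auto
  moreover have "bdd_below G"
    by (rule bdd_belowI[of _ E]) (rule less_imp_le[OF lower])
  ultimately show ?thesis
    unfolding is_endpoint_def using mem by (intro exI[of _ G]) auto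
qed

lemma gap_endpoint_left:
  fixes S :: "real set"
  assumes "E \<in> S" "0 < \<epsilon>" and free: "\<And>x. E - \<epsilon> < x \<Longrightarrow> x < E \<Longrightarrow> x \<notin> S"
  shows "\<exists>G. is_gap S G \<and> is_endpoint E G"
proof -
  define G where "G = connected_component_set (UNIV - S) (E - \<epsilon> / 2)"
  have sub: "{E - \<epsilon><..<E} \<subseteq> G"
    unfolding G_def using assms by (intro connected_component_maximal) auto
  have mem: "E - \<epsilon> / 2 \<in> G" using sub assms by auto
  have conn: "connected G" by (simp add: G_def connected_connected_component)
  have disj: "G \<subseteq> UNIV - S" unfolding G_def by (rule connected_component_subset)
  have upper: "y < E" if "y \<in> G" for y
  proof (rule ccontr)
    assume "\<not> y < E"
    then have "E \<in> G" using connectedD_interval[OF conn mem that, of E] assms by simp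
    then show False using disj assms by auto
  qed
  have "Sup G = E"
  proof (rule cSup_eq_non_empty)
    show "E \<le> y" if ub: "\<And>x. x \<in> G \<Longrightarrow> x \<le> y" for y
    proof (rule dense_le_bounded[of "E - \<epsilon>" E])
      show "w \<le> y" if "E - \<epsilon> < w" "w < E" for w using ub sub that by auto
    qed (use assms in auto)
  qed (use mem upper in \<open>auto intro: less_imp_le\<close>)
  moreover have "is_gap S G"
    unfolding is_gap_def G_def using mem disj by (intro componentsI) auto
  moreover have "bdd_above G"
    by (rule bdd_aboveI[of _ E]) (rule less_imp_le[OF upper])
  ultimately show ?thesis
    unfolding is_endpoint_def using mem by (intro exI[of _ G]) auto
qed

text \<open>For a vector \<open>c\<close>, \<open>g c\<close> and \<open>g' c\<close> are the two entries of \<open>B x c\<close>.\<close>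

lemma reducible_solutions:
  assumes red: "analytically_reducible \<alpha> (schrodinger_matrix lam E) \<eta>" and \<eta>: "0 < \<eta>"
  obtains C :: "real^2^2" and \<sigma> :: real and g g' :: "real^2 \<Rightarrow> real \<Rightarrow> real" where
    "C $ 1 $ 1 * C $ 2 $ 2 - C $ 1 $ 2 * C $ 2 $ 1 = 1" "\<sigma> = 1 \<or> \<sigma> = - 1"
    "\<And>c. continuous_on UNIV (g c)" "\<And>c. continuous_on UNIV (g' c)"
    "\<And>c x. g c (x + 1) = \<sigma> * g c x" "\<And>c x. g' c (x + 1) = \<sigma> * g' c x"
    "\<And>a b c d x. g (a *\<^sub>R c + b *\<^sub>R d) x = a * g c x + b * g d x"
    "\<And>a b c d x. g' (a *\<^sub>R c + b *\<^sub>R d) x = a * g' c x + b * g' d x"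
    "\<And>c x. g (C *v c) (x + \<alpha>) = (E - 2 * lam * cos (2 * pi * x)) * g c x - g' c x"
    "\<And>c x. g' (C *v c) (x + \<alpha>) = g c x"
    "\<And>c d x. g c x * g' d x - g' c x * g d x = c $ 1 * d $ 2 - c $ 2 * d $ 1"
proof -
  let ?A = "schrodinger_matrix lam E"
  obtain B :: "real \<Rightarrow> real^2^2" and F :: "complex \<Rightarrow> complex^2^2" and C :: "real^2^2" where
    detB: "\<And>x. det (B x) = 1"
    and perB: "(\<forall>x. B (x + 1) = B x) \<or> (\<forall>x. B (x + 1) = - B x)"
    and anF: "\<And>i j. (\<lambda>z. F z $ i $ j) analytic_on {z. \<bar>Im z\<bar> < \<eta>}"
    and FB: "\<And>x i j. F (complex_of_real x) $ i $ j = complex_of_real (B x $ i $ j)"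
    and conj: "\<And>x. matrix_inv (B (x + \<alpha>)) ** ?A x ** B x = C"
    using red unfolding analytically_reducible_def by blast
  have Bc: "continuous_on UNIV (\<lambda>x. B x $ i $ j)" for i j
  proof -
    have "continuous_on {z. \<bar>Im z\<bar> < \<eta>} (\<lambda>z. F z $ i $ j)"
      by (intro holomorphic_on_imp_continuous_on analytic_imp_holomorphic anF)
    then have "continuous_on UNIV (\<lambda>x. F (complex_of_real x) $ i $ j)"
      by (rule continuous_on_compose2) (use \<eta> in \<open>auto intro: continuous_intros\<close>)
    then have "continuous_on UNIV (\<lambda>x. Re (F (complex_of_real x) $ i $ j))"
      by (rule continuous_on_Re)
    then show ?thesis by (simp add: FB)
  qed
  have BC: "B (x + \<alpha>) ** C = ?A x ** B x" for x
  proof -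
    have "invertible (B (x + \<alpha>))" using detB[of "x + \<alpha>"] by (simp add: invertible_det_nz)
    then have "B (x + \<alpha>) ** matrix_inv (B (x + \<alpha>)) = mat 1"
      unfolding invertible_def matrix_inv_def by (rule someI2_ex) (rule conjunct1)
    then show ?thesis
      unfolding conj[of x, symmetric] by (simp add: matrix_mul_assoc)
  qed
  have "det (?A 0) = 1" by (simp add: det_2 schrodinger_matrix_def)
  then have detC: "det C = 1"
    using arg_cong[OF BC[of 0], of det] detB by (simp add: det_mul)
  obtain \<sigma> where \<sigma>: "\<sigma> = 1 \<or> \<sigma> = - 1" "\<And>x. B (x + 1) = \<sigma> *\<^sub>R B x"
    using perB by (metis scaleR_minus1_left scaleR_one)
  define g where "g c x = (B x *v c) $ 1" for c x
  define g' where "g' c x = (B x *v c) $ 2" for c x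
  have BA: "B (x + \<alpha>) *v (C *v c) = ?A x *v (B x *v c)" for x c
    by (simp add: matrix_vector_mul_assoc BC)
  show thesis
  proof (rule that[of C \<sigma> g g'])
    show "C $ 1 $ 1 * C $ 2 $ 2 - C $ 1 $ 2 * C $ 2 $ 1 = 1" using detC by (simp add: det_2)
    show "\<sigma> = 1 \<or> \<sigma> = - 1" by (rule \<sigma>)
    show "continuous_on UNIV (g c)" "continuous_on UNIV (g' c)" for c
      unfolding g_def[abs_def] g'_def[abs_def] matrix_vector_mult_def by (auto simp: sum_2 intro!: continuous_intros Bc)
    show "g c (x + 1) = \<sigma> * g c x" "g' c (x + 1) = \<sigma> * g' c x" for c x
      by (simp_all add: g_def g'_def \<sigma>(2) matrix_vector_mult_def sum_2 distrib_left mult.assoc)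
    show "g (a *\<^sub>R c + b *\<^sub>R d) x = a * g c x + b * g d x"
      "g' (a *\<^sub>R c + b *\<^sub>R d) x = a * g' c x + b * g' d x" for a b c d x
      by (simp_all add: g_def g'_def matrix_vector_right_distrib matrix_vector_mult_scaleR)
    show "g (C *v c) (x + \<alpha>) = (E - 2 * lam * cos (2 * pi * x)) * g c x - g' c x"
      "g' (C *v c) (x + \<alpha>) = g c x" for c x
      unfolding g_def g'_def BA
      by (simp_all add: matrix_vector_mult_def[of "?A x"] sum_2) (simp_all add: schrodinger_matrix_def)
    show "g c x * g' d x - g' c x * g d x = c $ 1 * d $ 2 - c $ 2 * d $ 1" for c d x
    proof -
      have "g c x * g' d x - g' c x * g d x = det (B x) * (c $ 1 * d $ 2 - c $ 2 * d $ 1)"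
        by (simp add: g_def g'_def matrix_vector_mult_def sum_2 det_2 algebra_simps)
      then show ?thesis by (simp add: detB)
    qed
  qed
qed

text \<open>Here \<open>F'\<close> is \<open>s\<close> times the translate of \<open>F\<close> by
  -\<alpha>, so the system is the second-order functional equation and a dependence of
  \<open>F\<close> and \<open>G\<close> passes to \<open>F'\<close> and \<open>G'\<close>. The
  conclusion is a vanishing Wronskian, which will contradict \<open>det (B x) = 1\<close>.\<close>

lemma no_independent_dual_solutions:
  fixes F F' G G' :: "real \<Rightarrow> complex"
  assumes lam: "lam \<noteq> 0" and s: "s = 1 \<or> s = - 1" and \<sigma>: "\<sigma> = 1 \<or> \<sigma> = - 1"
    and F: "continuous_on UNIV F" "\<And>x. F (x + 1) = \<sigma> * F x"
      "\<And>x. s * F (x + \<alpha>) = of_real (E - 2 * lam * cos (2 * pi * x)) * F x - F' x" "\<And>x. s * F' (x + \<alpha>) = F x"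
    and G: "continuous_on UNIV G" "\<And>x. G (x + 1) = \<sigma> * G x"
      "\<And>x. s * G (x + \<alpha>) = of_real (E - 2 * lam * cos (2 * pi * x)) * G x - G' x" "\<And>x. s * G' (x + \<alpha>) = G x"
  shows "F x * G' x = F' x * G x"
proof -
  have ss: "s * s = 1" using s by auto
  have prev: "F' x = s * F (x - \<alpha>)" "G' x = s * G (x - \<alpha>)" for x
    using F(4)[of "x - \<alpha>", symmetric] G(4)[of "x - \<alpha>", symmetric] ss by (simp_all add: mult.assoc[symmetric])
  define \<kappa> :: real where "\<kappa> = (if \<sigma> = 1 then 0 else 1 / 2)"
  have \<kappa>: "cis (2 * pi * \<kappa>) = \<sigma>" using \<sigma> by (auto simp: \<kappa>_def)
  have eq: "s * (F (x + \<alpha>) + F (x - \<alpha>)) + of_real (2 * lam * cos (2 * pi * x)) * F x = of_real E * F x"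
    "s * (G (x + \<alpha>) + G (x - \<alpha>)) + of_real (2 * lam * cos (2 * pi * x)) * G x = of_real E * G x" for x
    unfolding distrib_left F(3) G(3) prev by (simp_all add: algebra_simps)
  obtain a b where ab: "a \<noteq> 0 \<or> b \<noteq> 0" "\<And>x. a * F x + b * G x = 0"
    by (rule dual_solutions_dependent[of lam F \<kappa> s \<alpha> E G])
      (use lam F(1,2) G(1,2) \<kappa> eq in auto)
  have "s * (a * F (x - \<alpha>) + b * G (x - \<alpha>)) = 0" by (simp add: ab(2))
  then have 2: "a * F' x + b * G' x = 0" unfolding prev by (simp add: algebra_simps)
  have "a * (F x * G' x - F' x * G x) = G' x * (a * F x + b * G x) - G x * (a * F' x + b * G' x)"
    "b * (F x * G' x - F' x * G x) = F x * (a * F' x + b * G' x) - F' x * (a * F x + b * G x)"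
    by (simp_all add: algebra_simps)
  then show ?thesis using ab 2 by auto
qed

text \<open>Along the orbit of \<theta>, \<open>\<mu> powi n\<close> times \<open>g\<close> decays
  on the left and \<open>(1 / \<mu>) powi n\<close> times \<open>h\<close> decays on the right.
  These Bloch waves supply the Green function.\<close>

lemma hyperbolic_not_in_spectrum:
  fixes g g' h h' :: "real \<Rightarrow> real"
  assumes \<mu>: "1 < \<bar>\<mu>\<bar>"
    and bounded: "\<And>x. \<bar>g x\<bar> \<le> M" "\<And>x. \<bar>h x\<bar> \<le> M"
    and g: "\<And>x. \<mu> * g (x + \<alpha>) = (E - 2 * lam * cos (2 * pi * x)) * g x - g' x" "\<And>x. \<mu> * g' (x + \<alpha>) = g x"
    and h: "\<And>x. h (x + \<alpha>) / \<mu> = (E - 2 * lam * cos (2 * pi * x)) * h x - h' x" "\<And>x. h' (x + \<alpha>) / \<mu> = h x"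
    and W: "\<And>x. g x * h' x - g' x * h x \<noteq> 0"
  shows "E \<notin> amo_spectrum lam \<alpha> \<theta>"
proof -
  have \<mu>0: "\<mu> \<noteq> 0" using \<mu> by auto
  define u where "u k f n = k powi n * f (\<theta> + of_int n * \<alpha>)" for k :: real and f :: "real \<Rightarrow> real" and n :: int
  have fwd: "u k f (n + 1) = k powi n * (k * f (\<theta> + of_int n * \<alpha> + \<alpha>))" if "k \<noteq> 0" for k f n
    using that by (simp add: u_def power_int_add algebra_simps)
  have prev: "u k f (n - 1) = k powi n * f' (\<theta> + of_int n * \<alpha>)"
    if "k \<noteq> 0" "\<And>x. k * f' (x + \<alpha>) = f x" for k f f' n
  proof -
    have "u k f (n - 1) = k powi (n - 1) * (k * f' (\<theta> + of_int (n - 1) * \<alpha> + \<alpha>))"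
      by (simp add: u_def that(2))
    also have "\<dots> = k powi (n - 1 + 1) * f' (\<theta> + of_int n * \<alpha>)"
      using that(1) by (subst power_int_add) (simp_all add: algebra_simps)
    finally show ?thesis by simp
  qed
  have eq: "u k f (n + 1) + u k f (n - 1) + (2 * lam * cos (2 * pi * (\<theta> + of_int n * \<alpha>)) - E) * u k f n = 0"
    if k: "k \<noteq> 0" and f: "\<And>x. k * f (x + \<alpha>) = (E - 2 * lam * cos (2 * pi * x)) * f x - f' x" "\<And>x. k * f' (x + \<alpha>) = f x"
    for k f f' n
    unfolding fwd[OF k] prev[where f = f and f' = f', OF k f(2)] f(1)
    by (simp add: u_def algebra_simps)
  have h2: "(1 / \<mu>) * h (x + \<alpha>) = (E - 2 * lam * cos (2 * pi * x)) * h x - h' x" "(1 / \<mu>) * h' (x + \<alpha>) = h x" for x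
    using h[of x] by simp_all
  have \<mu>1: "1 / \<mu> \<noteq> 0" using \<mu>0 by simp
  show ?thesis
  proof (rule not_in_amo_spectrum[where u = "u \<mu> g" and v = "u (1 / \<mu>) h" and r = "1 / \<bar>\<mu>\<bar>" and K = "M * M"])
    show "u \<mu> g 0 * u (1 / \<mu>) h (- 1) - u \<mu> g (- 1) * u (1 / \<mu>) h 0 \<noteq> 0"
      using W[of \<theta>] prev[where f = g and f' = g' and n = 0, OF \<mu>0 g(2)]
        prev[where f = h and f' = h' and n = 0, OF \<mu>1 h2(2)] by (simp add: u_def)
    show "\<bar>u \<mu> g m * u (1 / \<mu>) h n\<bar> \<le> M * M * (1 / \<bar>\<mu>\<bar>) ^ nat (n - m)" if "m \<le> n" for m n
    proof -
      have "\<bar>\<mu>\<bar> powi m * (1 / \<bar>\<mu>\<bar>) powi n = (1 / \<bar>\<mu>\<bar>) powi (n - m)"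
        using \<mu>0 by (simp add: power_int_diff power_int_divide_distrib)
      also have "\<dots> = (1 / \<bar>\<mu>\<bar>) ^ nat (n - m)"
        using that by (simp add: power_int_def)
      finally have "\<bar>u \<mu> g m * u (1 / \<mu>) h n\<bar> = (1 / \<bar>\<mu>\<bar>) ^ nat (n - m) * (\<bar>g (\<theta> + of_int m * \<alpha>)\<bar> * \<bar>h (\<theta> + of_int n * \<alpha>)\<bar>)"
        by (simp add: u_def abs_mult power_int_abs abs_divide mult.assoc mult.left_commute)
      also have "\<dots> \<le> (1 / \<bar>\<mu>\<bar>) ^ nat (n - m) * (M * M)"
        using bounded by (intro mult_left_mono mult_mono') auto
      finally show ?thesis by (simp add: mult.commute)
    qed
  qed (use eq[where f = g and f' = g', OF \<mu>0 g] eq[where f = h and f' = h', OF \<mu>1 h2] \<mu> in auto)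
qed

section \<open>Eigenvectors and parallel vectors in the plane\<close>

lemma eigenvector_2x2:
  fixes C :: "real^2^2"
  assumes det: "C $ 1 $ 1 * C $ 2 $ 2 - C $ 1 $ 2 * C $ 2 $ 1 = 1"
    and \<mu>: "\<mu> * \<mu> = (C $ 1 $ 1 + C $ 2 $ 2) * \<mu> - 1"
  obtains c where "c \<noteq> 0" "C *v c = \<mu> *\<^sub>R c"
proof -
  have char: "(\<mu> - C $ 1 $ 1) * (\<mu> - C $ 2 $ 2) = C $ 1 $ 2 * C $ 2 $ 1"
    using det \<mu> by (simp add: algebra_simps)
  consider "C $ 1 $ 2 \<noteq> 0" | "C $ 2 $ 1 \<noteq> 0" | "C $ 1 $ 2 = 0" "C $ 2 $ 1 = 0" "\<mu> = C $ 1 $ 1"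
    | "C $ 1 $ 2 = 0" "C $ 2 $ 1 = 0" "\<mu> = C $ 2 $ 2"
    using char by fastforce
  then show thesis
  proof cases
    case 1
    then show thesis using char
      by (intro that[of "vector [C $ 1 $ 2, \<mu> - C $ 1 $ 1]"])
        (auto simp: vec_eq_iff forall_2 matrix_vector_mult_def sum_2 algebra_simps)
  next
    case 2
    then show thesis using char
      by (intro that[of "vector [\<mu> - C $ 2 $ 2, C $ 2 $ 1]"])
        (auto simp: vec_eq_iff forall_2 matrix_vector_mult_def sum_2 algebra_simps)
  next
    case 3
    then show thesis
      by (intro that[of "vector [1, 0]"]) (auto simp: vec_eq_iff forall_2 matrix_vector_mult_def sum_2)
  next
    case 4
    then show thesis
      by (intro that[of "vector [0, 1]"]) (auto simp: vec_eq_iff forall_2 matrix_vector_mult_def sum_2)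
  qed
qed

lemma cis_pi_int: "cis (pi * of_int N) = 1 \<or> cis (pi * of_int N) = - 1"
  by (cases "even N")
    (auto simp: complex_eq_iff cos_int_times_real sin_int_times_real mult.commute elim!: evenE oddE)

lemma parallel_2:
  fixes c d :: "real^2"
  assumes "c \<noteq> 0" "c $ 1 * d $ 2 - c $ 2 * d $ 1 = 0"
  obtains k where "d = k *\<^sub>R c"
proof (cases "c $ 1 = 0")
  case True
  then have "c $ 2 \<noteq> 0" using assms(1) by (auto simp: vec_eq_iff forall_2)
  then show thesis
    using assms(2) True by (intro that[of "d $ 2 / c $ 2"]) (auto simp: vec_eq_iff forall_2)
next
  case False
  then show thesis
    using assms(2) by (intro that[of "d $ 1 / c $ 1"]) (auto simp: vec_eq_iff forall_2 field_simps)
qed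

theorem theorem6p1:
  fixes \<alpha> lam \<theta> \<eta> E\<^sub>0 :: real
  assumes "\<alpha> \<notin> \<rat>"
    and "0 \<le> cf_beta \<alpha>" and "cf_beta \<alpha> < \<infinity>"
    and "lam \<noteq> 0"
    and "E\<^sub>0 \<in> amo_spectrum lam \<alpha> \<theta>"
    and "\<exists>\<rho>\<in>rotation_number \<alpha> (schrodinger_matrix lam E\<^sub>0).
           \<exists>k m :: int. 2 * \<rho> = of_int k * \<alpha> + of_int m"
    and "ereal \<eta> > 6 * cf_beta \<alpha>"
    and "analytically_reducible \<alpha> (schrodinger_matrix lam E\<^sub>0) \<eta>"
  shows "\<exists>G. is_gap (amo_spectrum lam \<alpha> \<theta>) G \<and> is_endpoint E\<^sub>0 G"
proof -
  note \<alpha> = assms(1) and lam = assms(4) and spec = assms(5)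
  have "0 < \<eta>"
  proof -
    have "(0::ereal) \<le> 6 * cf_beta \<alpha>" using assms(2) by simp
    then have "(0::ereal) < ereal \<eta>" using assms(7) by (rule le_less_trans)
    then show ?thesis by simp
  qed
  then obtain C :: "real^2^2" and \<sigma> :: real and g g' :: "real^2 \<Rightarrow> real \<Rightarrow> real" where
    det: "C $ 1 $ 1 * C $ 2 $ 2 - C $ 1 $ 2 * C $ 2 $ 1 = 1" and \<sigma>: "\<sigma> = 1 \<or> \<sigma> = - 1"
    and cont: "\<And>c. continuous_on UNIV (g c)" "\<And>c. continuous_on UNIV (g' c)"
    and per: "\<And>c x. g c (x + 1) = \<sigma> * g c x" "\<And>c x. g' c (x + 1) = \<sigma> * g' c x"
    and lin: "\<And>a b c d x. g (a *\<^sub>R c + b *\<^sub>R d) x = a * g c x + b * g d x"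
      "\<And>a b c d x. g' (a *\<^sub>R c + b *\<^sub>R d) x = a * g' c x + b * g' d x"
    and sol: "\<And>c x. g (C *v c) (x + \<alpha>) = (E\<^sub>0 - 2 * lam * cos (2 * pi * x)) * g c x - g' c x"
      "\<And>c x. g' (C *v c) (x + \<alpha>) = g c x"
    and W: "\<And>c d x. g c x * g' d x - g' c x * g d x = c $ 1 * d $ 2 - c $ 2 * d $ 1"
    by (rule reducible_solutions[OF assms(8)]) blast
  have scale: "g (a *\<^sub>R c) x = a * g c x" "g' (a *\<^sub>R c) x = a * g' c x" for a c x
    using lin[of a c 0 0 x] by simp_all
  have bounded: "\<exists>M. \<forall>x. \<bar>g c x\<bar> \<le> M" for c
  proof -
    have "\<bar>g c (x + 1)\<bar> = \<bar>g c x\<bar>" for x using \<sigma> by (auto simp: per)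
    then show ?thesis using periodic_continuous_bounded[of "g c"] cont by (metis real_norm_def)
  qed
  define T where "T = C $ 1 $ 1 + C $ 2 $ 2"
  have C1: "(C *v c) $ 1 = C $ 1 $ 1 * c $ 1 + C $ 1 $ 2 * c $ 2"
    and C2: "(C *v c) $ 2 = C $ 2 $ 1 * c $ 1 + C $ 2 $ 2 * c $ 2" for c
    by (simp_all add: matrix_vector_mult_def sum_2)
  consider "2 < \<bar>T\<bar>" | "\<bar>T\<bar> < 2" | "\<bar>T\<bar> = 2" by linarith
  then show ?thesis
  proof cases
    case 1
    have "E\<^sub>0 \<notin> amo_spectrum lam \<alpha> \<theta>"
    proof -
      define D where "D = sqrt (T\<^sup>2 - 4)"
      \<comment> \<open>The sign of \<open>T\<close> selects the eigenvalue of larger modulus; the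
        other one is its inverse.\<close>
      define \<mu> where "\<mu> = (T + sgn T * D) / 2"
      have "2\<^sup>2 < \<bar>T\<bar>\<^sup>2" using 1 by (intro power_strict_mono) auto
      then have T2: "4 < T\<^sup>2" by simp
      then have D: "D\<^sup>2 = T\<^sup>2 - 4" "0 < D" by (simp_all add: D_def)
      have s: "sgn T * sgn T = 1" "\<bar>T\<bar> = sgn T * T" using 1 by (auto simp: sgn_if)
      have abs\<mu>: "\<bar>\<mu>\<bar> = (\<bar>T\<bar> + D) / 2"
        using D(2) 1 by (auto simp: \<mu>_def sgn_if abs_if field_simps)
      then have \<mu>: "1 < \<bar>\<mu>\<bar>" using 1 D by simp
      then have \<mu>0: "\<mu> \<noteq> 0" by auto
      have "\<mu> * \<mu> = (T\<^sup>2 + 2 * (sgn T * T * D) + (sgn T * sgn T) * D\<^sup>2) / 4"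
        by (simp add: \<mu>_def power2_eq_square field_simps)
      also have "\<dots> = T * \<mu> - 1"
        unfolding s(1) D(1) by (simp add: \<mu>_def power2_eq_square field_simps)
      finally have char: "\<mu> * \<mu> = T * \<mu> - 1" .
      have char': "1 / \<mu> * (1 / \<mu>) = T * (1 / \<mu>) - 1"
        using \<mu>0 char by (simp add: field_simps)
      obtain c where c: "c \<noteq> 0" "C *v c = \<mu> *\<^sub>R c"
        using eigenvector_2x2[OF det] char by (auto simp: T_def)
      obtain d where d: "d \<noteq> 0" "C *v d = (1 / \<mu>) *\<^sub>R d"
        using eigenvector_2x2[OF det] char' unfolding T_def by metis
      have W0: "c $ 1 * d $ 2 - c $ 2 * d $ 1 \<noteq> 0"
      proof
        assume "c $ 1 * d $ 2 - c $ 2 * d $ 1 = 0"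
        then obtain k where k: "d = k *\<^sub>R c" using parallel_2[OF c(1)] by blast
        have "C *v d = \<mu> *\<^sub>R d" unfolding k by (simp add: matrix_vector_mult_scaleR c(2))
        then have "(\<mu> - 1 / \<mu>) *\<^sub>R d = 0" using d(2) by (metis cancel_comm_monoid_add_class.diff_cancel scaleR_left_diff_distrib)
        then have "\<mu> * \<mu> = 1" using d(1) \<mu>0 by (simp add: field_simps)
        then have "\<bar>\<mu>\<bar> * \<bar>\<mu>\<bar> = 1" by (simp add: abs_mult[symmetric])
        moreover have "1 * 1 < \<bar>\<mu>\<bar> * \<bar>\<mu>\<bar>" using \<mu> by (intro mult_strict_mono) auto
        ultimately show False by simp
      qed
      obtain M M' where M: "\<And>x. \<bar>g c x\<bar> \<le> M" "\<And>x. \<bar>g d x\<bar> \<le> M'"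
        using bounded by metis
      show ?thesis
      proof (rule hyperbolic_not_in_spectrum[where g = "g c" and g' = "g' c" and h = "g d" and h' = "g' d"
            and M = "max M M'", OF \<mu>])
        show "\<bar>g c x\<bar> \<le> max M M'" "\<bar>g d x\<bar> \<le> max M M'" for x
          using M[of x] by auto
        show "\<mu> * g c (x + \<alpha>) = (E\<^sub>0 - 2 * lam * cos (2 * pi * x)) * g c x - g' c x" "\<mu> * g' c (x + \<alpha>) = g c x" for x
          using sol[of c x] by (simp_all add: c(2) scale)
        show "g d (x + \<alpha>) / \<mu> = (E\<^sub>0 - 2 * lam * cos (2 * pi * x)) * g d x - g' d x" "g' d (x + \<alpha>) / \<mu> = g d x" for x
          using sol[of d x] by (simp_all add: d(2) scale)
        show "g c x * g' d x - g' c x * g d x \<noteq> 0" for x using W W0 by simp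
      qed
    qed
    then show ?thesis using spec by simp
  next
    case 2
    \<comment> \<open>\<open>a\<close> and \<open>b\<close> are, up to orientation, the real and imaginary parts of an eigenvector; multiplying
      the Bloch wave \<open>g a + i g b\<close> by \<open>e\<^sup>i\<^sup>\<pi>\<^sup>K\<^sup>x\<close> changes its multiplier from \<open>e\<^sup>i\<^sup>\<tau>\<close> to \<open>\<plusminus>1\<close>\<close>
    have False
    proof -
      have "\<bar>T\<bar>\<^sup>2 < 2\<^sup>2" using 2 by (intro power_strict_mono) auto
      then have T4: "T\<^sup>2 < 4" by simp
      have C21: "C $ 2 $ 1 \<noteq> 0"
      proof
        assume "C $ 2 $ 1 = 0"
        then have "C $ 1 $ 1 * C $ 2 $ 2 = 1" using det by simp
        then have "0 \<le> T\<^sup>2 - 4"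
          using zero_le_power2[of "C $ 1 $ 1 - C $ 2 $ 2"]
          by (simp add: T_def power2_eq_square algebra_simps)
        then show False using T4 by simp
      qed
      \<comment> \<open>The sign is opposite to that of \<open>C $ 2 $ 1\<close>, which makes
        \<open>b $ 2\<close> positive below. This is the orientation that
        \<open>rotation_number_elliptic\<close> requires.\<close>
      define S where "S = - sgn (C $ 2 $ 1) * sqrt (1 - (T / 2)\<^sup>2)"
      have "S\<^sup>2 = 1 - (T / 2)\<^sup>2"
        using C21 T4 by (simp add: S_def power_mult_distrib sgn_if power_divide)
      then have "(T / 2)\<^sup>2 + S\<^sup>2 = 1" by simp
      then obtain \<tau> where \<tau>: "T / 2 = cos \<tau>" "S = sin \<tau>" using sincos_total_2pi by metis
      have S: "C $ 2 $ 1 * S < 0"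
        using C21 T4 by (simp add: S_def power_divide mult_less_0_iff sgn_if)
      then have S0: "sin \<tau> \<noteq> 0" using \<tau> by auto
      define a :: "real^2" where "a = vector [1, 0]"
      \<comment> \<open>Obtained by solving \<open>C a = cos \<tau> a - sin \<tau> b\<close> for
        \<open>b\<close>. Trace and determinant then force \<open>Cb\<close>, so \<open>C\<close> is
        the rotation by -\<tau> in the basis \<open>a\<close>, \<open>b\<close>.\<close>
      define b where "b = (1 / sin \<tau>) *\<^sub>R (cos \<tau> *\<^sub>R a - C *v a)"
      have Ca: "C *v a = cos \<tau> *\<^sub>R a + (- sin \<tau>) *\<^sub>R b"
        using S0 by (simp add: b_def)
      have T': "C $ 1 $ 1 + C $ 2 $ 2 = 2 * cos \<tau>" using \<tau>(1) by (simp add: T_def)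
      have b1: "sin \<tau> * b $ 1 = cos \<tau> - C $ 1 $ 1" and b2: "sin \<tau> * b $ 2 = - C $ 2 $ 1"
        using S0 by (simp_all add: b_def a_def C1 C2)
      have "sin \<tau> *\<^sub>R (C *v b) = sin \<tau> *\<^sub>R (sin \<tau> *\<^sub>R a + cos \<tau> *\<^sub>R b)"
      proof -
        have CC: "C $ 1 $ 1 = 2 * cos \<tau> - C $ 2 $ 2" using T' by simp
        have sc: "sin \<tau> * sin \<tau> = 1 - cos \<tau> * cos \<tau>"
          using sin_cos_squared_add[of \<tau>] by (simp add: power2_eq_square)
        have "C $ 1 $ 1 * (sin \<tau> * b $ 1) + C $ 1 $ 2 * (sin \<tau> * b $ 2) = sin \<tau> * sin \<tau> + cos \<tau> * (sin \<tau> * b $ 1)"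
          unfolding b1 b2 sc using det unfolding CC by (simp add: algebra_simps)
        moreover have "C $ 2 $ 1 * (sin \<tau> * b $ 1) + C $ 2 $ 2 * (sin \<tau> * b $ 2) = cos \<tau> * (sin \<tau> * b $ 2)"
          unfolding b1 b2 CC by (simp add: algebra_simps)
        ultimately show ?thesis
          by (simp add: vec_eq_iff forall_2 C1 C2 a_def algebra_simps)
      qed
      then have Cb: "C *v b = sin \<tau> *\<^sub>R a + cos \<tau> *\<^sub>R b" using S0 by simp
      have "sin \<tau> * sin \<tau> * b $ 2 > 0"
        using b2 S \<tau>(2) by (simp add: mult.assoc) (simp add: mult.commute)
      then have b2pos: "0 < b $ 2" using S0 by (simp add: zero_less_mult_iff not_square_less_zero)
      have ab: "a $ 1 * b $ 2 - a $ 2 * b $ 1 = b $ 2" by (simp add: a_def)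
      obtain \<rho> and k m :: int where \<rho>: "\<rho> \<in> rotation_number \<alpha> (schrodinger_matrix lam E\<^sub>0)"
        "2 * \<rho> = of_int k * \<alpha> + of_int m"
        using assms(6) by blast
      define p where "p x = Complex (g a x) (g' a x)" for x
      define q where "q x = Complex (g b x) (g' b x)" for x
      have Avec: "schrodinger_matrix lam E\<^sub>0 x *v vec_of_complex (Complex (g c x) (g' c x))
          = vec_of_complex (Complex (g (C *v c) (x + \<alpha>)) (g' (C *v c) (x + \<alpha>)))" for c x
        by (simp add: vec_eq_iff forall_2 matrix_vector_mult_def[of "schrodinger_matrix lam E\<^sub>0 x"] sum_2 sol)
          (simp add: schrodinger_matrix_def)
      obtain d j :: int where dj: "2 * \<rho> = of_int d * \<alpha> + of_int j - \<tau> / pi"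
      proof (rule rotation_number_elliptic[of p q \<sigma> "schrodinger_matrix lam E\<^sub>0" \<tau> \<alpha> \<rho>])
        show "continuous_on UNIV p" "continuous_on UNIV q"
          unfolding p_def[abs_def] q_def[abs_def] Complex_eq by (intro continuous_intros cont)+
        show "p (x + 1) = complex_of_real \<sigma> * p x" "q (x + 1) = complex_of_real \<sigma> * q x" for x
          by (simp_all add: p_def q_def per complex_eq_iff)
        show "0 < Im (cnj (p x) * q x)" for x
          using W[of a x b] b2pos by (simp add: p_def q_def ab)
        show "schrodinger_matrix lam E\<^sub>0 x *v vec_of_complex (p x)
            = vec_of_complex (of_real (cos \<tau>) * p (x + \<alpha>) - of_real (sin \<tau>) * q (x + \<alpha>))" for x
          unfolding p_def Avec Ca lin
          by (rule arg_cong[of _ _ vec_of_complex]) (simp add: q_def complex_eq_iff)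
        show "schrodinger_matrix lam E\<^sub>0 x *v vec_of_complex (q x)
            = vec_of_complex (of_real (sin \<tau>) * p (x + \<alpha>) + of_real (cos \<tau>) * q (x + \<alpha>))" for x
          unfolding q_def Avec Cb lin
          by (rule arg_cong[of _ _ vec_of_complex]) (simp add: p_def complex_eq_iff)
      qed (use \<sigma> \<rho> in auto)
      \<comment> \<open>Equating the two expressions for \<open>2 * \<rho>\<close> puts \<tau> /
        \<pi> into \<alpha> \<int> + \<int>.\<close>
      define K N where "K = d - k" and "N = j - m"
      have \<tau>K: "\<tau> = pi * of_int N + pi * of_int K * \<alpha>"
      proof -
        have "\<tau> / pi = of_int N + of_int K * \<alpha>" using dj \<rho>(2) by (simp add: K_def N_def algebra_simps)
        then show ?thesis by (simp add: field_simps)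
      qed
      define \<Phi> where "\<Phi> x = (g a x + \<i> * g b x) * cis (pi * of_int K * x)" for x
      define \<Phi>' where "\<Phi>' x = (g' a x + \<i> * g' b x) * cis (pi * of_int K * x)" for x
      define s :: complex where "s = cis (pi * of_int N)"
      have s: "s = 1 \<or> s = - 1" unfolding s_def by (rule cis_pi_int)
      \<comment> \<open>For odd \<open>K\<close> the added exponential changes sign over a period,
        so the period sign has to be recomputed.\<close>
      define \<sigma>' :: complex where "\<sigma>' = of_real \<sigma> * cis (pi * of_int K)"
      have \<sigma>': "\<sigma>' = 1 \<or> \<sigma>' = - 1"
        using \<sigma> cis_pi_int[of K] by (auto simp: \<sigma>'_def)
      have cis\<tau>: "s * cis (pi * of_int K * (x + \<alpha>)) = cis \<tau> * cis (pi * of_int K * x)" for x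
        by (simp add: s_def cis_mult \<tau>K algebra_simps)
      have rot: "cis \<tau> * (g a (x + \<alpha>) + \<i> * g b (x + \<alpha>)) = g (C *v a) (x + \<alpha>) + \<i> * g (C *v b) (x + \<alpha>)"
        "cis \<tau> * (g' a (x + \<alpha>) + \<i> * g' b (x + \<alpha>)) = g' (C *v a) (x + \<alpha>) + \<i> * g' (C *v b) (x + \<alpha>)" for x
        unfolding Ca Cb lin by (simp_all add: complex_eq_iff algebra_simps)
      have \<Phi>: "s * \<Phi> (x + \<alpha>) = of_real (E\<^sub>0 - 2 * lam * cos (2 * pi * x)) * \<Phi> x - \<Phi>' x"
        "s * \<Phi>' (x + \<alpha>) = \<Phi> x" for x
      proof -
        have "s * \<Phi> (x + \<alpha>) = (cis \<tau> * (g a (x + \<alpha>) + \<i> * g b (x + \<alpha>))) * cis (pi * of_int K * x)"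
          unfolding \<Phi>_def using cis\<tau>[of x] by (simp add: mult.left_commute mult.assoc)
        then show "s * \<Phi> (x + \<alpha>) = of_real (E\<^sub>0 - 2 * lam * cos (2 * pi * x)) * \<Phi> x - \<Phi>' x"
          unfolding rot sol by (simp add: \<Phi>_def \<Phi>'_def algebra_simps)
        have "s * \<Phi>' (x + \<alpha>) = (cis \<tau> * (g' a (x + \<alpha>) + \<i> * g' b (x + \<alpha>))) * cis (pi * of_int K * x)"
          unfolding \<Phi>'_def using cis\<tau>[of x] by (simp add: mult.left_commute mult.assoc)
        then show "s * \<Phi>' (x + \<alpha>) = \<Phi> x"
          unfolding rot sol by (simp add: \<Phi>_def)
      qed
      have per\<Phi>: "\<Phi> (x + 1) = \<sigma>' * \<Phi> x" for x
      proof -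
        have "cis (pi * of_int K * (x + 1)) = cis (pi * of_int K * x) * cis (pi * of_int K)"
          by (simp add: cis_mult algebra_simps)
        then show ?thesis unfolding \<Phi>_def \<sigma>'_def per by (simp add: algebra_simps)
      qed
      have cnj_s: "cnj s = s" "cnj \<sigma>' = \<sigma>'" using s \<sigma>' by auto
      have cont\<Phi>: "continuous_on UNIV \<Phi>"
        unfolding \<Phi>_def[abs_def] by (intro continuous_intros cont)
      \<comment> \<open>The second solution is the complex conjugate, which solves the same equation
        because \<open>s\<close>, \<open>\<sigma>'\<close> and the potential are real. Equality says
        that the Wronskian of \<open>g a\<close> and \<open>g b\<close> is 0, whereas it equals
        \<open>b $ 2\<close>.\<close>
      have "\<Phi> 0 * cnj (\<Phi>' 0) = \<Phi>' 0 * cnj (\<Phi> 0)"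
      proof (rule no_independent_dual_solutions[OF lam s \<sigma>' cont\<Phi> per\<Phi> \<Phi>,
            where G = "\<lambda>x. cnj (\<Phi> x)" and G' = "\<lambda>x. cnj (\<Phi>' x)"])
        show "continuous_on UNIV (\<lambda>x. cnj (\<Phi> x))" by (intro continuous_intros cont\<Phi>)
        show "cnj (\<Phi> (x + 1)) = \<sigma>' * cnj (\<Phi> x)" for x by (simp add: per\<Phi> cnj_s)
        show "s * cnj (\<Phi> (x + \<alpha>)) = of_real (E\<^sub>0 - 2 * lam * cos (2 * pi * x)) * cnj (\<Phi> x) - cnj (\<Phi>' x)" for x
          using arg_cong[OF \<Phi>(1)[of x], of cnj] by (simp add: cnj_s)
        show "s * cnj (\<Phi>' (x + \<alpha>)) = cnj (\<Phi> x)" for x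
          using arg_cong[OF \<Phi>(2)[of x], of cnj] by (simp add: cnj_s)
      qed
      then have "g a 0 * g' b 0 - g' a 0 * g b 0 = 0"
        by (simp add: \<Phi>_def \<Phi>'_def complex_eq_iff)
      then show False using W[of a 0 b] ab b2pos by simp
    qed
    then show ?thesis ..
  next
    case 3
    define s where "s = T / 2"
    have s: "s = 1 \<or> s = - 1" using 3 by (auto simp: s_def abs_if split: if_splits)
    have tr: "C $ 1 $ 1 + C $ 2 $ 2 = 2 * s" by (simp add: s_def T_def)
    have ss: "s * s = 1" using s by auto
    define e1 e2 :: "real^2" where "e1 = vector [1, 0]" and "e2 = vector [0, 1]"
    \<comment> \<open>The nilpotent part of \<open>s C\<close>: with trace \<open>2 * s\<close> and
      determinant 1, Cayley--Hamilton makes its square zero, which \<open>NN\<close>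
      expresses.\<close>
    define N where "N c = s *\<^sub>R (C *v c) - c" for c
    have NN: "s *\<^sub>R (C *v (N c)) = N c" for c
    proof -
      have "C *v (C *v c) = (2 * s) *\<^sub>R (C *v c) - c"
      proof -
        have "(C *v (C *v c)) $ i - ((2 * s) *\<^sub>R (C *v c) - c) $ i
            = c $ i * (1 - (C $ 1 $ 1 * C $ 2 $ 2 - C $ 1 $ 2 * C $ 2 $ 1))" for i
          using exhaust_2[of i] unfolding tr[symmetric] by (auto simp: C1 C2 algebra_simps)
        then show ?thesis by (simp add: vec_eq_iff det)
      qed
      moreover have "s *\<^sub>R (C *v (N c)) = (s * s) *\<^sub>R (C *v (C *v c)) - s *\<^sub>R (C *v c)"
        by (simp add: N_def matrix_vector_mult_diff_distrib matrix_vector_mult_scaleR scaleR_right_diff_distrib)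
      ultimately show ?thesis
        unfolding ss N_def by (simp add: vec_eq_iff)
    qed
    \<comment> \<open>If \<open>N\<close> were zero, \<open>C\<close> would be the scalar
      \<open>s\<close>, and the two columns of \<open>B\<close> would themselves be independent
      solutions excluded by duality.\<close>
    have "\<exists>d. N d \<noteq> 0"
    proof (rule ccontr)
      assume "\<not> ?thesis"
      then have "s *\<^sub>R (C *v c) = c" for c by (simp add: N_def)
      then have "(s * s) *\<^sub>R (C *v c) = s *\<^sub>R c" for c by (metis scaleR_scaleR)
      then have C: "C *v c = s *\<^sub>R c" for c by (simp add: ss)
      have F: "continuous_on UNIV (\<lambda>x. complex_of_real (g c x))"
        "complex_of_real (g c (x + 1)) = of_real \<sigma> * of_real (g c x)"
        "of_real s * complex_of_real (g c (x + \<alpha>)) = of_real (E\<^sub>0 - 2 * lam * cos (2 * pi * x)) * of_real (g c x) - of_real (g' c x)"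
        "of_real s * complex_of_real (g' c (x + \<alpha>)) = of_real (g c x)" for c x
        using sol[of c x] by (auto simp: per C scale intro!: continuous_intros cont simp flip: of_real_mult of_real_diff)
      have "complex_of_real (g e1 0) * of_real (g' e2 0) = of_real (g' e1 0) * of_real (g e2 0)"
      proof (rule no_independent_dual_solutions[where s = "of_real s" and \<sigma> = "of_real \<sigma>"
            and lam = lam and \<alpha> = \<alpha> and E = E\<^sub>0 and F = "\<lambda>x. of_real (g e1 x)" and F' = "\<lambda>x. of_real (g' e1 x)"
            and G = "\<lambda>x. of_real (g e2 x)" and G' = "\<lambda>x. of_real (g' e2 x)"])
        show "complex_of_real s = 1 \<or> complex_of_real s = - 1" "complex_of_real \<sigma> = 1 \<or> complex_of_real \<sigma> = - 1"
          using s \<sigma> by auto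
      qed (rule lam F)+
      then have "g e1 0 * g' e2 0 - g' e1 0 * g e2 0 = 0"
        by (simp flip: of_real_mult)
      then show False using W[of e1 0 e2] by (simp add: e1_def e2_def)
    qed
    then obtain d where d: "N d \<noteq> 0" by blast
    define c where "c = N d"
    have Cc: "C *v c = s *\<^sub>R c"
      using arg_cong[OF NN[of d], of "\<lambda>v. s *\<^sub>R v"] by (simp add: c_def ss)
    have Cd: "C *v d = s *\<^sub>R d + s *\<^sub>R c"
      by (simp add: c_def N_def scaleR_right_diff_distrib ss)
    \<comment> \<open>The orientation of the Jordan basis \<open>c\<close>, \<open>d\<close>; its
      sign decides on which side of \<open>E\<^sub>0\<close> the gap lies.\<close>
    define w where "w = c $ 1 * d $ 2 - c $ 2 * d $ 1"
    have w: "w \<noteq> 0"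
    proof
      assume "w = 0"
      then obtain k where "d = k *\<^sub>R c" using parallel_2[of c d] d by (auto simp: w_def c_def)
      then have "N d = k *\<^sub>R (s *\<^sub>R (C *v c) - c)"
        by (simp add: N_def matrix_vector_mult_scaleR scaleR_right_diff_distrib)
      then show False using d by (simp add: Cc ss)
    qed
    obtain M where M: "\<And>x. \<bar>g d x\<bar> \<le> M" using bounded by blast
    obtain \<epsilon> where \<epsilon>: "0 < \<epsilon>"
      "\<And>\<delta>. 0 < \<delta> \<Longrightarrow> \<delta> < \<epsilon> \<Longrightarrow> E\<^sub>0 - w * \<delta>\<^sup>2 \<notin> amo_spectrum lam \<alpha> \<theta>"
    proof (rule parabolic_one_sided[OF \<alpha> s w cont(1)[of c] _ M,
          where g' = "g' c" and h' = "g' d" and E = E\<^sub>0 and lam = lam and \<theta> = \<theta>])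
      show "\<bar>g c (x + 1)\<bar> = \<bar>g c x\<bar>" for x using \<sigma> by (auto simp: per)
      show "s * g c (x + \<alpha>) = (E\<^sub>0 - 2 * lam * cos (2 * pi * x)) * g c x - g' c x" "s * g' c (x + \<alpha>) = g c x" for x
        using sol[of c x] by (simp_all add: Cc scale)
      show "s * (g d (x + \<alpha>) + g c (x + \<alpha>)) = (E\<^sub>0 - 2 * lam * cos (2 * pi * x)) * g d x - g' d x"
        "s * (g' d (x + \<alpha>) + g' c (x + \<alpha>)) = g d x" for x
        using sol[of d x] by (simp_all add: Cd lin distrib_left)
      show "g c x * g' d x - g' c x * g d x = w" for x by (simp add: W w_def)
    qed blast
    \<comment> \<open>Taking \<delta> as the square root of \<open>y\<close> shows that the shifts
      fill a whole one-sided interval at \<open>E\<^sub>0\<close>.\<close>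
    have free: "E\<^sub>0 - w * y \<notin> amo_spectrum lam \<alpha> \<theta>" if "0 < y" "y < \<epsilon>\<^sup>2" for y
    proof -
      have "sqrt y < \<epsilon>" using that \<epsilon>(1) real_sqrt_less_mono[of y "\<epsilon>\<^sup>2"] by simp
      then show ?thesis using \<epsilon>(2)[of "sqrt y"] that by simp
    qed
    have e: "0 < \<bar>w\<bar> * \<epsilon>\<^sup>2" using w \<epsilon>(1) by simp
    show ?thesis
    proof (cases "0 < w")
      case True
      show ?thesis
      proof (rule gap_endpoint_left[OF spec e])
        fix x assume "E\<^sub>0 - \<bar>w\<bar> * \<epsilon>\<^sup>2 < x" "x < E\<^sub>0"
        then show "x \<notin> amo_spectrum lam \<alpha> \<theta>"
          using free[of "(E\<^sub>0 - x) / w"] True by (simp add: field_simps)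
      qed
    next
      case False
      then have "w < 0" using w by simp
      show ?thesis
      proof (rule gap_endpoint_right[OF spec e])
        fix x assume "E\<^sub>0 < x" "x < E\<^sub>0 + \<bar>w\<bar> * \<epsilon>\<^sup>2"
        then show "x \<notin> amo_spectrum lam \<alpha> \<theta>"
          using free[of "(E\<^sub>0 - x) / w"] \<open>w < 0\<close> by (simp add: field_simps)
      qed
    qed
  qed
qed

end
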